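(* Let $F^3$ be a (connected, smooth, regular) three-dimensional pseudo-spherical submanifold in $\mathbb{R}^5$, i.e. of constant sectional curvature $-1$, with position vector $x(u_1,u_2,u_3)$ in horospherical coordinates, so that its metric is $ds^2=du_1^2+e^{-2u_1}(du_2^2+du_3^2)$. Suppose that the corresponding Bianchi transformation $\tilde x = x+\frac{\partial x}{\partial u_1}$ is holonomically degenerate of rank 2, and let $\tilde F^2$ be the resulting two-dimensional surface (represented by $\tilde x$). Then $\tilde F^2$ belongs to a three-dimensional (affine) subspace $\mathbb{R}^3\subset\mathbb{R}^5$ and has constant negative Gauss curvature $\tilde K\le -1$. Moreover, the following description holds locally, up to a rigid motion of $\mathbb{R}^5$ and up to an admissible change of the horospherical coordinates (see context): 1) If $\tilde K\equiv -1$, then $F^3$ is represented by the position vector $$x(u_1,u_2,u_3)=\left(\bar x(u_1,u_2),\ e^{-u_1}\cos u_3,\ e^{-u_1}\sin u_3\right),$$ where $\bar x(u_1,u_2)$ is a generic vector-function representing a two-dimensional surface in $\mathbb{R}^3$ with the first fundamental form $$d\bar x^2=(1-e^{-2u_1})\,du_1^2+e^{-2u_1}\,du_2^2.$$ The null-curves of the Bianchi transformation are the parallel straight lines $u_2=\mathrm{const}$ on the coordinate horospheres $u_1=\mathrm{const}$. 2) If $\tilde K<-1$, then $F^3$ is represented by the position vector $$x(v_1,v_2,v_3)=\left(\bar x(v_1,v_2),\ \tfrac1a e^{-v_1}v_2\cos (a v_3),\ \tfrac1a e^{-v_1}v_2\sin (a v_3)\right),$$ where $\bar x(v_1,v_2)$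 is a generic vector-function representing a two-dimensional surface in $\mathbb{R}^3$ with the first fundamental form $$d\bar x^2=\left(1-e^{-2v_1}\tfrac{v_2^2}{a^2}\right)dv_1^2+2e^{-2v_1}\tfrac{v_2}{a^2}\,dv_1dv_2+e^{-2v_1}\left(1-\tfrac1{a^2}\right)dv_2^2,$$ the constant $a>1$ is determined by $\tilde K=-\frac{a^2}{a^2-1}$, and the coordinates $(v_1,v_2,v_3)$ are related to the horospherical coordinates by $u_1=v_1$, $u_2=v_2\cos v_3$, $u_3=v_2\sin v_3$. The null-curves of the Bianchi transformation are the concentric circles $v_2=\mathrm{const}$ on the coordinate horospheres $u_1=\mathrm{const}$. In both cases, "generic" means that the off-diagonal coefficient $\bar b_{12}$ of the second fundamental form of $\bar x$, in the coordinates $(u_1,u_2)$, respectively $(v_1,v_2)$, vanishes nowhere.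
   Context: A pseudo-spherical submanifold $F^n\subset\mathbb{R}^{n+p}$ is a regular submanifold of constant sectional curvature $-1$. Everything is local and smooth: $F^3$ is given by an immersion $x:U\to\mathbb{R}^5$ of a connected open set $U\subset\mathbb{R}^3$ with coordinates $(u_1,u_2,u_3)$, called horospherical, meaning that the induced metric is $du_1^2+e^{-2u_1}(du_2^2+du_3^2)$. The surfaces $u_1=\mathrm{const}$ are (domains on) horospheres; each is flat, with $(u_2,u_3)$ Cartesian coordinates up to scale. The Bianchi transformation of $F^3$ corresponding to the chosen horospherical coordinates is the map $\tilde x=x+\frac{\partial x}{\partial u_1}:U\to\mathbb{R}^5$. It is called degenerate of rank 2 if $\dim\mathrm{span}\{\frac{\partial\tilde x}{\partial u_1},\frac{\partial\tilde x}{\partial u_2},\frac{\partial\tilde x}{\partial u_3}\}=2$ at every point; then $\tilde x$ locally represents a two-dimensional surface $\tilde F^2$. The kernel of the differential of a degenerate rank-2 Bianchi transformation is a one-dimensional distribution on $F^3$, tangent to the horospheres $u_1=\mathrm{const}$; its integral curves are called the null-curves of the Bianchi transformation. Consider three mutually orthogonal one-dimensional distributions on $F^3$: the one spanned by $\xi_1=\frac{\partial x}{\partial u_1}$, the kernel of the Bianchi transformation, spanned by a field $\xi_3$, and the orthogonal complement of these two, spanned by a field $\xi_2$. The degenerate Bianchi transformation is called holonomically degenerate if $[\xi_i,\xi_j]\in\mathrm{span}(\xi_i,\xi_j)$ for all $1\le i<j\le 3$. An admissible change of horospherical coordinates is one of the form $u_1'=u_1+c$, $(u_2',u_3')=e^{c}\,T(u_2,u_3)$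 with $c\in\mathbb{R}$ a constant and $T$ an isometry of the Euclidean plane; it preserves the form of the metric and the vector field $\frac{\partial x}{\partial u_1}$, hence the Bianchi transformation. In case 2), $v_2>0$. For a surface $\bar x$ in $\mathbb{R}^3$ with coordinates $(w_1,w_2)$ and unit normal $\bar n$, $\bar b_{12}=\langle \frac{\partial^2\bar x}{\partial w_1\partial w_2},\bar n\rangle$. *)

theory Defs
  imports "HOL-Analysis.Analysis"
begin

section \<open>Smooth maps and partial derivatives\<close>

text \<open>Intended for open sets. The successor clause asks for Frechet differentiability on the set
  and for all directional derivatives to be one class lower.\<close>

primrec Ck_on :: "nat \<Rightarrow> ('a::real_normed_vector \<Rightarrow> 'b::real_normed_vector) \<Rightarrow> 'a set \<Rightarrow> bool" where
  "Ck_on 0 f U \<longleftrightarrow> continuous_on U f"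
| "Ck_on (Suc k) f U \<longleftrightarrow>
     (\<forall>u\<in>U. f differentiable (at u)) \<and>
     (\<forall>v. Ck_on k (\<lambda>u. frechet_derivative f (at u) v) U)"

definition smooth_on :: "'a set \<Rightarrow> ('a::real_normed_vector \<Rightarrow> 'b::real_normed_vector) \<Rightarrow> bool" where
  "smooth_on U f \<longleftrightarrow> (\<forall>k. Ck_on k f U)"

definition pd :: "'n::finite \<Rightarrow> (real^'n \<Rightarrow> 'b::real_normed_vector) \<Rightarrow> real^'n \<Rightarrow> 'b" where
  "pd i f u = frechet_derivative f (at u) (axis i 1)"

definition immersion_on :: "(real^'n) set \<Rightarrow> (real^'n \<Rightarrow> real^'m) \<Rightarrow> bool" where
  "immersion_on U f \<longleftrightarrow> smooth_on U f \<and> (\<forall>u\<in>U. inj (frechet_derivative f (at u)))"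


section \<open>Induced metric and its curvature\<close>

definition metric :: "(real^'n \<Rightarrow> real^'m) \<Rightarrow> real^'n \<Rightarrow> real^'n^'n" where
  "metric f u = (\<chi> i j. pd i f u \<bullet> pd j f u)"

definition metric_inner :: "(real^'n \<Rightarrow> real^'m) \<Rightarrow> real^'n \<Rightarrow> real^'n \<Rightarrow> real^'n \<Rightarrow> real" where
  "metric_inner f u X Y = (\<Sum>i\<in>UNIV. \<Sum>j\<in>UNIV. metric f u $ i $ j * X $ i * Y $ j)"

text \<open>\<^term>\<open>christoffel f k i j u\<close> is the symbol with upper index \<open>k\<close> and lower indices \<open>i\<close>, \<open>j\<close>.\<close>

definition christoffel :: "(real^'n \<Rightarrow> real^'m) \<Rightarrow> 'n \<Rightarrow> 'n \<Rightarrow> 'n \<Rightarrow> real^'n \<Rightarrow> real" where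
  "christoffel f k i j u =
     (\<Sum>l\<in>UNIV. matrix_inv (metric f u) $ k $ l *
        (pd i (\<lambda>w. metric f w $ j $ l) u + pd j (\<lambda>w. metric f w $ i $ l) u
          - pd l (\<lambda>w. metric f w $ i $ j) u)) / 2"

text \<open>\<open>riemann f l k i j\<close> is the \<open>l\<close>-th component of \<open>R(\<partial>\<^sub>i, \<partial>\<^sub>j)\<partial>\<^sub>k\<close>, where
  \<open>R(X,Y)Z = \<nabla>\<^sub>X\<nabla>\<^sub>Y Z - \<nabla>\<^sub>Y\<nabla>\<^sub>X Z - \<nabla>\<^bsub>[X,Y]\<^esub> Z\<close>; with this sign the sectional curvature is
  \<open>\<langle>R(X,Y)Y,X\<rangle>\<close> divided by the squared area of the parallelogram.\<close>

definition riemann :: "(real^'n \<Rightarrow> real^'m) \<Rightarrow> 'n \<Rightarrow> 'n \<Rightarrow> 'n \<Rightarrow> 'n \<Rightarrow> real^'n \<Rightarrow> real" where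
  "riemann f l k i j u =
     pd i (christoffel f l j k) u - pd j (christoffel f l i k) u
     + (\<Sum>m\<in>UNIV. christoffel f m j k u * christoffel f l i m u
                 - christoffel f m i k u * christoffel f l j m u)"

definition sectional_curvature ::
    "(real^'n \<Rightarrow> real^'m) \<Rightarrow> real^'n \<Rightarrow> real^'n \<Rightarrow> real^'n \<Rightarrow> real" where
  "sectional_curvature f u X Y =
     metric_inner f u (\<chi> l. \<Sum>k\<in>UNIV. \<Sum>i\<in>UNIV. \<Sum>j\<in>UNIV. riemann f l k i j u * X $ i * Y $ j * Y $ k) X
     / (metric_inner f u X X * metric_inner f u Y Y - (metric_inner f u X Y)\<^sup>2)"

definition gauss_curvature :: "(real^2 \<Rightarrow> real^'m) \<Rightarrow> real^2 \<Rightarrow> real" where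
  "gauss_curvature y w = sectional_curvature y w (axis 1 1) (axis 2 1)"

definition pseudospherical_on :: "(real^'n) set \<Rightarrow> (real^'n \<Rightarrow> real^'m) \<Rightarrow> bool" where
  "pseudospherical_on U x \<longleftrightarrow> immersion_on U x \<and>
     (\<forall>u\<in>U. \<forall>X Y. X \<noteq> Y \<and> independent {X, Y} \<longrightarrow> sectional_curvature x u X Y = -1)"

text \<open>The off-diagonal second fundamental form coefficient of a surface in three-space.\<close>

definition unit_normal :: "(real^2 \<Rightarrow> real^3) \<Rightarrow> real^2 \<Rightarrow> real^3" where
  "unit_normal y w = sgn (cross3 (pd 1 y w) (pd 2 y w))"

definition b12 :: "(real^2 \<Rightarrow> real^3) \<Rightarrow> real^2 \<Rightarrow> real" where
  "b12 y w = pd 1 (pd 2 y) w \<bullet> unit_normal y w"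


section \<open>Horospherical coordinates and the Bianchi transformation\<close>

definition horospherical_on :: "(real^3) set \<Rightarrow> (real^3 \<Rightarrow> real^5) \<Rightarrow> bool" where
  "horospherical_on U x \<longleftrightarrow>
     (\<forall>u\<in>U. metric x u = (\<chi> i j. if i \<noteq> j then 0 else if i = 1 then 1 else exp (- 2 * u $ 1)))"

definition bianchi :: "(real^3 \<Rightarrow> real^5) \<Rightarrow> real^3 \<Rightarrow> real^5" where
  "bianchi x u = x u + pd 1 x u"

definition degenerate_rank2_on :: "(real^3) set \<Rightarrow> (real^3 \<Rightarrow> real^5) \<Rightarrow> bool" where
  "degenerate_rank2_on U F \<longleftrightarrow> (\<forall>u\<in>U. dim (span {pd 1 F u, pd 2 F u, pd 3 F u}) = 2)"

definition lie_bracket :: "(real^'n \<Rightarrow> real^'n) \<Rightarrow> (real^'n \<Rightarrow> real^'n) \<Rightarrow> real^'n \<Rightarrow> real^'n" where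
  "lie_bracket X Y u = frechet_derivative Y (at u) (X u) - frechet_derivative X (at u) (Y u)"

text \<open>Tangent fields of the submanifold are written in the coordinates \<open>u\<close>, so the field
  \<open>\<partial>x/\<partial>u\<^sub>1\<close> becomes \<^term>\<open>axis 1 1\<close>. Spanning fields of the distributions are only
  required locally, since a line field need not have a global nonvanishing section; the bracket
  conditions do not depend on the choice of spanning fields.\<close>

definition holonomically_degenerate_on :: "(real^3) set \<Rightarrow> (real^3 \<Rightarrow> real^5) \<Rightarrow> bool" where
  "holonomically_degenerate_on U x \<longleftrightarrow>
     (\<forall>p\<in>U. \<exists>V X1 X2 X3. open V \<and> p \<in> V \<and> V \<subseteq> U \<and>
        smooth_on V X1 \<and> smooth_on V X2 \<and> smooth_on V X3 \<and>
        (\<forall>u\<in>V.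
           X1 u = axis 1 1 \<and>
           X3 u \<noteq> 0 \<and> span {X3 u} = {v. frechet_derivative (bianchi x) (at u) v = 0} \<and>
           X2 u \<noteq> 0 \<and>
           metric_inner x u (X1 u) (X2 u) = 0 \<and>
           metric_inner x u (X1 u) (X3 u) = 0 \<and>
           metric_inner x u (X2 u) (X3 u) = 0 \<and>
           lie_bracket X1 X2 u \<in> span {X1 u, X2 u} \<and>
           lie_bracket X1 X3 u \<in> span {X1 u, X3 u} \<and>
           lie_bracket X2 X3 u \<in> span {X2 u, X3 u}))"

text \<open>A regular parametrization \<open>y\<close> of a piece of the two-dimensional surface represented by a
  map \<open>F\<close> of rank two: \<open>F\<close> factors through \<open>y\<close> on \<open>V\<close>.\<close>

definition local_surface ::
    "(real^3) set \<Rightarrow> (real^3 \<Rightarrow> real^5) \<Rightarrow> (real^3) set \<Rightarrow> (real^3 \<Rightarrow> real^2) \<Rightarrow> (real^2) set \<Rightarrow> (real^2 \<Rightarrow> real^5) \<Rightarrow> bool" where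
  "local_surface U F V \<pi> W y \<longleftrightarrow>
     open V \<and> V \<subseteq> U \<and> open W \<and> smooth_on V \<pi> \<and> \<pi> ` V = W \<and> immersion_on W y \<and>
     (\<forall>u\<in>V. F u = y (\<pi> u))"

definition represents_surface_of_curvature ::
    "(real^3) set \<Rightarrow> (real^3 \<Rightarrow> real^5) \<Rightarrow> real \<Rightarrow> bool" where
  "represents_surface_of_curvature U F K \<longleftrightarrow>
     (\<forall>p\<in>U. \<exists>V \<pi> W y. p \<in> V \<and> local_surface U F V \<pi> W y) \<and>
     (\<forall>V \<pi> W y. local_surface U F V \<pi> W y \<longrightarrow> (\<forall>w\<in>W. gauss_curvature y w = K))"

text \<open>\<open>\<gamma>\<close> is a regular curve in \<open>V\<close>; it is a null-curve of \<open>F\<close> when it is, up to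
  parametrization, an integral curve of the kernel of the differential of \<open>F\<close>.\<close>

definition regular_curve :: "(real^3) set \<Rightarrow> real set \<Rightarrow> (real \<Rightarrow> real^3) \<Rightarrow> bool" where
  "regular_curve V I \<gamma> \<longleftrightarrow> open I \<and> is_interval I \<and> smooth_on I \<gamma> \<and> \<gamma> ` I \<subseteq> V \<and>
     (\<forall>t\<in>I. vector_derivative \<gamma> (at t) \<noteq> 0)"

definition null_curve :: "(real^3 \<Rightarrow> real^5) \<Rightarrow> (real^3) set \<Rightarrow> real set \<Rightarrow> (real \<Rightarrow> real^3) \<Rightarrow> bool" where
  "null_curve F V I \<gamma> \<longleftrightarrow> regular_curve V I \<gamma> \<and>
     (\<forall>t\<in>I. frechet_derivative F (at (\<gamma> t)) (vector_derivative \<gamma> (at t)) = 0)"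


section \<open>Rigid motions and coordinate changes\<close>

definition rigid_motion :: "(real^'n \<Rightarrow> real^'n) \<Rightarrow> bool" where
  "rigid_motion g \<longleftrightarrow> (\<exists>Q b. rotation_matrix Q \<and> g = (\<lambda>y. Q *v y + b))"

definition admissible_change :: "(real^3 \<Rightarrow> real^3) \<Rightarrow> bool" where
  "admissible_change \<phi> \<longleftrightarrow>
     (\<exists>c (T :: real^2 \<Rightarrow> real^2). (\<forall>p q. dist (T p) (T q) = dist p q) \<and>
        (\<forall>u. \<phi> u = vector [u $ 1 + c,
                         exp c * T (vector [u $ 2, u $ 3]) $ 1,
                         exp c * T (vector [u $ 2, u $ 3]) $ 2]))"

text \<open>The point of five-space with the given first three, fourth and fifth coordinates.\<close>

definition point5 :: "real^3 \<Rightarrow> real \<Rightarrow> real \<Rightarrow> real^5" where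
  "point5 y p q = vector [y $ 1, y $ 2, y $ 3, p, q]"

definition polar_coords :: "real^3 \<Rightarrow> real^3" where
  "polar_coords v = vector [v $ 1, v $ 2 * cos (v $ 3), v $ 2 * sin (v $ 3)]"

definition first_two :: "real^3 \<Rightarrow> real^2" where
  "first_two v = vector [v $ 1, v $ 2]"

text \<open>\<open>x'\<close> denotes the position vector after the rigid motion \<open>g\<close>, \<open>\<phi> u\<close> the new horospherical
  coordinates. Since \<^term>\<open>first_two\<close> is an open map, \<open>W\<close> below is an open subset of the plane.\<close>

definition line_form_on :: "(real^3) set \<Rightarrow> (real^3 \<Rightarrow> real^5) \<Rightarrow> bool" where
  "line_form_on V x \<longleftrightarrow>
     (\<exists>g \<phi> W xbar. rigid_motion g \<and> admissible_change \<phi> \<and>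
        W = (\<lambda>u. first_two (\<phi> u)) ` V \<and> immersion_on W xbar \<and>
        (\<forall>u\<in>V. let u' = \<phi> u in
           g (x u) = point5 (xbar (first_two u'))
                       (exp (- u' $ 1) * cos (u' $ 3)) (exp (- u' $ 1) * sin (u' $ 3))) \<and>
        (\<forall>w\<in>W. metric xbar w $ 1 $ 1 = 1 - exp (- 2 * w $ 1) \<and>
               metric xbar w $ 1 $ 2 = 0 \<and>
               metric xbar w $ 2 $ 2 = exp (- 2 * w $ 1) \<and>
               b12 xbar w \<noteq> 0) \<and>
        (\<forall>I \<gamma>. regular_curve V I \<gamma> \<longrightarrow>
           (null_curve (bianchi x) V I \<gamma> \<longleftrightarrow> (\<lambda>t. first_two (\<phi> (\<gamma> t))) constant_on I)))"

text \<open>\<open>\<psi> u = v\<close> are the polar coordinates of the new horospherical coordinates \<open>\<phi> u\<close>; being a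
  smooth branch of the inverse of \<^term>\<open>polar_coords\<close> composed with the affine bijection \<open>\<phi>\<close>,
  \<open>\<psi>\<close> is a coordinate system on \<open>V\<close>.\<close>

definition circle_form_on :: "real \<Rightarrow> (real^3) set \<Rightarrow> (real^3 \<Rightarrow> real^5) \<Rightarrow> bool" where
  "circle_form_on a V x \<longleftrightarrow>
     (\<exists>g \<phi> \<psi> W xbar. rigid_motion g \<and> admissible_change \<phi> \<and>
        smooth_on V \<psi> \<and> (\<forall>u\<in>V. \<psi> u $ 2 > 0 \<and> \<phi> u = polar_coords (\<psi> u)) \<and>
        W = (\<lambda>u. first_two (\<psi> u)) ` V \<and> immersion_on W xbar \<and>
        (\<forall>u\<in>V. let v = \<psi> u in
           g (x u) = point5 (xbar (first_two v))
                       (1 / a * exp (- v $ 1) * v $ 2 * cos (a * v $ 3))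
                       (1 / a * exp (- v $ 1) * v $ 2 * sin (a * v $ 3))) \<and>
        (\<forall>w\<in>W. metric xbar w $ 1 $ 1 = 1 - exp (- 2 * w $ 1) * ((w $ 2)\<^sup>2 / a\<^sup>2) \<and>
               metric xbar w $ 1 $ 2 = exp (- 2 * w $ 1) * (w $ 2 / a\<^sup>2) \<and>
               metric xbar w $ 2 $ 2 = exp (- 2 * w $ 1) * (1 - 1 / a\<^sup>2) \<and>
               b12 xbar w \<noteq> 0) \<and>
        (\<forall>I \<gamma>. regular_curve V I \<gamma> \<longrightarrow>
           (null_curve (bianchi x) V I \<gamma> \<longleftrightarrow> (\<lambda>t. first_two (\<psi> (\<gamma> t))) constant_on I)))"

end

theory Submission
  imports Defs
begin

text \<open>Let \<open>\<xi>3\<close> be the kernel field, normalised to be a Euclidean unit vector in \<open>(u2, u3)\<close>, and let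
  \<open>\<xi>2\<close> be orthogonal to it. Holonomy makes both independent of \<open>u1\<close>, and then so is the unit
  tangent vector \<open>E3 = exp u1 * \<partial>x/\<partial>\<xi>3\<close>. Differentiating inner products with \<open>E3\<close> and with its
  derivative \<open>f\<close> along \<open>\<xi>3\<close> in the direction \<open>u1\<close> yields everything needed from the
  Gauss--Codazzi equations: \<open>E3\<close> is constant along \<open>\<xi>2\<close>, the integral curves of \<open>\<xi>2\<close> are straight
  lines of the horospheres, the curvature \<open>\<kappa>\<close> of the null curves is constant along them, and
  the derivative of \<open>f\<close> along \<open>\<xi>3\<close> is \<open>- |f|^2 E3\<close>. Hence \<open>E3\<close> and \<open>f/|f|\<close> rotate in a fixed plane
  to which the transformed surface is orthogonal, and \<open>\<kappa>^2 / |f|^2 = m\<close> is a constant below 1.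
  The vector \<open>\<kappa> / |f|^2 * f + E2\<close> is normal to the surface, which gives \<open>K = -1 / (1 - m)\<close>.
  The component of \<open>x\<close> in the plane is, up to a constant, \<open>exp (- u1) / |f|\<close> times a unit vector
  rotating with speed \<open>|f|\<close> along the null curves; these are parallel lines if \<open>m = 0\<close> and
  concentric circles of radius \<open>1 / \<kappa>\<close> otherwise.\<close>

section \<open>Calculus of smooth maps\<close>

text \<open>The engine is a contrast: \<open>E3\<close>, \<open>f\<close>, \<open>\<kappa>\<close>
  and \<open>\<kappa>2\<close> do not change with \<open>u1\<close>, whereas the
  \<open>u1\<close>-derivative of \<open>E2\<close> is \<open>exp u1\<close> times \<open>B\<close>,
  the derivative of the transformed map across its kernel, which is nonzero because that kernel is
  only a line. A \<open>u1\<close>-independent vector, all of whose other parts are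
  \<open>u1\<close>-independent too, can therefore have no component along \<open>E2\<close>; this
  kills \<open>\<kappa>2\<close> and the derivative of \<open>\<kappa>\<close> along the null
  curves. The same \<open>B\<close> accounts for genericity: up to a constant factor its image in
  the three-space is the normal part of the mixed second derivative of \<open>xbar\<close>. The
  constant \<open>a = 1 / sqrt m\<close> is \<open>|f| / \<kappa>\<close>, the speed of rotation in
  the fixed plane of five-space divided by the speed of turning in the horosphere. The obstacle to a
  global statement is that the unit kernel field exists only locally and only up to sign, and
  \<open>\<kappa>\<close> changes sign with it. Constancy on \<open>U\<close> is therefore proved
  for \<open>\<kappa>^2 / |f|^2\<close> and for the orthogonal projection onto the plane, which do
  not feel the sign.\<close>

lemma Ck_on_cong:
  assumes "open U" "\<And>u. u \<in> U \<Longrightarrow> f u = g u"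
  shows "Ck_on k f U \<longleftrightarrow> Ck_on k g U"
  using assms(2)
proof (induction k arbitrary: f g)
  case 0
  then show ?case by (simp cong: continuous_on_cong)
next
  case (Suc k)
  have d: "f differentiable (at u) \<longleftrightarrow> g differentiable (at u)" if "u \<in> U" for u
    using has_derivative_transform_within_open[OF _ assms(1) that, of f _ UNIV g]
      has_derivative_transform_within_open[OF _ assms(1) that, of g _ UNIV f] Suc.prems
    unfolding differentiable_def by metis
  have D: "frechet_derivative f (at u) = frechet_derivative g (at u)"
    if "u \<in> U" "f differentiable (at u)" for u
    using frechet_derivative_transform_within_open[OF that(2) assms(1) that(1)] Suc.prems by blast
  have "Ck_on k (\<lambda>u. frechet_derivative f (at u) v) U \<longleftrightarrow> Ck_on k (\<lambda>u. frechet_derivative g (at u) v) U"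
    if "\<forall>u\<in>U. f differentiable (at u)" for v
    using that D by (intro Suc.IH) auto
  then show ?case
    unfolding Ck_on.simps using d by blast
qed

lemma Ck_on_Suc_imp: "Ck_on (Suc k) f U \<Longrightarrow> Ck_on k f U"
proof (induction k arbitrary: f)
  case 0
  then show ?case
    by (simp add: continuous_at_imp_continuous_on differentiable_imp_continuous_within)
next
  case (Suc k)
  show ?case
    unfolding Ck_on.simps(2)[of k]
  proof (intro conjI allI)
    show "\<forall>u\<in>U. f differentiable (at u)"
      using Suc.prems unfolding Ck_on.simps(2)[of "Suc k"] by blast
    show "Ck_on k (\<lambda>u. frechet_derivative f (at u) v) U" for v
      using Suc.prems Suc.IH unfolding Ck_on.simps(2)[of "Suc k"] by blast
  qed
qed

lemma Ck_on_has_derivative: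
  "Ck_on (Suc k) f U \<Longrightarrow> u \<in> U \<Longrightarrow> (f has_derivative frechet_derivative f (at u)) (at u)"
  by (simp add: frechet_derivative_works)

lemma Ck_on_subset: "Ck_on k f U \<Longrightarrow> V \<subseteq> U \<Longrightarrow> Ck_on k f V"
  by (induction k arbitrary: f) (auto intro: continuous_on_subset)

lemma Ck_on_SucI:
  assumes "open U" "\<And>u. u \<in> U \<Longrightarrow> (f has_derivative F u) (at u)"
    and "\<And>v. Ck_on k (\<lambda>u. F u v) U"
  shows "Ck_on (Suc k) f U"
proof -
  have "frechet_derivative f (at u) = F u" if "u \<in> U" for u
    using frechet_derivative_at assms(2)[OF that] by metis
  then have "Ck_on k (\<lambda>u. frechet_derivative f (at u) v) U" for v
    using assms(3)[of v] Ck_on_cong[OF assms(1), of "\<lambda>u. frechet_derivative f (at u) v" "\<lambda>u. F u v"]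
    by simp
  then show ?thesis
    using assms(2) by (auto simp: differentiable_def)
qed

lemma Ck_on_const: "Ck_on k (\<lambda>u. a) U"
  by (induction k arbitrary: a) auto

lemma Ck_on_bounded_linear:
  assumes "bounded_linear L" "open U" "Ck_on k f U"
  shows "Ck_on k (\<lambda>u. L (f u)) U"
  using assms(3)
proof (induction k arbitrary: f)
  case 0
  then show ?case
    using bounded_linear.continuous_on[OF assms(1)] by simp
next
  case (Suc k)
  show ?case
  proof (rule Ck_on_SucI[OF assms(2)])
    show "((\<lambda>u. L (f u)) has_derivative (\<lambda>v. L (frechet_derivative f (at u) v))) (at u)"
      if "u \<in> U" for u
      using bounded_linear.has_derivative[OF assms(1) Ck_on_has_derivative[OF Suc.prems that]] .
    show "Ck_on k (\<lambda>u. L (frechet_derivative f (at u) v)) U" for v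
      using Suc by auto
  qed
qed

lemma Ck_on_add:
  assumes "open U" "Ck_on k f U" "Ck_on k g U"
  shows "Ck_on k (\<lambda>u. f u + g u) U"
  using assms(2,3)
proof (induction k arbitrary: f g)
  case 0
  then show ?case by (simp add: continuous_on_add)
next
  case (Suc k)
  show ?case
  proof (rule Ck_on_SucI[OF assms(1)])
    show "((\<lambda>u. f u + g u) has_derivative
        (\<lambda>v. frechet_derivative f (at u) v + frechet_derivative g (at u) v)) (at u)"
      if "u \<in> U" for u
      using has_derivative_add[OF Suc.prems[THEN Ck_on_has_derivative, OF that]] .
    show "Ck_on k (\<lambda>u. frechet_derivative f (at u) v + frechet_derivative g (at u) v) U" for v
      using Suc by auto
  qed
qed

lemma Ck_on_sum:
  assumes "open U" "\<And>i. i \<in> I \<Longrightarrow> Ck_on k (f i) U"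
  shows "Ck_on k (\<lambda>u. \<Sum>i\<in>I. f i u) U"
  using assms(2)
  by (induction I rule: infinite_finite_induct) (auto intro: Ck_on_const Ck_on_add[OF assms(1)])

lemma Ck_on_bounded_bilinear:
  assumes "bounded_bilinear B" "open U" "Ck_on k f U" "Ck_on k g U"
  shows "Ck_on k (\<lambda>u. B (f u) (g u)) U"
  using assms(3,4)
proof (induction k arbitrary: f g)
  case 0
  then show ?case using bounded_bilinear.continuous_on[OF assms(1)] by simp
next
  case (Suc k)
  show ?case
  proof (rule Ck_on_SucI[OF assms(2)])
    show "((\<lambda>u. B (f u) (g u)) has_derivative
        (\<lambda>v. B (f u) (frechet_derivative g (at u) v) + B (frechet_derivative f (at u) v) (g u))) (at u)"
      if "u \<in> U" for u
      using bounded_bilinear.FDERIV[OF assms(1) Suc.prems[THEN Ck_on_has_derivative, OF that]] .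
    show "Ck_on k (\<lambda>u. B (f u) (frechet_derivative g (at u) v) + B (frechet_derivative f (at u) v) (g u)) U" for v
      using Suc.prems Suc.prems[THEN Ck_on_Suc_imp]
      by (intro Ck_on_add[OF assms(2)] Suc.IH) auto
  qed
qed

text \<open>\<open>Ck_on\<close> controls derivatives in fixed directions only, while the chain rule
  evaluates the derivative of \<open>g\<close> in a moving direction. Expanding that direction in
  the basis of the middle space gives a finite sum of products of controlled factors; hence the
  Euclidean middle type.\<close>

lemma Ck_on_compose:
  fixes f :: "'a::real_normed_vector \<Rightarrow> 'b::euclidean_space" and g :: "'b \<Rightarrow> 'c::real_normed_vector"
  assumes "open U" "open S" "f ` U \<subseteq> S" "Ck_on k f U" "Ck_on k g S"
  shows "Ck_on k (\<lambda>u. g (f u)) U"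
  using assms(4,5)
proof (induction k arbitrary: g)
  case 0
  then show ?case using continuous_on_compose2 assms(3) by (metis Ck_on.simps(1))
next
  case (Suc k)
  let ?Df = "\<lambda>u. frechet_derivative f (at u)" and ?Dg = "\<lambda>y. frechet_derivative g (at y)"
  show ?case
  proof (rule Ck_on_SucI[OF assms(1)])
    fix u assume u: "u \<in> U"
    have f: "(f has_derivative ?Df u) (at u)" and g: "(g has_derivative ?Dg (f u)) (at (f u))"
      using Suc.prems u assms(3) by (auto simp flip: frechet_derivative_works)
    have "?Dg (f u) (?Df u v) = (\<Sum>b\<in>Basis. (?Df u v \<bullet> b) *\<^sub>R ?Dg (f u) b)" for v
      using has_derivative_linear[OF g]
      by (subst (1) euclidean_representation[symmetric, of "?Df u v"]) (simp add: linear_sum linear_cmul)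
    then show "((\<lambda>u. g (f u)) has_derivative (\<lambda>v. \<Sum>b\<in>Basis. (?Df u v \<bullet> b) *\<^sub>R ?Dg (f u) b)) (at u)"
      using has_derivative_compose[OF f g] by presburger
  next
    fix v
    have "Ck_on k (\<lambda>u. ?Df u v) U" "\<And>b. Ck_on k (\<lambda>u. ?Dg (f u) b) U"
      using Suc.prems Suc.IH[OF Ck_on_Suc_imp[OF Suc.prems(1)], of "\<lambda>y. ?Dg y _"] by auto
    then show "Ck_on k (\<lambda>u. \<Sum>b\<in>Basis. (?Df u v \<bullet> b) *\<^sub>R ?Dg (f u) b) U"
      by (intro Ck_on_sum assms(1) Ck_on_bounded_bilinear[OF bounded_bilinear_scaleR] Ck_on_bounded_linear[OF bounded_linear_inner_left])
  qed
qed

lemma smooth_on_cong: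
  "open U \<Longrightarrow> (\<And>u. u \<in> U \<Longrightarrow> f u = g u) \<Longrightarrow> smooth_on U f \<longleftrightarrow> smooth_on U g"
  unfolding smooth_on_def using Ck_on_cong by blast

lemma smooth_on_subset: "smooth_on U f \<Longrightarrow> V \<subseteq> U \<Longrightarrow> smooth_on V f"
  unfolding smooth_on_def using Ck_on_subset by blast

lemma smooth_on_differentiable: "smooth_on U f \<Longrightarrow> u \<in> U \<Longrightarrow> f differentiable (at u)"
  unfolding smooth_on_def by (metis Ck_on.simps(2))

lemma smooth_on_has_derivative:
  "smooth_on U f \<Longrightarrow> u \<in> U \<Longrightarrow> (f has_derivative frechet_derivative f (at u)) (at u)"
  using smooth_on_differentiable frechet_derivative_works by blast

lemma smooth_on_continuous: "smooth_on U f \<Longrightarrow> continuous_on U f"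
  unfolding smooth_on_def by (metis Ck_on.simps(1))

lemma smooth_on_frechet: "smooth_on U f \<Longrightarrow> smooth_on U (\<lambda>u. frechet_derivative f (at u) v)"
  unfolding smooth_on_def by (metis Ck_on.simps(2))

text \<open>Bootstrapping for functions such as \<open>exp\<close>, \<open>inverse\<close> and
  \<open>sqrt\<close>, whose derivatives are expressed through the functions themselves: order
  \<open>k\<close> yields order \<open>k + 1\<close>.\<close>

lemma smooth_onI:
  assumes "\<And>k. Ck_on k f U \<Longrightarrow> Ck_on (Suc k) f U" and "continuous_on U f"
  shows "smooth_on U f"
  unfolding smooth_on_def
proof
  show "Ck_on k f U" for k
    using assms by (induction k) (auto simp del: Ck_on.simps(2))
qed

named_theorems smooth_intros

lemma smooth_on_const [smooth_intros]: "smooth_on U (\<lambda>u. a)"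
  by (simp add: smooth_on_def Ck_on_const)

lemma smooth_on_ident [smooth_intros]: "smooth_on U (\<lambda>u. u)"
  unfolding smooth_on_def
proof
  fix k show "Ck_on k (\<lambda>u. u) U"
    by (cases k) (auto simp: Ck_on_const)
qed

lemma smooth_on_linear:
  "bounded_linear L \<Longrightarrow> open U \<Longrightarrow> smooth_on U f \<Longrightarrow> smooth_on U (\<lambda>u. L (f u))"
  unfolding smooth_on_def using Ck_on_bounded_linear by blast

lemma smooth_on_bilinear:
  "bounded_bilinear B \<Longrightarrow> open U \<Longrightarrow> smooth_on U f \<Longrightarrow> smooth_on U g \<Longrightarrow> smooth_on U (\<lambda>u. B (f u) (g u))"
  unfolding smooth_on_def using Ck_on_bounded_bilinear by blast

lemma smooth_on_compose:
  fixes f :: "'a::real_normed_vector \<Rightarrow> 'b::euclidean_space" and g :: "'b \<Rightarrow> 'c::real_normed_vector"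
  assumes "open U" "open S" "f ` U \<subseteq> S" "smooth_on U f" "smooth_on S g"
  shows "smooth_on U (\<lambda>u. g (f u))"
  using assms Ck_on_compose unfolding smooth_on_def by blast

lemma smooth_on_add [smooth_intros]:
  "open U \<Longrightarrow> smooth_on U f \<Longrightarrow> smooth_on U g \<Longrightarrow> smooth_on U (\<lambda>u. f u + g u)"
  unfolding smooth_on_def using Ck_on_add by blast

lemma smooth_on_sum [smooth_intros]:
  "open U \<Longrightarrow> (\<And>i. i \<in> I \<Longrightarrow> smooth_on U (f i)) \<Longrightarrow> smooth_on U (\<lambda>u. \<Sum>i\<in>I. f i u)"
  unfolding smooth_on_def by (simp add: Ck_on_sum)

lemma smooth_on_minus [smooth_intros]:
  "open U \<Longrightarrow> smooth_on U f \<Longrightarrow> smooth_on U (\<lambda>u. - f u)"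
  by (rule smooth_on_linear[OF bounded_linear_minus[OF bounded_linear_ident]])

lemma smooth_on_diff [smooth_intros]:
  "open U \<Longrightarrow> smooth_on U f \<Longrightarrow> smooth_on U g \<Longrightarrow> smooth_on U (\<lambda>u. f u - g u)"
  using smooth_on_add[OF _ _ smooth_on_minus, of U f g] by simp

lemma smooth_on_scaleR [smooth_intros]:
  "open U \<Longrightarrow> smooth_on U f \<Longrightarrow> smooth_on U g \<Longrightarrow> smooth_on U (\<lambda>u. f u *\<^sub>R g u)"
  by (rule smooth_on_bilinear[OF bounded_bilinear_scaleR])

lemma smooth_on_mult [smooth_intros]:
  fixes f g :: "'a::real_normed_vector \<Rightarrow> real"
  shows "open U \<Longrightarrow> smooth_on U f \<Longrightarrow> smooth_on U g \<Longrightarrow> smooth_on U (\<lambda>u. f u * g u)"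
  by (rule smooth_on_bilinear[OF bounded_bilinear_mult])

lemma smooth_on_inner [smooth_intros]:
  "open U \<Longrightarrow> smooth_on U f \<Longrightarrow> smooth_on U g \<Longrightarrow> smooth_on U (\<lambda>u. f u \<bullet> g u)"
  by (rule smooth_on_bilinear[OF bounded_bilinear_inner])

lemma smooth_on_nth [smooth_intros]:
  "open U \<Longrightarrow> smooth_on U f \<Longrightarrow> smooth_on U (\<lambda>u. f u $ i)"
  by (rule smooth_on_linear[OF bounded_linear_vec_nth])

lemma Ck_on_real_SucI:
  fixes f :: "real \<Rightarrow> real"
  assumes "open S" "\<And>t. t \<in> S \<Longrightarrow> (f has_real_derivative f' t) (at t)" "Ck_on k f' S"
  shows "Ck_on (Suc k) f S"
proof (rule Ck_on_SucI[where F = "\<lambda>t v. f' t * v", OF assms(1)])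
  show "Ck_on k (\<lambda>t. f' t * v) S" for v
    by (rule Ck_on_bounded_linear[OF bounded_linear_mult_left assms(1,3)])
qed (use assms(2) in \<open>simp add: has_field_derivative_def\<close>)

lemma smooth_on_exp_UNIV: "smooth_on UNIV (exp :: real \<Rightarrow> real)"
proof (rule smooth_onI)
  show "Ck_on (Suc k) (exp :: real \<Rightarrow> real) UNIV" if "Ck_on k (exp :: real \<Rightarrow> real) UNIV" for k
    by (rule Ck_on_real_SucI[OF open_UNIV DERIV_exp that])
qed (intro continuous_intros)

text \<open>The two functions share one induction because each is, up to sign, the derivative of the
  other.\<close>

lemma Ck_on_sin_cos: "Ck_on k (sin :: real \<Rightarrow> real) UNIV \<and> Ck_on k (cos :: real \<Rightarrow> real) UNIV"
proof (induction k)
  case 0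
  have "continuous_on UNIV (sin :: real \<Rightarrow> real)" "continuous_on UNIV (cos :: real \<Rightarrow> real)"
    by (intro continuous_intros)+
  then show ?case by simp
next
  case (Suc k)
  have "Ck_on k (\<lambda>t::real. - sin t) UNIV"
    using Suc by (intro Ck_on_bounded_linear[OF bounded_linear_minus[OF bounded_linear_ident] open_UNIV]) blast
  then have "Ck_on (Suc k) (cos :: real \<Rightarrow> real) UNIV"
    by (rule Ck_on_real_SucI[OF open_UNIV DERIV_cos])
  moreover have "Ck_on (Suc k) (sin :: real \<Rightarrow> real) UNIV"
    using Suc by (intro Ck_on_real_SucI[OF open_UNIV DERIV_sin]) blast
  ultimately show ?case by blast
qed

lemma smooth_on_inverse_nz: "smooth_on (- {0}) (inverse :: real \<Rightarrow> real)"
proof (rule smooth_onI)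
  fix k assume k: "Ck_on k (inverse :: real \<Rightarrow> real) (- {0})"
  have "Ck_on k (\<lambda>t::real. - (inverse t * inverse t)) (- {0})"
    using k by (simp add: Ck_on_bounded_linear[OF bounded_linear_minus[OF bounded_linear_ident]]
        Ck_on_bounded_bilinear[OF bounded_bilinear_mult] open_Compl)
  then show "Ck_on (Suc k) (inverse :: real \<Rightarrow> real) (- {0})"
    by (rule Ck_on_real_SucI[rotated 2]) (use DERIV_inverse in \<open>auto simp: power2_eq_square open_Compl\<close>)
qed (intro continuous_intros, auto)

lemma smooth_on_inverse [smooth_intros]:
  fixes f :: "'a::real_normed_vector \<Rightarrow> real"
  assumes "open U" "smooth_on U f" "\<And>u. u \<in> U \<Longrightarrow> f u \<noteq> 0"
  shows "smooth_on U (\<lambda>u. inverse (f u))"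
  by (rule smooth_on_compose[OF assms(1) _ _ assms(2) smooth_on_inverse_nz])
    (use assms(3) in \<open>auto simp: open_Compl\<close>)

lemma smooth_on_divide [smooth_intros]:
  fixes f :: "'a::real_normed_vector \<Rightarrow> real"
  assumes "open U" "smooth_on U f" "smooth_on U g" "\<And>u. u \<in> U \<Longrightarrow> g u \<noteq> 0"
  shows "smooth_on U (\<lambda>u. f u / g u)"
  unfolding divide_inverse using assms by (auto intro!: smooth_intros)

lemma smooth_on_exp [smooth_intros]:
  "open U \<Longrightarrow> smooth_on U f \<Longrightarrow> smooth_on U (\<lambda>u. exp (f u :: real))"
  by (rule smooth_on_compose[OF _ open_UNIV subset_UNIV _ smooth_on_exp_UNIV])

lemma smooth_on_sin [smooth_intros]:
  "open U \<Longrightarrow> smooth_on U f \<Longrightarrow> smooth_on U (\<lambda>u. sin (f u :: real))"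
  by (rule smooth_on_compose[OF _ open_UNIV subset_UNIV, where g = sin])
    (simp_all add: smooth_on_def Ck_on_sin_cos)

lemma smooth_on_cos [smooth_intros]:
  "open U \<Longrightarrow> smooth_on U f \<Longrightarrow> smooth_on U (\<lambda>u. cos (f u :: real))"
  by (rule smooth_on_compose[OF _ open_UNIV subset_UNIV, where g = cos])
    (simp_all add: smooth_on_def Ck_on_sin_cos)

lemma smooth_on_arctan [smooth_intros]:
  assumes "open U" "smooth_on U f"
  shows "smooth_on U (\<lambda>u. arctan (f u))"
proof (rule smooth_on_compose[OF assms(1) open_UNIV _ assms(2)])
  have "smooth_on UNIV (\<lambda>t::real. inverse (1 + t * t))"
    by (intro smooth_intros) (auto simp: add_nonneg_eq_0_iff)
  then show "smooth_on UNIV arctan"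
    by (intro smooth_onI, intro Ck_on_real_SucI[OF open_UNIV DERIV_arctan])
      (simp_all add: smooth_on_def power2_eq_square continuous_on_arctan)
qed simp

lemma smooth_on_sqrt [smooth_intros]:
  fixes f :: "'a::real_normed_vector \<Rightarrow> real"
  assumes "open U" "smooth_on U f" "\<And>u. u \<in> U \<Longrightarrow> f u > 0"
  shows "smooth_on U (\<lambda>u. sqrt (f u))"
proof (rule smooth_on_compose[OF assms(1) open_greaterThan _ assms(2)])
  show "smooth_on {0<..} sqrt"
  proof (rule smooth_onI)
    fix k assume k: "Ck_on k sqrt {0<..}"
    have "Ck_on k (\<lambda>t. inverse (sqrt t)) {0<..}"
    proof (rule Ck_on_compose[where S = "- {0}" and f = sqrt and g = inverse])
      show "Ck_on k (inverse :: real \<Rightarrow> real) (- {0})"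
        using smooth_on_inverse_nz unfolding smooth_on_def by blast
    qed (auto intro: k)
    then have "Ck_on k (\<lambda>t. inverse (sqrt t) / 2) {0<..}"
      by (rule Ck_on_bounded_linear[OF bounded_linear_divide open_greaterThan, where f = "\<lambda>t. inverse (sqrt t)"])
    then show "Ck_on (Suc k) sqrt {0<..}"
      by (rule Ck_on_real_SucI[OF open_greaterThan DERIV_real_sqrt, rotated]) (simp only: greaterThan_iff)
  qed (intro continuous_intros)
qed (use assms in auto)

subsection \<open>Symmetry of second derivatives and commutators of vector fields\<close>

lemma has_real_derivative_along_line:
  fixes f :: "'a::real_normed_vector \<Rightarrow> real"
  assumes "f differentiable (at (p + r *\<^sub>R v))"
  shows "((\<lambda>r. f (p + r *\<^sub>R v)) has_real_derivative frechet_derivative f (at (p + r *\<^sub>R v)) v) (at r)"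
proof -
  let ?D = "frechet_derivative f (at (p + r *\<^sub>R v))"
  have "(f has_derivative ?D) (at (p + r *\<^sub>R v))"
    using assms frechet_derivative_works by blast
  moreover have "((\<lambda>r. p + r *\<^sub>R v) has_derivative (\<lambda>t. t *\<^sub>R v)) (at r)"
    by (auto intro!: derivative_eq_intros)
  ultimately have "((\<lambda>r. f (p + r *\<^sub>R v)) has_derivative (\<lambda>t. ?D (t *\<^sub>R v))) (at r)"
    by (rule has_derivative_compose[rotated])
  moreover have "?D (t *\<^sub>R v) = ?D v * t" for t
    using linear_frechet_derivative[OF assms] by (simp add: linear_cmul)
  ultimately show ?thesis
    by (simp add: has_field_derivative_def)
qed

text \<open>The mean value theorem is applied along \<open>v\<close> to the difference over
  \<open>w\<close>, then along \<open>w\<close> to the derivative. The left side of the equation is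
  symmetric in \<open>v\<close> and \<open>w\<close>, which is the source of the symmetry of second
  derivatives.\<close>

lemma second_difference_mean_value:
  fixes f :: "'a::real_normed_vector \<Rightarrow> real"
  assumes "t > 0" "smooth_on U f"
    and U: "\<And>a b. 0 \<le> a \<Longrightarrow> a \<le> t \<Longrightarrow> 0 \<le> b \<Longrightarrow> b \<le> t \<Longrightarrow> u + a *\<^sub>R v + b *\<^sub>R w \<in> U"
  obtains a b where "0 < a" "a < t" "0 < b" "b < t"
    "f (u + t *\<^sub>R v + t *\<^sub>R w) - f (u + t *\<^sub>R v) - f (u + t *\<^sub>R w) + f u =
      t * t * frechet_derivative (\<lambda>z. frechet_derivative f (at z) v) (at (u + a *\<^sub>R v + b *\<^sub>R w)) w"
proof -
  let ?A = "\<lambda>z. frechet_derivative f (at z) v"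
  have sA: "smooth_on U ?A" by (rule smooth_on_frechet[OF assms(2)])
  have "((\<lambda>r. f ((u + t *\<^sub>R w) + r *\<^sub>R v) - f (u + r *\<^sub>R v)) has_real_derivative
      ?A ((u + t *\<^sub>R w) + r *\<^sub>R v) - ?A (u + r *\<^sub>R v)) (at r)" if "0 \<le> r" "r \<le> t" for r
    using U[of r t] U[of r 0] that assms(1)
    by (intro DERIV_diff has_real_derivative_along_line smooth_on_differentiable[OF assms(2)])
      (simp_all add: algebra_simps)
  from MVT2[OF assms(1) this] obtain a where a: "0 < a" "a < t"
    "f ((u + t *\<^sub>R w) + t *\<^sub>R v) - f (u + t *\<^sub>R v) - (f (u + t *\<^sub>R w) - f u) =
      t * (?A ((u + t *\<^sub>R w) + a *\<^sub>R v) - ?A (u + a *\<^sub>R v))"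
    by auto
  have "((\<lambda>r. ?A ((u + a *\<^sub>R v) + r *\<^sub>R w)) has_real_derivative
      frechet_derivative ?A (at ((u + a *\<^sub>R v) + r *\<^sub>R w)) w) (at r)" if "0 \<le> r" "r \<le> t" for r
    using U[of a r] that a
    by (intro has_real_derivative_along_line smooth_on_differentiable[OF sA]) simp
  from MVT2[OF assms(1) this] obtain b where b: "0 < b" "b < t"
    "?A ((u + a *\<^sub>R v) + t *\<^sub>R w) - ?A (u + a *\<^sub>R v) =
      t * frechet_derivative ?A (at ((u + a *\<^sub>R v) + b *\<^sub>R w)) w"
    by auto
  have e: "(u + t *\<^sub>R w) + r *\<^sub>R v = (u + r *\<^sub>R v) + t *\<^sub>R w" for r
    by (simp add: algebra_simps)
  show ?thesis
    using a b by (intro that[of a b]) (simp_all add: e)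
qed

lemma symmetric_second_derivative_real:
  fixes f :: "'a::real_normed_vector \<Rightarrow> real"
  assumes "open U" "smooth_on U f" "u \<in> U"
  shows "frechet_derivative (\<lambda>z. frechet_derivative f (at z) v) (at u) w =
    frechet_derivative (\<lambda>z. frechet_derivative f (at z) w) (at u) v" (is "?C u = ?E u")
proof (rule ccontr)
  assume ne: "?C u \<noteq> ?E u"
  define e where "e = \<bar>?C u - ?E u\<bar> / 2"
  have e: "e > 0" using ne by (simp add: e_def)
  have cC: "continuous_on U ?C" and cE: "continuous_on U ?E"
    by (intro smooth_on_continuous smooth_on_frechet assms(2))+
  obtain d0 where d0: "d0 > 0" "ball u d0 \<subseteq> U"
    using assms open_contains_ball by blast
  have "isCont ?C u" "isCont ?E u"
    using cC cE assms by (simp_all add: continuous_on_eq_continuous_at)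
  then obtain d1 d2 where d1: "d1 > 0" "\<And>z. dist z u < d1 \<Longrightarrow> dist (?C z) (?C u) < e"
    and d2: "d2 > 0" "\<And>z. dist z u < d2 \<Longrightarrow> dist (?E z) (?E u) < e"
    unfolding continuous_at_eps_delta using e by metis
  define d where "d = min d0 (min d1 d2)"
  have d: "d > 0" using d0 d1 d2 by (simp add: d_def)
  \<comment> \<open>The step is so short that the whole parallelogram with sides \<open>t v\<close>
    and \<open>t w\<close> stays within distance \<open>d\<close>; the summand 1 guards against
    \<open>v = w = 0\<close>.\<close>
  define t where "t = d / (norm v + norm w + 1)"
  have nvw: "norm v + norm w + 1 > 0" by (smt (verit) norm_ge_zero)
  then have t: "t > 0" using d by (simp add: t_def)
  have near: "dist (u + a *\<^sub>R v + b *\<^sub>R w) u < d" if "0 \<le> a" "a \<le> t" "0 \<le> b" "b \<le> t" for a b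
  proof -
    have "norm (a *\<^sub>R v + b *\<^sub>R w) \<le> a * norm v + b * norm w"
      using that by (metis abs_of_nonneg norm_scaleR norm_triangle_ineq)
    also have "\<dots> \<le> t * norm v + t * norm w"
      using that by (intro add_mono mult_right_mono) auto
    also have "\<dots> < t * (norm v + norm w + 1)"
      using t by (simp add: algebra_simps)
    also have "\<dots> = d" using nvw by (simp add: t_def)
    finally show ?thesis by (simp add: dist_norm add.assoc)
  qed
  then have U1: "u + a *\<^sub>R v + b *\<^sub>R w \<in> U" if "0 \<le> a" "a \<le> t" "0 \<le> b" "b \<le> t" for a b
    using d0 that by (force simp: d_def dist_commute)
  then have U2: "u + b *\<^sub>R w + a *\<^sub>R v \<in> U" if "0 \<le> b" "b \<le> t" "0 \<le> a" "a \<le> t" for a b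
    using that by (metis add.assoc add.commute)
  obtain a b where ab: "0 < a" "a < t" "0 < b" "b < t"
    "f (u + t *\<^sub>R v + t *\<^sub>R w) - f (u + t *\<^sub>R v) - f (u + t *\<^sub>R w) + f u = t * t * ?C (u + a *\<^sub>R v + b *\<^sub>R w)"
    using second_difference_mean_value[OF t assms(2) U1] by blast
  obtain b' a' where ab': "0 < b'" "b' < t" "0 < a'" "a' < t"
    "f (u + t *\<^sub>R w + t *\<^sub>R v) - f (u + t *\<^sub>R w) - f (u + t *\<^sub>R v) + f u = t * t * ?E (u + b' *\<^sub>R w + a' *\<^sub>R v)"
    using second_difference_mean_value[OF t assms(2) U2] by blast
  \<comment> \<open>One second difference, evaluated in both orders, equates the two mixed
    derivatives at two nearby points; continuity then contradicts the gap \<open>2 * e\<close> at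
    \<open>u\<close>.\<close>
  have "t * t * ?C (u + a *\<^sub>R v + b *\<^sub>R w) = t * t * ?E (u + a' *\<^sub>R v + b' *\<^sub>R w)"
  proof -
    have c: "u + t *\<^sub>R w + t *\<^sub>R v = u + t *\<^sub>R v + t *\<^sub>R w" "u + b' *\<^sub>R w + a' *\<^sub>R v = u + a' *\<^sub>R v + b' *\<^sub>R w"
      by (simp_all add: algebra_simps)
    show ?thesis using ab(5) ab'(5) unfolding c by linarith
  qed
  then have "?C (u + a *\<^sub>R v + b *\<^sub>R w) = ?E (u + a' *\<^sub>R v + b' *\<^sub>R w)"
    using t by simp
  moreover have "dist (?C (u + a *\<^sub>R v + b *\<^sub>R w)) (?C u) < e" "dist (?E (u + a' *\<^sub>R v + b' *\<^sub>R w)) (?E u) < e"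
    using near[of a b] near[of a' b'] ab ab' by (auto intro!: d1 d2 simp: d_def)
  moreover have False if "x = y" "dist x c < \<bar>c - d\<bar> / 2" "dist y d < \<bar>c - d\<bar> / 2" for x y c d :: real
    using that dist_triangle_half_r[of x c "\<bar>c - d\<bar>" d] by (simp add: dist_real_def)
  ultimately show False
    unfolding e_def by blast
qed

lemma frechet_derivative_inner_right:
  assumes "f differentiable (at u)"
  shows "frechet_derivative (\<lambda>z. f z \<bullet> a) (at u) v = frechet_derivative f (at u) v \<bullet> a"
proof -
  have "((\<lambda>z. f z \<bullet> a) has_derivative (\<lambda>v. frechet_derivative f (at u) v \<bullet> a)) (at u)"
    using assms by (intro has_derivative_inner_left) (simp add: frechet_derivative_works[symmetric])
  from frechet_derivative_at[OF this] show ?thesis by metis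
qed

lemma frechet_derivative_cong:
  assumes "open U" "u \<in> U" "\<And>z. z \<in> U \<Longrightarrow> f z = g z"
  shows "frechet_derivative f (at u) = frechet_derivative g (at u)"
proof -
  have "(f has_derivative F) (at u) \<longleftrightarrow> (g has_derivative F) (at u)" for F
    using has_derivative_transform_within_open[OF _ assms(1,2), of f F UNIV g]
      has_derivative_transform_within_open[OF _ assms(1,2), of g F UNIV f] assms(3) by metis
  then show ?thesis unfolding frechet_derivative_def by simp
qed

lemma symmetric_second_derivative:
  fixes f :: "'a::real_normed_vector \<Rightarrow> 'b::euclidean_space"
  assumes "open U" "smooth_on U f" "u \<in> U"
  shows "frechet_derivative (\<lambda>z. frechet_derivative f (at z) v) (at u) w =
    frechet_derivative (\<lambda>z. frechet_derivative f (at z) w) (at u) v"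
proof (rule euclidean_eqI)
  fix b :: 'b assume "b \<in> Basis"
  have s: "smooth_on U (\<lambda>z. f z \<bullet> b)"
    using assms by (intro smooth_intros)
  have *: "frechet_derivative (\<lambda>z. frechet_derivative f (at z) v) (at u) w \<bullet> b =
    frechet_derivative (\<lambda>z. frechet_derivative (\<lambda>z. f z \<bullet> b) (at z) v) (at u) w" for v w
  proof -
    have "frechet_derivative (\<lambda>z. frechet_derivative f (at z) v) (at u) w \<bullet> b =
      frechet_derivative (\<lambda>z. frechet_derivative f (at z) v \<bullet> b) (at u) w"
      by (rule frechet_derivative_inner_right[symmetric])
        (rule smooth_on_differentiable[OF smooth_on_frechet[OF assms(2)] assms(3)])
    also have "\<dots> = frechet_derivative (\<lambda>z. frechet_derivative (\<lambda>z. f z \<bullet> b) (at z) v) (at u) w"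
      by (rule fun_cong[OF frechet_derivative_cong[OF assms(1,3)]])
        (simp add: frechet_derivative_inner_right smooth_on_differentiable[OF assms(2)])
    finally show ?thesis .
  qed
  show "frechet_derivative (\<lambda>z. frechet_derivative f (at z) v) (at u) w \<bullet> b =
    frechet_derivative (\<lambda>z. frechet_derivative f (at z) w) (at u) v \<bullet> b"
    unfolding * by (rule symmetric_second_derivative_real[OF assms(1) s assms(3)])
qed

section \<open>Derivatives along vector fields\<close>

definition deriv_along :: "('a::real_normed_vector \<Rightarrow> 'a) \<Rightarrow> ('a \<Rightarrow> 'b::real_normed_vector) \<Rightarrow> 'a \<Rightarrow> 'b" where
  "deriv_along X F u = frechet_derivative F (at u) (X u)"

lemma deriv_along_axis: "deriv_along (\<lambda>u. axis i 1) F = pd i F"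
  by (simp add: fun_eq_iff deriv_along_def pd_def)

lemma deriv_alongI: "(F has_derivative D) (at u) \<Longrightarrow> deriv_along X F u = D (X u)"
  unfolding deriv_along_def using frechet_derivative_at by metis

lemma frechet_derivative_expand:
  fixes F :: "'a::euclidean_space \<Rightarrow> 'b::real_normed_vector"
  assumes "F differentiable (at u)"
  shows "frechet_derivative F (at u) v = (\<Sum>b\<in>Basis. (v \<bullet> b) *\<^sub>R frechet_derivative F (at u) b)"
  using linear_frechet_derivative[OF assms]
  by (subst (1) euclidean_representation[symmetric, of v]) (simp add: linear_sum linear_cmul)

text \<open>The direction \<open>X u\<close> moves with \<open>u\<close>, so it is again expanded in
  the basis before fixed-direction smoothness applies.\<close>

lemma smooth_on_deriv_along [smooth_intros]:
  fixes F :: "'a::euclidean_space \<Rightarrow> 'b::real_normed_vector"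
  assumes "open U" "smooth_on U X" "smooth_on U F"
  shows "smooth_on U (deriv_along X F)"
proof -
  have "smooth_on U (\<lambda>u. \<Sum>b\<in>Basis. (X u \<bullet> b) *\<^sub>R frechet_derivative F (at u) b)"
    using assms by (intro smooth_intros smooth_on_frechet)
  moreover have "deriv_along X F u = (\<Sum>b\<in>Basis. (X u \<bullet> b) *\<^sub>R frechet_derivative F (at u) b)" if "u \<in> U" for u
    unfolding deriv_along_def
    by (rule frechet_derivative_expand[OF smooth_on_differentiable[OF assms(3) that]])
  ultimately show ?thesis
    using smooth_on_cong[OF assms(1), of "deriv_along X F"] by simp
qed

lemma smooth_on_pd [smooth_intros]: "open U \<Longrightarrow> smooth_on U F \<Longrightarrow> smooth_on U (pd i F)"
  unfolding pd_def[abs_def] by (rule smooth_on_frechet)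

lemma deriv_along_cong:
  assumes "open U" "u \<in> U" "\<And>z. z \<in> U \<Longrightarrow> F z = G z"
  shows "deriv_along X F u = deriv_along X G u"
  unfolding deriv_along_def using frechet_derivative_cong[OF assms] by simp

lemma deriv_along_const [simp]: "deriv_along X (\<lambda>u. a) u = 0"
  by (simp add: deriv_along_def)

lemma deriv_along_zero:
  assumes "open U" "u \<in> U" "\<And>z. z \<in> U \<Longrightarrow> F z = a"
  shows "deriv_along X F u = 0"
  using deriv_along_cong[OF assms] by simp

context
  fixes g :: "'a::real_normed_vector \<Rightarrow> 'b::real_inner" and u :: 'a and X :: "'a \<Rightarrow> 'a" and U
  assumes d: "smooth_on U g" "u \<in> U"
begin

lemma deriv_along_minus: "deriv_along X (\<lambda>z. - g z) u = - deriv_along X g u"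
  using deriv_alongI[OF has_derivative_minus[OF smooth_on_has_derivative[OF d]], of X]
  by (simp add: deriv_along_def)

lemma deriv_along_add:
  assumes h: "smooth_on U h"
  shows "deriv_along X (\<lambda>z. h z + g z) u = deriv_along X h u + deriv_along X g u"
  using deriv_alongI[OF has_derivative_add[OF smooth_on_has_derivative[OF h d(2)] smooth_on_has_derivative[OF d]], of X]
  by (simp add: deriv_along_def)

lemma deriv_along_diff:
  assumes h: "smooth_on U h"
  shows "deriv_along X (\<lambda>z. h z - g z) u = deriv_along X h u - deriv_along X g u"
  using deriv_alongI[OF has_derivative_diff[OF smooth_on_has_derivative[OF h d(2)] smooth_on_has_derivative[OF d]], of X]
  by (simp add: deriv_along_def)

lemma deriv_along_scaleR:
  assumes r: "smooth_on U r"
  shows "deriv_along X (\<lambda>z. r z *\<^sub>R g z) u = r u *\<^sub>R deriv_along X g u + deriv_along X r u *\<^sub>R g u"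
  using deriv_alongI[OF has_derivative_scaleR[OF smooth_on_has_derivative[OF r d(2)] smooth_on_has_derivative[OF d]], of X]
  by (simp add: deriv_along_def)

lemma deriv_along_inner:
  assumes h: "smooth_on U h"
  shows "deriv_along X (\<lambda>z. h z \<bullet> g z) u = h u \<bullet> deriv_along X g u + deriv_along X h u \<bullet> g u"
  using deriv_alongI[OF has_derivative_inner[OF smooth_on_has_derivative[OF h d(2)] smooth_on_has_derivative[OF d]], of X]
  by (simp add: deriv_along_def)

end

lemma deriv_along_mult:
  fixes r g :: "'a::real_normed_vector \<Rightarrow> real"
  assumes "smooth_on U g" "u \<in> U" "smooth_on U r"
  shows "deriv_along X (\<lambda>z. r z * g z) u = r u * deriv_along X g u + deriv_along X r u * g u"
  using deriv_along_scaleR[OF assms] by simp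

text \<open>Product rule: one term differentiates the field \<open>Y\<close>, the other is the
  second derivative of \<open>F\<close> with both directions frozen. Only the first is asymmetric in
  \<open>X\<close> and \<open>Y\<close>, so it alone survives in the commutator.\<close>

lemma deriv_along_deriv_along:
  fixes F :: "'a::euclidean_space \<Rightarrow> 'b::euclidean_space"
  assumes "open U" "smooth_on U Y" "smooth_on U F" "u \<in> U"
  shows "deriv_along X (deriv_along Y F) u =
    frechet_derivative F (at u) (deriv_along X Y u) +
    frechet_derivative (\<lambda>z. frechet_derivative F (at z) (Y u)) (at u) (X u)"
proof -
  let ?DF = "\<lambda>z. frechet_derivative F (at z)"
  have sF: "smooth_on U (\<lambda>z. ?DF z b)" for b
    by (rule smooth_on_frechet[OF assms(3)])
  have sY: "smooth_on U (\<lambda>z. Y z \<bullet> b)" for b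
    using assms by (intro smooth_intros)
  have "deriv_along X (deriv_along Y F) u = deriv_along X (\<lambda>z. \<Sum>b\<in>Basis. (Y z \<bullet> b) *\<^sub>R ?DF z b) u"
    by (rule deriv_along_cong[OF assms(1,4)])
      (simp add: deriv_along_def frechet_derivative_expand[OF smooth_on_differentiable[OF assms(3)], of _ "Y _"])
  also have "\<dots> = (\<Sum>b\<in>Basis. (Y u \<bullet> b) *\<^sub>R frechet_derivative (\<lambda>z. ?DF z b) (at u) (X u)
      + frechet_derivative (\<lambda>z. Y z \<bullet> b) (at u) (X u) *\<^sub>R ?DF u b)"
    by (rule deriv_alongI) (intro has_derivative_sum has_derivative_scaleR smooth_on_has_derivative[OF _ assms(4)] sF sY)
  also have "\<dots> = (\<Sum>b\<in>Basis. (Y u \<bullet> b) *\<^sub>R frechet_derivative (\<lambda>z. ?DF z (X u)) (at u) b)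
      + (\<Sum>b\<in>Basis. (deriv_along X Y u \<bullet> b) *\<^sub>R ?DF u b)"
    using symmetric_second_derivative[OF assms(1,3,4), of _ "X u"]
      frechet_derivative_inner_right[OF smooth_on_differentiable[OF assms(2,4)]]
    by (simp add: sum.distrib deriv_along_def)
  also have "\<dots> = frechet_derivative (\<lambda>z. ?DF z (X u)) (at u) (Y u) + ?DF u (deriv_along X Y u)"
    using frechet_derivative_expand[OF smooth_on_differentiable[OF sF assms(4)], of "X u" "Y u"]
      frechet_derivative_expand[OF smooth_on_differentiable[OF assms(3,4)], of "deriv_along X Y u"] by simp
  finally show ?thesis
    using symmetric_second_derivative[OF assms(1,3,4), of "X u" "Y u"] by simp
qed

lemma deriv_along_commutator:
  fixes F :: "real^'n \<Rightarrow> 'b::euclidean_space"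
  assumes "open U" "smooth_on U X" "smooth_on U Y" "smooth_on U F" "u \<in> U"
  shows "deriv_along X (deriv_along Y F) u - deriv_along Y (deriv_along X F) u =
    frechet_derivative F (at u) (lie_bracket X Y u)"
  using deriv_along_deriv_along[OF assms(1,3,4,5), of X] deriv_along_deriv_along[OF assms(1,2,4,5), of Y]
    symmetric_second_derivative[OF assms(1,4,5), of "X u" "Y u"]
    linear_diff[OF linear_frechet_derivative[OF smooth_on_differentiable[OF assms(4,5)]]]
  by (simp add: lie_bracket_def deriv_along_def)

lemma deriv_along_compose:
  assumes "h differentiable (at u)" "F differentiable (at (h u))"
  shows "frechet_derivative (\<lambda>z. F (h z)) (at u) v = frechet_derivative F (at (h u)) (frechet_derivative h (at u) v)"
  using frechet_derivative_compose[OF assms] by (simp add: o_def)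

lemma constant_on_convex_if_derivative_zero:
  fixes F :: "'a::real_normed_vector \<Rightarrow> 'b::real_normed_vector"
  assumes "convex U" "smooth_on U F" "\<And>u v. u \<in> U \<Longrightarrow> frechet_derivative F (at u) v = 0" "p \<in> U" "q \<in> U"
  shows "F p = F q"
proof -
  have "(F has_derivative (\<lambda>h. 0)) (at u within U)" if "u \<in> U" for u
    using smooth_on_has_derivative[OF assms(2) that] assms(3)[OF that]
    by (metis (no_types, lifting) ext has_derivative_at_withinI)
  from has_derivative_zero_constant[OF assms(1) this] show ?thesis
    using assms(4,5) by metis
qed

section \<open>The frame adapted to a degenerate Bianchi transformation\<close>

text \<open>Otherwise six nonzero pairwise orthogonal vectors would be independent in a space of
  dimension five.\<close>

lemma orthogonal_five:
  fixes a b c d e v :: "real^5"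
  assumes "a \<noteq> 0" "b \<noteq> 0" "c \<noteq> 0" "d \<noteq> 0" "e \<noteq> 0"
    and "a \<bullet> b = 0" "a \<bullet> c = 0" "a \<bullet> d = 0" "a \<bullet> e = 0" "b \<bullet> c = 0" "b \<bullet> d = 0" "b \<bullet> e = 0"
    "c \<bullet> d = 0" "c \<bullet> e = 0" "d \<bullet> e = 0"
    and "v \<bullet> a = 0" "v \<bullet> b = 0" "v \<bullet> c = 0" "v \<bullet> d = 0" "v \<bullet> e = 0"
  shows "v = 0"
proof (rule ccontr)
  assume v: "v \<noteq> 0"
  let ?S = "{v, a, b, c, d, e}"
  have "pairwise orthogonal ?S"
    using assms by (auto simp: pairwise_insert orthogonal_def inner_commute)
  then have "independent ?S"
    using assms v by (intro pairwise_orthogonal_independent) auto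
  then have "card ?S \<le> DIM(real^5)" using independent_bound by blast
  moreover have "card ?S = 6"
  proof -
    have n: "p \<noteq> q" if "p \<bullet> q = 0" "p \<noteq> 0" for p q :: "real^5" using that by auto
    have "distinct [v, a, b, c, d, e]" by (simp add: n assms v)
    then show ?thesis using distinct_card by fastforce
  qed
  ultimately show False by simp
qed

text \<open>\<open>(c, s)\<close> is the unit direction across the null curves in the Cartesian
  coordinates of a horosphere. Its independence of \<open>u1\<close> is the bracket condition
  between the first field and the kernel, and \<open>cokernel\<close> says that the kernel is no
  larger than a line.\<close>

locale null_frame =
  fixes V :: "(real^3) set" and x :: "real^3 \<Rightarrow> real^5" and c s :: "real^3 \<Rightarrow> real"
  assumes open_V [simp]: "open V"
    and smooth_x [simp]: "smooth_on V x" and smooth_c [simp]: "smooth_on V c" and smooth_s [simp]: "smooth_on V s"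
    and horospherical: "horospherical_on V x"
    and cs: "\<And>u. u \<in> V \<Longrightarrow> c u * c u + s u * s u = 1"
    and pd1_c: "\<And>u. u \<in> V \<Longrightarrow> pd 1 c u = 0" and pd1_s: "\<And>u. u \<in> V \<Longrightarrow> pd 1 s u = 0"
    and kernel: "\<And>u. u \<in> V \<Longrightarrow> c u *\<^sub>R pd 3 (bianchi x) u = s u *\<^sub>R pd 2 (bianchi x) u"
    and cokernel: "\<And>u. u \<in> V \<Longrightarrow> c u *\<^sub>R pd 2 (bianchi x) u + s u *\<^sub>R pd 3 (bianchi x) u \<noteq> 0"
begin

lemmas smooth_V [simp] = smooth_on_const smooth_on_ident smooth_on_add[OF open_V] smooth_on_diff[OF open_V]
  smooth_on_minus[OF open_V] smooth_on_scaleR[OF open_V] smooth_on_mult[OF open_V] smooth_on_inner[OF open_V]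
  smooth_on_nth[OF open_V] smooth_on_exp[OF open_V] smooth_on_deriv_along[OF open_V]

text \<open>\<open>X3\<close> spans the kernel of the Bianchi transformation, \<open>X2\<close> its orthogonal complement in
  the horosphere; \<open>E2\<close> and \<open>E3\<close> are the corresponding unit tangent vectors in five-space. The
  field \<open>B\<close> turns out to be normal, and \<open>\<kappa>\<close>, \<open>\<kappa>2\<close> are the Euclidean curvatures of the integral
  curves of \<open>X3\<close>, \<open>X2\<close> in the coordinates \<open>(u2, u3)\<close>.\<close>

definition X2 :: "real^3 \<Rightarrow> real^3" where "X2 u = c u *\<^sub>R axis 2 1 + s u *\<^sub>R axis 3 1"
definition X3 :: "real^3 \<Rightarrow> real^3" where "X3 u = c u *\<^sub>R axis 3 1 - s u *\<^sub>R axis 2 1"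

abbreviation d1 where "d1 \<equiv> deriv_along (\<lambda>u::real^3. axis 1 1)"
abbreviation d2 where "d2 \<equiv> deriv_along X2"
abbreviation d3 where "d3 \<equiv> deriv_along X3"

definition E2 where "E2 u = exp (u $ 1) *\<^sub>R d2 x u"
definition E3 where "E3 u = exp (u $ 1) *\<^sub>R d3 x u"
definition B where "B = d2 (bianchi x)"
definition f where "f = d3 E3"
definition \<kappa> where "\<kappa> u = c u * d3 s u - s u * d3 c u"
definition \<kappa>2 where "\<kappa>2 u = c u * d2 s u - s u * d2 c u"
abbreviation e1 where "e1 \<equiv> d1 x"
abbreviation x11 where "x11 \<equiv> d1 (d1 x)"

lemma smooth_X [simp]: "smooth_on V X2" "smooth_on V X3"
  unfolding X2_def[abs_def] X3_def[abs_def] by simp_all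

lemma bianchi_eq: "bianchi x = (\<lambda>u. x u + d1 x u)"
  by (simp add: fun_eq_iff bianchi_def deriv_along_axis)

lemma smooth_fields [simp]: "smooth_on V E2" "smooth_on V E3" "smooth_on V (bianchi x)" "smooth_on V B"
  "smooth_on V f" "smooth_on V \<kappa>" "smooth_on V \<kappa>2"
  unfolding E2_def[abs_def] E3_def[abs_def] bianchi_eq B_def f_def \<kappa>_def[abs_def] \<kappa>2_def[abs_def]
  by simp_all

lemmas d_rules = deriv_along_add[where U = V] deriv_along_diff[where U = V] deriv_along_minus[where U = V]
  deriv_along_scaleR[where U = V] deriv_along_inner[where U = V] deriv_along_mult[where U = V]

lemmas d_cong = deriv_along_cong[OF open_V]
lemmas d_zero = deriv_along_zero[OF open_V]

lemma d2_eq: "smooth_on V F \<Longrightarrow> u \<in> V \<Longrightarrow> d2 F u = c u *\<^sub>R pd 2 F u + s u *\<^sub>R pd 3 F u"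
  using linear_frechet_derivative[OF smooth_on_differentiable, of V F u]
  by (simp add: X2_def deriv_along_def linear_add linear_cmul pd_def)

lemma d3_eq: "smooth_on V F \<Longrightarrow> u \<in> V \<Longrightarrow> d3 F u = c u *\<^sub>R pd 3 F u - s u *\<^sub>R pd 2 F u"
  using linear_frechet_derivative[OF smooth_on_differentiable, of V F u]
  by (simp add: X3_def deriv_along_def linear_diff linear_cmul pd_def)

lemma d_exp [simp]: "d1 (\<lambda>u. exp (u $ 1)) u = exp (u $ 1)" "d2 (\<lambda>u. exp (u $ 1)) u = 0" "d3 (\<lambda>u. exp (u $ 1)) u = 0"
  "d1 (\<lambda>u. exp (- u $ 1)) u = - exp (- u $ 1)" "d2 (\<lambda>u. exp (- u $ 1)) u = 0" "d3 (\<lambda>u. exp (- u $ 1)) u = 0"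
proof -
  have 1: "((\<lambda>u::real^3. exp (u $ 1)) has_derivative (\<lambda>v. exp (u $ 1) * v $ 1)) (at u)"
    by (auto intro!: derivative_eq_intros bounded_linear.has_derivative[OF bounded_linear_vec_nth])
  have 2: "((\<lambda>u::real^3. exp (- u $ 1)) has_derivative (\<lambda>v. - exp (- u $ 1) * v $ 1)) (at u)"
    by (auto intro!: derivative_eq_intros bounded_linear.has_derivative[OF bounded_linear_vec_nth])
  have X: "X2 u $ 1 = 0" "X3 u $ 1 = 0" by (simp_all add: X2_def X3_def axis_def)
  show "d1 (\<lambda>u. exp (u $ 1)) u = exp (u $ 1)" "d2 (\<lambda>u. exp (u $ 1)) u = 0" "d3 (\<lambda>u. exp (u $ 1)) u = 0"
    by (simp_all add: deriv_alongI[OF 1] X)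
  show "d1 (\<lambda>u. exp (- u $ 1)) u = - exp (- u $ 1)" "d2 (\<lambda>u. exp (- u $ 1)) u = 0" "d3 (\<lambda>u. exp (- u $ 1)) u = 0"
    by (simp_all add: deriv_alongI[OF 2] X)
qed

lemma d1_cs [simp]: "u \<in> V \<Longrightarrow> d1 c u = 0" "u \<in> V \<Longrightarrow> d1 s u = 0"
  using pd1_c pd1_s by (simp_all add: deriv_along_axis)

lemma d_cs: assumes u: "u \<in> V" shows "c u * deriv_along X c u + s u * deriv_along X s u = 0"
  using d_zero[OF u cs, of "\<lambda>z. z" X] u by (simp add: d_rules)

text \<open>A unit vector in the plane moves along its quarter turn; \<open>k\<close> is the angular
  speed.\<close>

lemma cs_system:
  assumes "u \<in> V" "k = c u * deriv_along X s u - s u * deriv_along X c u"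
  shows "deriv_along X s u = k * c u" "deriv_along X c u = - k * s u"
  using cs[OF assms(1)] d_cs[OF assms(1), of X] unfolding assms(2) by algebra+

lemma d_cs2: "u \<in> V \<Longrightarrow> d2 s u = \<kappa>2 u * c u" "u \<in> V \<Longrightarrow> d2 c u = - \<kappa>2 u * s u"
  using cs_system[of u "\<kappa>2 u" X2] by (simp_all add: \<kappa>2_def)

lemma d_cs3: "u \<in> V \<Longrightarrow> d3 s u = \<kappa> u * c u" "u \<in> V \<Longrightarrow> d3 c u = - \<kappa> u * s u"
  using cs_system[of u "\<kappa> u" X3] by (simp_all add: \<kappa>_def)

lemma d_X: "u \<in> V \<Longrightarrow> deriv_along X X2 u = deriv_along X c u *\<^sub>R axis 2 1 + deriv_along X s u *\<^sub>R axis 3 1"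
  "u \<in> V \<Longrightarrow> deriv_along X X3 u = deriv_along X c u *\<^sub>R axis 3 1 - deriv_along X s u *\<^sub>R axis 2 1"
  unfolding X2_def[abs_def] X3_def[abs_def] by (simp_all add: d_rules)

text \<open>The coefficients \<open>c\<close> and \<open>s\<close> of \<open>X2\<close> and
  \<open>X3\<close> do not depend on \<open>u1\<close>, so both brackets with the first coordinate
  field vanish.\<close>

lemma d12: "smooth_on V F \<Longrightarrow> u \<in> V \<Longrightarrow> d1 (d2 F) u = d2 (d1 (F :: real^3 \<Rightarrow> 'b::euclidean_space)) u"
  and d13: "smooth_on V F \<Longrightarrow> u \<in> V \<Longrightarrow> d1 (d3 F) u = d3 (d1 (F :: real^3 \<Rightarrow> 'b::euclidean_space)) u"
proof -
  assume F: "smooth_on V F" and u: "u \<in> V"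
  have "lie_bracket (\<lambda>u. axis 1 1) X2 u = 0" "lie_bracket (\<lambda>u. axis 1 1) X3 u = 0"
  proof -
    have "lie_bracket (\<lambda>u. axis 1 1) X u = d1 X u" for X
      by (simp add: lie_bracket_def deriv_along_def)
    then show "lie_bracket (\<lambda>u. axis 1 1) X2 u = 0" "lie_bracket (\<lambda>u. axis 1 1) X3 u = 0"
      using u by (simp_all add: d_X)
  qed
  then show "d1 (d2 F) u = d2 (d1 F) u" "d1 (d3 F) u = d3 (d1 F) u"
    using deriv_along_commutator[OF open_V _ _ F u, of "\<lambda>u. axis 1 1" X2]
      deriv_along_commutator[OF open_V _ _ F u, of "\<lambda>u. axis 1 1" X3]
      linear_0[OF linear_frechet_derivative[OF smooth_on_differentiable[OF F u]]]
    by simp_all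
qed

text \<open>The bracket of \<open>X2\<close> and \<open>X3\<close> is
  \<open>- \<kappa>2 X2 - \<kappa> X3\<close>: two orthonormal planar fields fail to commute exactly
  by the turning rates of their integral curves.\<close>

lemma d23:
  fixes F :: "real^3 \<Rightarrow> 'b::euclidean_space"
  assumes F: "smooth_on V F" and u: "u \<in> V"
  shows "d2 (d3 F) u = d3 (d2 F) u - \<kappa>2 u *\<^sub>R d2 F u - \<kappa> u *\<^sub>R d3 F u"
proof -
  have "lie_bracket X2 X3 u = d2 X3 u - d3 X2 u"
    by (simp add: lie_bracket_def deriv_along_def)
  also have "\<dots> = - \<kappa>2 u *\<^sub>R X2 u - \<kappa> u *\<^sub>R X3 u"
    using u by (simp add: d_X d_cs2 d_cs3 X2_def X3_def algebra_simps)
  finally have L: "frechet_derivative F (at u) (lie_bracket X2 X3 u) = - \<kappa>2 u *\<^sub>R d2 F u - \<kappa> u *\<^sub>R d3 F u"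
    using linear_frechet_derivative[OF smooth_on_differentiable[OF F u]]
    by (simp add: linear_diff linear_neg linear_cmul deriv_along_def)
  have "d2 (d3 F) u = d3 (d2 F) u + frechet_derivative F (at u) (lie_bracket X2 X3 u)"
    using deriv_along_commutator[OF open_V _ _ F u, of X2 X3] by (simp add: algebra_simps)
  then show ?thesis unfolding L by simp
qed

section \<open>First derivatives of the adapted frame\<close>

lemma metric_x: "u \<in> V \<Longrightarrow> pd i x u \<bullet> pd j x u = (if i \<noteq> j then 0 else if i = 1 then 1 else exp (- 2 * u $ 1))"
proof -
  assume "u \<in> V"
  then have "metric x u $ i $ j = (if i \<noteq> j then 0 else if i = 1 then 1 else exp (- 2 * u $ 1))"
    using horospherical by (auto simp: horospherical_on_def)
  then show ?thesis by (simp add: metric_def)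
qed

lemma exp_cancel: "exp t * exp (- t) = 1" "exp (- t) * exp t = (1::real)" "exp t * (exp t * exp (-2 * t)) = 1"
  by (simp_all add: mult_exp_exp)

lemma frame:
  assumes u: "u \<in> V"
  shows "e1 u \<bullet> e1 u = 1" "e1 u \<bullet> E2 u = 0" "e1 u \<bullet> E3 u = 0" "E2 u \<bullet> E2 u = 1" "E2 u \<bullet> E3 u = 0" "E3 u \<bullet> E3 u = 1"
proof -
  note d = d2_eq[OF smooth_x u] d3_eq[OF smooth_x u] deriv_along_axis metric_x[OF u] inner_add_left inner_add_right
    inner_diff_left inner_diff_right
  show "e1 u \<bullet> e1 u = 1" "e1 u \<bullet> E2 u = 0" "e1 u \<bullet> E3 u = 0"
    by (simp_all add: E2_def E3_def d)
  have "d2 x u \<bullet> d2 x u = exp (- 2 * u $ 1) * (c u * c u + s u * s u)"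
    "d3 x u \<bullet> d3 x u = exp (- 2 * u $ 1) * (c u * c u + s u * s u)" "d2 x u \<bullet> d3 x u = 0"
    by (simp_all add: d algebra_simps)
  then show "E2 u \<bullet> E2 u = 1" "E2 u \<bullet> E3 u = 0" "E3 u \<bullet> E3 u = 1"
    using exp_cancel(3)[of "u $ 1"] cs[OF u] by (simp_all add: E2_def E3_def)
qed

lemmas frame' = frame frame(2)[unfolded inner_commute[of "e1 _"]] frame(3)[unfolded inner_commute[of "e1 _"]]
  frame(5)[unfolded inner_commute[of "E2 _"]]

lemma dx: "d2 x u = exp (- u $ 1) *\<^sub>R E2 u" "d3 x u = exp (- u $ 1) *\<^sub>R E3 u"
  by (simp_all add: E2_def E3_def exp_cancel)

lemma d_bianchi: "u \<in> V \<Longrightarrow> deriv_along X (bianchi x) u = deriv_along X x u + deriv_along X e1 u"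
  unfolding bianchi_eq by (simp add: d_rules)

lemma d3_bianchi: "u \<in> V \<Longrightarrow> d3 (bianchi x) u = 0"
  using kernel by (simp add: d3_eq)

lemma B_nonzero: "u \<in> V \<Longrightarrow> B u \<noteq> 0"
  using cokernel by (simp add: B_def d2_eq)

lemma d2_e1: "u \<in> V \<Longrightarrow> d2 e1 u = B u - exp (- u $ 1) *\<^sub>R E2 u"
  using d_bianchi[of u X2] by (simp add: B_def dx)

lemma d3_e1: "u \<in> V \<Longrightarrow> d3 e1 u = - exp (- u $ 1) *\<^sub>R E3 u"
  using d_bianchi[of u X3] d3_bianchi[of u] by (simp add: dx add_eq_0_iff)

lemma d1_E2: "u \<in> V \<Longrightarrow> d1 E2 u = exp (u $ 1) *\<^sub>R B u"
proof -
  assume u: "u \<in> V"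
  have "d1 E2 u = exp (u $ 1) *\<^sub>R d1 (d2 x) u + exp (u $ 1) *\<^sub>R d2 x u"
    unfolding E2_def[abs_def] using u by (simp add: d_rules)
  then show ?thesis using u by (simp add: d12 d2_e1 dx scaleR_diff_right)
qed

text \<open>The kernel condition makes \<open>d3 e1\<close> equal to \<open>- d3 x\<close>, so with
  growing \<open>u1\<close> the vector \<open>d3 x\<close> decays exponentially without turning; the
  factor \<open>exp u1\<close> in \<open>E3\<close> cancels this decay.\<close>

lemma d1_E3: "u \<in> V \<Longrightarrow> d1 E3 u = 0"
proof -
  assume u: "u \<in> V"
  have "d1 E3 u = exp (u $ 1) *\<^sub>R d1 (d3 x) u + exp (u $ 1) *\<^sub>R d3 x u"
    unfolding E3_def[abs_def] using u by (simp add: d_rules)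
  then show ?thesis using u by (simp add: d13 d3_e1 dx)
qed

text \<open>All three follow from orthonormality: \<open>d2 e1\<close> differs from \<open>B\<close>
  by a multiple of \<open>E2\<close>, and along \<open>u1\<close> the derivative of
  \<open>E2\<close> is a multiple of \<open>B\<close> while that of \<open>E3\<close>
  vanishes.\<close>

lemma B_perp:
  assumes u: "u \<in> V"
  shows "B u \<bullet> e1 u = 0" "B u \<bullet> E2 u = 0" "B u \<bullet> E3 u = 0"
proof -
  have "d2 e1 u \<bullet> e1 u = 0"
    using d_zero[OF u frame(1), of "\<lambda>z. z" X2] u by (simp add: d_rules inner_commute)
  then show "B u \<bullet> e1 u = 0"
    using u by (simp add: d2_e1 inner_diff_left frame')
  show "B u \<bullet> E2 u = 0"
    using d_zero[OF u frame(4), of "\<lambda>z. z" "\<lambda>u. axis 1 1"] u by (simp add: d_rules inner_commute d1_E2)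
  show "B u \<bullet> E3 u = 0"
    using d_zero[OF u frame(5), of "\<lambda>z. z" "\<lambda>u. axis 1 1"] u by (simp add: d_rules inner_commute d1_E2 d1_E3)
qed

lemma x11_perp:
  assumes u: "u \<in> V"
  shows "x11 u \<bullet> e1 u = 0" "x11 u \<bullet> E2 u = 0" "x11 u \<bullet> E3 u = 0"
  using d_zero[OF u frame(1), of "\<lambda>z. z" "\<lambda>u. axis 1 1"] d_zero[OF u frame(2), of "\<lambda>z. z" "\<lambda>u. axis 1 1"]
    d_zero[OF u frame(3), of "\<lambda>z. z" "\<lambda>u. axis 1 1"] u B_perp(1)[OF u]
  by (simp_all add: d_rules inner_commute d1_E2 d1_E3)

lemma d2_E3_eq: "u \<in> V \<Longrightarrow> d2 E3 u = d3 E2 u - \<kappa>2 u *\<^sub>R E2 u - \<kappa> u *\<^sub>R E3 u"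
  unfolding E2_def[abs_def] E3_def[abs_def] by (simp add: d_rules d23 algebra_simps)

text \<open>In each orthogonality relation involving \<open>E3\<close> the derivative along
  \<open>X3\<close> is shifted to the other factor. For \<open>E2\<close> that leaves
  \<open>d3 E2 \<bullet> E3\<close>, which the commutator of \<open>d2\<close> and \<open>d3\<close>
  on \<open>x\<close> evaluates.\<close>

lemma f_frame:
  assumes u: "u \<in> V"
  shows "f u \<bullet> e1 u = exp (- u $ 1)" "f u \<bullet> E2 u = - \<kappa> u" "f u \<bullet> E3 u = 0"
proof -
  show "f u \<bullet> E3 u = 0"
    using d_zero[OF u frame(6), of "\<lambda>z. z" X3] u by (simp add: d_rules inner_commute f_def)
  show "f u \<bullet> e1 u = exp (- u $ 1)"
    using d_zero[OF u frame(3), of "\<lambda>z. z" X3] u by (simp add: d_rules inner_commute d3_e1 frame f_def)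
  have "d2 E3 u \<bullet> E3 u = 0"
    using d_zero[OF u frame(6), of "\<lambda>z. z" X2] u by (simp add: d_rules inner_commute)
  then have "d3 E2 u \<bullet> E3 u = \<kappa> u"
    using u by (simp add: d2_E3_eq inner_diff_left frame')
  then show "f u \<bullet> E2 u = - \<kappa> u"
    using d_zero[OF u frame(5), of "\<lambda>z. z" X3] u by (simp add: d_rules inner_commute f_def)
qed

lemma d1_f: assumes u: "u \<in> V" shows "d1 f u = 0"
  unfolding f_def using d_zero[OF u d1_E3, of "\<lambda>z. z" X3] u by (simp add: d13)

lemma d1_\<kappa>: assumes u: "u \<in> V" shows "d1 \<kappa> u = 0" "d1 \<kappa>2 u = 0"
  unfolding \<kappa>_def[abs_def] \<kappa>2_def[abs_def]
  using d_zero[OF u d1_cs(1), of "\<lambda>z. z" X3] d_zero[OF u d1_cs(2), of "\<lambda>z. z" X3]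
    d_zero[OF u d1_cs(1), of "\<lambda>z. z" X2] d_zero[OF u d1_cs(2), of "\<lambda>z. z" X2] u
  by (simp_all add: d_rules d12 d13)

text \<open>Since \<open>f\<close> does not depend on \<open>u1\<close>, the
  \<open>u1\<close>-derivatives of \<open>f \<bullet> E2\<close> and \<open>f \<bullet> e1\<close>
  fall on the second factor only and disclose how \<open>f\<close> meets the normal vectors
  \<open>B\<close> and \<open>x11\<close>.\<close>

lemma f_perp:
  assumes u: "u \<in> V"
  shows "f u \<bullet> B u = 0" "f u \<bullet> x11 u = - exp (- u $ 1)"
proof -
  have "d1 (\<lambda>u. f u \<bullet> E2 u) u = d1 (\<lambda>u. - \<kappa> u) u"
    by (rule d_cong[OF u f_frame(2)])
  then show "f u \<bullet> B u = 0"
    using u by (simp add: d_rules d1_f d1_E2 d1_\<kappa>)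
  have "d1 (\<lambda>u. f u \<bullet> e1 u) u = d1 (\<lambda>u. exp (- u $ 1)) u"
    by (rule d_cong[OF u f_frame(1)])
  then show "f u \<bullet> x11 u = - exp (- u $ 1)"
    using u by (simp add: d_rules d1_f)
qed

text \<open>\<open>B\<close> and \<open>x11\<close> span the normal plane without being orthogonal
  in general: \<open>f\<close> meets \<open>x11\<close> but not \<open>B\<close>. Removing the
  \<open>B\<close>-part from \<open>x11\<close>, or the tangential part from \<open>f\<close>,
  completes \<open>e1\<close>, \<open>E2\<close>, \<open>E3\<close>, \<open>B\<close> to five
  orthogonal vectors; either fifth vector may serve in the test.\<close>

lemma frame_test:
  assumes u: "u \<in> V"
    and v: "v \<bullet> e1 u = 0" "v \<bullet> E2 u = 0" "v \<bullet> E3 u = 0" "v \<bullet> B u = 0" "v \<bullet> x11 u = 0 \<or> v \<bullet> f u = 0"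
  shows "v = 0"
proof -
  let ?p = "(x11 u \<bullet> B u) / (B u \<bullet> B u)"
  define n where "n = x11 u - ?p *\<^sub>R B u"
  define m where "m = f u - exp (- u $ 1) *\<^sub>R e1 u + \<kappa> u *\<^sub>R E2 u"
  have BB: "B u \<bullet> B u \<noteq> 0" using B_nonzero[OF u] by simp
  have nz: "e1 u \<noteq> 0" "E2 u \<noteq> 0" "E3 u \<noteq> 0" using frame[OF u] by auto
  note F = frame'[OF u] B_perp[OF u] x11_perp[OF u] f_perp[OF u] f_frame[OF u] B_nonzero[OF u]
  have nB: "n \<bullet> e1 u = 0" "n \<bullet> E2 u = 0" "n \<bullet> E3 u = 0" "n \<bullet> B u = 0" "n \<bullet> f u \<noteq> 0"
    using BB F by (simp_all add: n_def inner_simps inner_commute)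
  have mB: "m \<bullet> e1 u = 0" "m \<bullet> E2 u = 0" "m \<bullet> E3 u = 0" "m \<bullet> B u = 0" "m \<bullet> x11 u \<noteq> 0"
    using BB F by (simp_all add: m_def inner_simps inner_commute)
  have "n \<noteq> 0" "m \<noteq> 0" using nB(5) mB(5) by auto
  moreover have "v \<bullet> n = 0 \<or> v \<bullet> m = 0"
    using v by (auto simp: n_def m_def inner_diff_right inner_add_right)
  ultimately consider "n \<noteq> 0" "v \<bullet> n = 0" | "m \<noteq> 0" "v \<bullet> m = 0" by blast
  then show ?thesis
  proof cases
    case 1
    have "B u \<bullet> n = 0" "e1 u \<bullet> n = 0" "E2 u \<bullet> n = 0" "E3 u \<bullet> n = 0"
      "e1 u \<bullet> B u = 0" "E2 u \<bullet> B u = 0" "E3 u \<bullet> B u = 0"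
      using nB F by (simp_all add: inner_commute)
    then show ?thesis
      by (intro orthogonal_five[OF nz B_nonzero[OF u], of n v]) (simp_all only: F v \<open>n \<noteq> 0\<close> \<open>v \<bullet> n = 0\<close> simp_thms)
  next
    case 2
    have "B u \<bullet> m = 0" "e1 u \<bullet> m = 0" "E2 u \<bullet> m = 0" "E3 u \<bullet> m = 0"
      "e1 u \<bullet> B u = 0" "E2 u \<bullet> B u = 0" "E3 u \<bullet> B u = 0"
      using mB F by (simp_all add: inner_commute)
    then show ?thesis
      by (intro orthogonal_five[OF nz B_nonzero[OF u], of m v]) (simp_all only: F v \<open>m \<noteq> 0\<close> \<open>v \<bullet> m = 0\<close> simp_thms)
  qed
qed

text \<open>Only the \<open>E2\<close>-component of \<open>d2 E3\<close> can be nonzero, so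
  \<open>d2 E3 = - \<kappa>2 E2\<close>. The left side does not depend on \<open>u1\<close>, and the
  derivative of the right side is a nonzero multiple of \<open>\<kappa>2 B\<close>.\<close>

lemma d2_E3: assumes u: "u \<in> V" shows "\<kappa>2 u = 0" "d2 E3 u = 0"
proof -
  have E: "d2 E3 z \<bullet> E3 z = 0" "d2 E3 z \<bullet> e1 z = 0" "d2 E3 z \<bullet> E2 z = - \<kappa>2 z" "d1 (d2 E3) z = 0" if z: "z \<in> V" for z
  proof -
    show "d2 E3 z \<bullet> E3 z = 0"
      using d_zero[OF z frame(6), of "\<lambda>z. z" X2] z by (simp add: d_rules inner_commute)
    show "d2 E3 z \<bullet> e1 z = 0"
      using d_zero[OF z frame(3), of "\<lambda>z. z" X2] z B_perp[OF z]
      by (simp add: d_rules inner_commute d2_e1 frame inner_diff_right inner_diff_left)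
    have "d3 E2 z \<bullet> E2 z = 0"
      using d_zero[OF z frame(4), of "\<lambda>z. z" X3] z by (simp add: d_rules inner_commute)
    then show "d2 E3 z \<bullet> E2 z = - \<kappa>2 z"
      using z by (simp add: d2_E3_eq inner_diff_left frame')
    show "d1 (d2 E3) z = 0"
      using z d_zero[OF z d1_E3, of "\<lambda>z. z" X2] by (simp add: d12)
  qed
  have h: "d2 E3 z = - \<kappa>2 z *\<^sub>R E2 z" if z: "z \<in> V" for z
  proof -
    have "d1 (\<lambda>z. d2 E3 z \<bullet> E2 z) z = d1 (\<lambda>z. - \<kappa>2 z) z"
      by (rule d_cong[OF z E(3)])
    then have hB: "d2 E3 z \<bullet> B z = 0"
      using z by (simp add: d_rules E d1_E2 d1_\<kappa>)
    have hx: "d2 E3 z \<bullet> x11 z = 0"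
      using d_zero[OF z E(2), of "\<lambda>z. z" "\<lambda>u. axis 1 1"] z by (simp add: d_rules E)
    have "d2 E3 z + \<kappa>2 z *\<^sub>R E2 z = 0"
      using z E hB hx B_perp[OF z] x11_perp[OF z]
      by (intro frame_test[OF z]) (simp_all add: inner_simps frame' inner_commute)
    then show ?thesis by (simp add: add_eq_0_iff)
  qed
  have "d1 (d2 E3) u = d1 (\<lambda>z. - \<kappa>2 z *\<^sub>R E2 z) u"
    by (rule d_cong[OF u h])
  then have "\<kappa>2 u *\<^sub>R (exp (u $ 1) *\<^sub>R B u) = 0"
    using u by (simp add: d_rules E d1_E2 d1_\<kappa>)
  then show "\<kappa>2 u = 0" using B_nonzero[OF u] by simp
  then show "d2 E3 u = 0" using h[OF u] by simp
qed

lemma d3_E2: "u \<in> V \<Longrightarrow> d3 E2 u = \<kappa> u *\<^sub>R E3 u"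
  using d2_E3_eq[of u] d2_E3[of u] by simp

lemma d2_cs: "u \<in> V \<Longrightarrow> d2 c u = 0" "u \<in> V \<Longrightarrow> d2 s u = 0"
  by (simp_all add: d_cs2 d2_E3)

text \<open>The argument for \<open>d2 E3\<close> one order higher: in the frame expansion of
  \<open>d3 f\<close> the term \<open>- d3 \<kappa> E2\<close> is the only one that could vary with
  \<open>u1\<close>, so it must vanish.\<close>

lemma d3_f_\<kappa>: assumes u: "u \<in> V" shows "d3 \<kappa> u = 0" "d3 f u = - (f u \<bullet> f u) *\<^sub>R E3 u"
proof -
  have E: "d3 f z \<bullet> E3 z = - (f z \<bullet> f z)" "d3 f z \<bullet> e1 z = 0" "d3 f z \<bullet> E2 z = - d3 \<kappa> z"
    "d1 (d3 f) z = 0" "d1 (d3 \<kappa>) z = 0" if z: "z \<in> V" for z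
  proof -
    show "d3 f z \<bullet> E3 z = - (f z \<bullet> f z)"
      using d_zero[OF z f_frame(3), of "\<lambda>z. z" X3] z by (simp add: d_rules add_eq_0_iff f_def)
    have "d3 (\<lambda>z. f z \<bullet> e1 z) z = d3 (\<lambda>z. exp (- z $ 1)) z"
      by (rule d_cong[OF z f_frame(1)])
    then show "d3 f z \<bullet> e1 z = 0"
      using z f_frame[OF z] by (simp add: d_rules d3_e1)
    have "d3 (\<lambda>z. f z \<bullet> E2 z) z = d3 (\<lambda>z. - \<kappa> z) z"
      by (rule d_cong[OF z f_frame(2)])
    then show "d3 f z \<bullet> E2 z = - d3 \<kappa> z"
      using z f_frame[OF z] by (simp add: d_rules d3_E2)
    show "d1 (d3 f) z = 0" using z d_zero[OF z d1_f, of "\<lambda>z. z" X3] by (simp add: d13)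
    show "d1 (d3 \<kappa>) z = 0" using z d_zero[OF z d1_\<kappa>(1), of "\<lambda>z. z" X3] by (simp add: d13)
  qed
  have h: "d3 f z = - d3 \<kappa> z *\<^sub>R E2 z - (f z \<bullet> f z) *\<^sub>R E3 z" if z: "z \<in> V" for z
  proof -
    have "d1 (\<lambda>z. d3 f z \<bullet> E2 z) z = d1 (\<lambda>z. - d3 \<kappa> z) z"
      by (rule d_cong[OF z E(3)])
    then have hB: "d3 f z \<bullet> B z = 0"
      using z by (simp add: d_rules E d1_E2)
    have hx: "d3 f z \<bullet> x11 z = 0"
      using d_zero[OF z E(2), of "\<lambda>z. z" "\<lambda>u. axis 1 1"] z by (simp add: d_rules E)
    have "d3 f z - (- d3 \<kappa> z *\<^sub>R E2 z - (f z \<bullet> f z) *\<^sub>R E3 z) = 0"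
      using z E hB hx B_perp[OF z] x11_perp[OF z]
      by (intro frame_test[OF z]) (simp_all add: inner_simps frame' inner_commute)
    then show ?thesis by (simp only: right_minus_eq)
  qed
  have "d1 (d3 f) u = d1 (\<lambda>z. - d3 \<kappa> z *\<^sub>R E2 z - (f z \<bullet> f z) *\<^sub>R E3 z) u"
    by (rule d_cong[OF u h])
  then have "d3 \<kappa> u *\<^sub>R (exp (u $ 1) *\<^sub>R B u) = 0"
    using u by (simp add: d_rules E d1_E2 d1_E3 d1_f)
  then show "d3 \<kappa> u = 0" using B_nonzero[OF u] by simp
  then show "d3 f u = - (f u \<bullet> f u) *\<^sub>R E3 u" using h[OF u] by simp
qed

lemma d2_f: assumes u: "u \<in> V" shows "d2 f u = - \<kappa> u *\<^sub>R f u"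
  unfolding f_def using d_zero[OF u d2_E3(2), of "\<lambda>z. z" X3] u by (simp add: d23 d2_E3)

text \<open>As \<open>c\<close> and \<open>s\<close> are constant along \<open>X2\<close>, only the
  commutator contributes. This Riccati equation leaves \<open>\<kappa> = 0\<close> or the reciprocal
  of arc length along a normal, hence parallel lines or concentric circles.\<close>

lemma d2_\<kappa>: assumes u: "u \<in> V" shows "d2 \<kappa> u = - \<kappa> u * \<kappa> u"
proof -
  have 3: "d2 (d3 c) u = \<kappa> u * \<kappa> u * s u" "d2 (d3 s) u = - \<kappa> u * \<kappa> u * c u"
    using d_zero[OF u d2_cs(1), of "\<lambda>z. z" X3] d_zero[OF u d2_cs(2), of "\<lambda>z. z" X3] u
    by (simp_all add: d23 d2_E3 d_cs3)
  have "d2 \<kappa> u = c u * d2 (d3 s) u - s u * d2 (d3 c) u"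
    unfolding \<kappa>_def[abs_def] using u by (simp add: d_rules d2_cs)
  also have "\<dots> = - \<kappa> u * \<kappa> u * (c u * c u + s u * s u)"
    unfolding 3 by (simp add: algebra_simps)
  finally have "d2 \<kappa> u = - \<kappa> u * \<kappa> u * (c u * c u + s u * s u)" .
  then show ?thesis by (simp add: cs[OF u])
qed

abbreviation N2 where "N2 u \<equiv> f u \<bullet> f u"

text \<open>\<open>\<kappa> * \<kappa>\<close> obeys the same three equations, which is why its
  ratio to \<open>N2\<close> is constant.\<close>

lemma d_N2: "u \<in> V \<Longrightarrow> d1 N2 u = 0" "u \<in> V \<Longrightarrow> d2 N2 u = - 2 * \<kappa> u * N2 u" "u \<in> V \<Longrightarrow> d3 N2 u = 0"
  using f_frame(3)[of u]
  by (simp_all add: d_rules d1_f d2_f d3_f_\<kappa> inner_commute)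

text \<open>The inequality is strict since the component of \<open>f\<close> normal to the submanifold and its
  component along \<open>e1\<close> do not vanish.\<close>

lemma N2_gt: assumes u: "u \<in> V" shows "N2 u > \<kappa> u * \<kappa> u + exp (- u $ 1) * exp (- u $ 1)"
proof -
  define m where "m = f u - exp (- u $ 1) *\<^sub>R e1 u + \<kappa> u *\<^sub>R E2 u"
  have "m \<bullet> x11 u = - exp (- u $ 1)"
    using f_perp[OF u] x11_perp[OF u] by (simp add: m_def inner_simps inner_commute)
  then have "m \<bullet> m > 0" by auto
  moreover have "m \<bullet> m = N2 u - \<kappa> u * \<kappa> u - exp (- u $ 1) * exp (- u $ 1)"
    using f_frame[OF u] frame'[OF u]
    by (simp add: m_def inner_simps inner_commute algebra_simps)
  ultimately show ?thesis by simp
qed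

end

section \<open>The Gauss equation of a surface in Euclidean space\<close>

lemmas pd_scaleR = deriv_along_scaleR[where X = "\<lambda>_. axis i (1::real)" for i, unfolded deriv_along_axis]
lemmas pd_inner = deriv_along_inner[where X = "\<lambda>_. axis i (1::real)" for i, unfolded deriv_along_axis]
lemmas pd_add = deriv_along_add[where X = "\<lambda>_. axis i (1::real)" for i, unfolded deriv_along_axis]
lemmas pd_diff = deriv_along_diff[where X = "\<lambda>_. axis i (1::real)" for i, unfolded deriv_along_axis]
lemmas pd_cong = deriv_along_cong[where X = "\<lambda>_. axis i (1::real)" for i, unfolded deriv_along_axis]

lemma pd_commute:
  fixes F :: "real^'n \<Rightarrow> 'b::euclidean_space"
  assumes "open U" "smooth_on U F" "u \<in> U"
  shows "pd i (pd j F) u = pd j (pd i F) u"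
  using symmetric_second_derivative[OF assms, of "axis j 1" "axis i 1"] by (simp add: pd_def[abs_def])

lemma frechet_derivative_pd:
  fixes F :: "real^'n \<Rightarrow> 'b::real_normed_vector"
  assumes "F differentiable (at u)"
  shows "frechet_derivative F (at u) v = (\<Sum>i\<in>UNIV. v $ i *\<^sub>R pd i F u)"
proof -
  have "v = (\<Sum>i\<in>UNIV. v $ i *\<^sub>R axis i 1)"
    by (simp add: vec_eq_iff axis_def if_distrib cong: if_cong)
  then have "frechet_derivative F (at u) v = frechet_derivative F (at u) (\<Sum>i\<in>UNIV. v $ i *\<^sub>R axis i 1)"
    by simp
  then show ?thesis
    using linear_frechet_derivative[OF assms] by (simp add: linear_sum linear_cmul pd_def)
qed

locale immersed_surface =
  fixes W :: "(real^2) set" and y :: "real^2 \<Rightarrow> real^'m"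
  assumes open_W [simp]: "open W" and immersion: "immersion_on W y"
begin

lemma smooth_y [simp]: "smooth_on W y"
  using immersion by (simp add: immersion_on_def)

lemmas smooth_W [simp] = smooth_on_const smooth_on_add[OF open_W] smooth_on_diff[OF open_W]
  smooth_on_minus[OF open_W] smooth_on_scaleR[OF open_W] smooth_on_mult[OF open_W] smooth_on_inner[OF open_W]
  smooth_on_pd[OF open_W] smooth_on_sum[OF open_W]

abbreviation g where "g i j u \<equiv> pd i y u \<bullet> pd j y u"
abbreviation D where "D u \<equiv> g 1 1 u * g 2 2 u - g 1 2 u * g 1 2 u"

lemma pd_independent:
  assumes "w \<in> W" "\<alpha> *\<^sub>R pd 1 y w + \<beta> *\<^sub>R pd 2 y w = 0"
  shows "\<alpha> = 0" "\<beta> = 0"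
proof -
  have d: "y differentiable (at w)" using smooth_on_differentiable[OF smooth_y assms(1)] .
  have "frechet_derivative y (at w) (vector [\<alpha>, \<beta>]) = 0"
    using assms(2) by (simp add: frechet_derivative_pd[OF d] sum_2)
  then have "vector [\<alpha>, \<beta>] = (0 :: real^2)"
    using immersion assms(1) linear_frechet_derivative[OF d]
    by (metis immersion_on_def linear_injective_0)
  then show "\<alpha> = 0" "\<beta> = 0"
    by (metis vector_2 zero_index)+
qed

lemma D_pos: assumes w: "w \<in> W" shows "D w > 0"
proof -
  have nz: "g 1 1 w \<noteq> 0" using pd_independent[OF w, of 1 0] by auto
  \<comment> \<open>Up to the factor \<open>- g 1 1 w\<close> this is the part of
    \<open>pd 2 y w\<close> orthogonal to \<open>pd 1 y w\<close>.\<close>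
  let ?v = "g 1 2 w *\<^sub>R pd 1 y w + (- g 1 1 w) *\<^sub>R pd 2 y w"
  have "?v \<noteq> 0" using pd_independent[OF w, of "g 1 2 w" "- g 1 1 w"] nz by auto
  then have "?v \<bullet> ?v > 0" by simp
  moreover have "?v \<bullet> ?v = g 1 1 w * D w"
    by (simp add: inner_simps inner_commute algebra_simps)
  moreover have "g 1 1 w \<ge> 0" by simp
  ultimately show ?thesis by (metis mult_pos_pos not_less_iff_gr_or_eq nz order_le_less zero_less_mult_pos)
qed

text \<open>Cramer's rule for the coefficients of the tangential part of
  \<open>pd i (pd j y)\<close>; these turn out to be the Christoffel symbols of the induced
  metric.\<close>

definition \<Gamma> where
  "\<Gamma> k i j u = (if k = (1::2) then g 2 2 u * (pd i (pd j y) u \<bullet> pd 1 y u) - g 1 2 u * (pd i (pd j y) u \<bullet> pd 2 y u)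
     else g 1 1 u * (pd i (pd j y) u \<bullet> pd 2 y u) - g 1 2 u * (pd i (pd j y) u \<bullet> pd 1 y u)) / D u"

lemma smooth_D [simp]: "smooth_on W (\<lambda>u. inverse (D u))"
  using D_pos by (intro smooth_on_inverse) force+

lemma smooth_\<Gamma> [simp]: "smooth_on W (\<Gamma> k i j)"
  unfolding \<Gamma>_def[abs_def] divide_inverse by (cases "k = 1") simp_all

lemma matrix_inv_metric:
  assumes w: "w \<in> W"
  shows "matrix_inv (metric y w) = (\<chi> k l. (if k \<noteq> l then - g 1 2 w else if k = 1 then g 2 2 w else g 1 1 w) / D w)"
    (is "_ = ?J")
proof -
  have D: "D w \<noteq> 0" using D_pos[OF w] by simp
  have 1: "metric y w ** ?J = mat 1"
    using D unfolding vec_eq_iff forall_2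
    by (simp add: matrix_matrix_mult_def mat_def metric_def sum_2 inner_commute diff_divide_distrib[symmetric] add_divide_distrib[symmetric] mult.commute)
  then have "?J ** metric y w = mat 1"
    using matrix_left_right_inverse by blast
  with 1 have 2: "matrix_inv (metric y w) ** metric y w = mat 1"
    unfolding matrix_inv_def
    by (rule_tac someI2_ex[where Q = "\<lambda>X. X ** metric y w = mat 1"]) blast+
  have "matrix_inv (metric y w) = matrix_inv (metric y w) ** (metric y w ** ?J)"
    unfolding 1 by simp
  also have "\<dots> = ?J"
    unfolding matrix_mul_assoc 2 by simp
  finally show ?thesis .
qed

text \<open>For an induced metric, symmetry of second derivatives collapses the three metric
  derivatives to \<open>2 * (pd i (pd j y) w \<bullet> pd l y w)\<close>.\<close>

lemma christoffel_eq:
  assumes w: "w \<in> W"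
  shows "christoffel y k i j w = \<Gamma> k i j w"
proof -
  have p: "pd a (\<lambda>u. metric y u $ b $ l) w = pd a (pd b y) w \<bullet> pd l y w + pd a (pd l y) w \<bullet> pd b y w" for a b l
    unfolding metric_def using w by (simp add: pd_inner[where U = W] inner_commute add.commute)
  have e: "pd i (\<lambda>w. metric y w $ j $ l) w + pd j (\<lambda>w. metric y w $ i $ l) w - pd l (\<lambda>w. metric y w $ i $ j) w
     = 2 * (pd i (pd j y) w \<bullet> pd l y w)" for l
    unfolding p using pd_commute[OF open_W smooth_y w] by (simp add: inner_commute)
  obtain d where d: "d = D w" by blast
  show ?thesis
    using exhaust_2[of k]
    unfolding christoffel_def e matrix_inv_metric[OF w] \<Gamma>_def d[symmetric]
    by (auto simp: sum_2 diff_divide_distrib add_divide_distrib algebra_simps)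
qed

definition T where "T i j u = \<Gamma> 1 i j u *\<^sub>R pd 1 y u + \<Gamma> 2 i j u *\<^sub>R pd 2 y u"

definition II where "II i j u = pd i (pd j y) u - T i j u"

lemma smooth_T [simp]: "smooth_on W (T i j)" "smooth_on W (II i j)"
  unfolding II_def[abs_def] T_def[abs_def] by simp_all

lemma T_inner:
  assumes w: "w \<in> W"
  shows "T i j w \<bullet> pd k y w = pd i (pd j y) w \<bullet> pd k y w"
proof -
  have D: "D w \<noteq> 0" using D_pos[OF w] by simp
  let ?s = "\<lambda>k. pd i (pd j y) w \<bullet> pd k y w"
  have "T i j w \<bullet> pd k y w = \<Gamma> 1 i j w * g 1 k w + \<Gamma> 2 i j w * g 2 k w"
    by (simp add: T_def inner_simps)
  moreover have "\<Gamma> 1 i j w * g 1 k w + \<Gamma> 2 i j w * g 2 k w = ((g 2 2 w * ?s 1 - g 1 2 w * ?s 2) * g 1 k w + (g 1 1 w * ?s 2 - g 1 2 w * ?s 1) * g 2 k w) / D w"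
    by (simp add: \<Gamma>_def add_divide_distrib)
  moreover have "(g 2 2 w * ?s 1 - g 1 2 w * ?s 2) * g 1 k w + (g 1 1 w * ?s 2 - g 1 2 w * ?s 1) * g 2 k w = ?s k * D w"
      using exhaust_2[of k] inner_commute[of "pd 1 y w" "pd 2 y w"] by (elim disjE) (simp_all add: algebra_simps)
  ultimately show ?thesis using D by simp
qed

lemma II_inner: "w \<in> W \<Longrightarrow> II i j w \<bullet> pd k y w = 0"
  by (simp add: II_def inner_diff_left T_inner)

lemma II_inner_T: "w \<in> W \<Longrightarrow> II i j w \<bullet> T k l w = 0"
  by (simp add: T_def inner_simps II_inner)

text \<open>Differentiating \<open>T\<close> gives derivatives of Christoffel symbols and second
  derivatives of \<open>y\<close>. The product with \<open>pd 1 y\<close> keeps only the tangential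
  part of the latter, which supplies the quadratic terms of the curvature.\<close>

lemma riemann_T:
  assumes w: "w \<in> W"
  shows "metric_inner y w (\<chi> l. riemann y l 2 1 2 w) (axis 1 1) = (pd 1 (T 2 2) w - pd 2 (T 1 2) w) \<bullet> pd 1 y w"
proof -
  have c: "pd a (christoffel y k i j) w = pd a (\<Gamma> k i j) w" for a k i j
    using pd_cong[OF open_W w] christoffel_eq by blast
  have pT: "pd a (T i j) w = \<Gamma> 1 i j w *\<^sub>R pd a (pd 1 y) w + pd a (\<Gamma> 1 i j) w *\<^sub>R pd 1 y w
      + (\<Gamma> 2 i j w *\<^sub>R pd a (pd 2 y) w + pd a (\<Gamma> 2 i j) w *\<^sub>R pd 2 y w)" for a i j
    unfolding T_def[abs_def] using w by (simp add: pd_add[where U = W] pd_scaleR[where U = W])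
  have s: "pd a (pd b y) w \<bullet> pd 1 y w = \<Gamma> 1 a b w * g 1 1 w + \<Gamma> 2 a b w * g 2 1 w" for a b
    using T_inner[OF w, of a b 1] by (simp add: T_def inner_simps)
  have m: "metric_inner y w X (axis 1 1) = X $ 1 * g 1 1 w + X $ 2 * g 2 1 w" for X
    by (simp add: metric_inner_def metric_def sum_2 axis_def)
  show ?thesis
    unfolding m riemann_def sum_2 c christoffel_eq[OF w] pT
    by (simp add: inner_simps s) (simp add: algebra_simps)
qed

text \<open>Third derivatives of \<open>y\<close> commute, so the skew derivative of the tangential
  parts \<open>T\<close> is the opposite of that of the normal parts \<open>II\<close>. Normality of
  \<open>II\<close> then moves the derivative onto \<open>pd 1 y\<close>.\<close>

theorem gauss_equation:
  assumes w: "w \<in> W"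
  shows "gauss_curvature y w = (II 1 1 w \<bullet> II 2 2 w - II 1 2 w \<bullet> II 1 2 w) / D w"
proof -
  have s3: "pd 1 (pd 2 (pd 2 y)) w = pd 2 (pd 1 (pd 2 y)) w"
    by (rule pd_commute[OF open_W _ w]) simp
  have c: "pd 2 (pd 1 y) w = pd 1 (pd 2 y) w"
    by (rule pd_commute[OF open_W smooth_y w])
  have pII: "pd a (II i j) w = pd a (pd i (pd j y)) w - pd a (T i j) w" for a i j
    unfolding II_def[abs_def] using w by (simp add: pd_diff[where U = W])
  have z: "pd a (II i j) w \<bullet> pd 1 y w = - (II i j w \<bullet> pd a (pd 1 y) w)" for a i j
  proof -
    have "pd a (\<lambda>u. II i j u \<bullet> pd 1 y u) w = pd a (\<lambda>u. 0) w"
      by (rule pd_cong[OF open_W w II_inner])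
    moreover have "pd a (\<lambda>u::real^2. 0::real) w = 0" by (simp add: pd_def)
    ultimately show ?thesis
      using w by (simp add: pd_inner[where U = W] add_eq_0_iff)
  qed
  have "(pd 1 (T 2 2) w - pd 2 (T 1 2) w) \<bullet> pd 1 y w = (pd 2 (II 1 2) w - pd 1 (II 2 2) w) \<bullet> pd 1 y w"
    by (simp add: pII s3)
  also have "\<dots> = II 2 2 w \<bullet> pd 1 (pd 1 y) w - II 1 2 w \<bullet> pd 1 (pd 2 y) w"
    by (simp add: inner_diff_left z c)
  also have "\<dots> = II 2 2 w \<bullet> II 1 1 w - II 1 2 w \<bullet> II 1 2 w"
    using II_inner_T[OF w, of 2 2 1 1] II_inner_T[OF w, of 1 2 1 2]
    by (simp add: II_def[of 1 1] II_def[of 1 2] inner_diff_right)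
  finally have "metric_inner y w (\<chi> l. riemann y l 2 1 2 w) (axis 1 1) = II 1 1 w \<bullet> II 2 2 w - II 1 2 w \<bullet> II 1 2 w"
    by (simp add: riemann_T[OF w] inner_commute)
  moreover have "(\<chi> l. \<Sum>k\<in>UNIV. \<Sum>i\<in>UNIV. \<Sum>j\<in>UNIV. riemann y l k i j w * axis 1 1 $ i * axis 2 1 $ j * axis 2 1 $ k)
      = (\<chi> l. riemann y l 2 1 2 w)"
    by (simp add: vec_eq_iff sum_2 axis_def)
  moreover have "metric_inner y w (axis a 1) (axis b 1) = g a b w" for a b
    using exhaust_2[of a] exhaust_2[of b] by (auto simp: metric_inner_def metric_def sum_2 axis_def)
  ultimately show ?thesis
    unfolding gauss_curvature_def sectional_curvature_def by (simp add: power2_eq_square)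
qed

end

section \<open>The curvature of the transformed surface\<close>

context null_frame
begin

lemma pd_frame:
  assumes "smooth_on V F" "u \<in> V"
  shows "pd 2 F u = c u *\<^sub>R d2 F u - s u *\<^sub>R d3 F u" "pd 3 F u = s u *\<^sub>R d2 F u + c u *\<^sub>R d3 F u"
proof -
  have "c u *\<^sub>R d2 F u - s u *\<^sub>R d3 F u = (c u * c u + s u * s u) *\<^sub>R pd 2 F u"
    "s u *\<^sub>R d2 F u + c u *\<^sub>R d3 F u = (c u * c u + s u * s u) *\<^sub>R pd 3 F u"
    using assms by (simp_all add: d2_eq d3_eq algebra_simps)
  then show "pd 2 F u = c u *\<^sub>R d2 F u - s u *\<^sub>R d3 F u" "pd 3 F u = s u *\<^sub>R d2 F u + c u *\<^sub>R d3 F u"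
    by (simp_all add: cs[OF assms(2)])
qed

lemma constant_on_convex:
  assumes "convex V" "smooth_on V F" "\<And>u. u \<in> V \<Longrightarrow> d1 F u = 0" "\<And>u. u \<in> V \<Longrightarrow> d2 F u = 0"
    "\<And>u. u \<in> V \<Longrightarrow> d3 F u = 0" "p \<in> V" "q \<in> V"
  shows "F p = F q"
proof (rule constant_on_convex_if_derivative_zero[OF assms(1,2) _ assms(6,7)])
  fix u v assume u: "u \<in> V"
  show "frechet_derivative F (at u) v = 0"
    unfolding frechet_derivative_pd[OF smooth_on_differentiable[OF assms(2) u]] sum_3
    using assms(3)[OF u] assms(4)[OF u] assms(5)[OF u] u
    by (simp add: pd_frame[OF assms(2)] deriv_along_axis)
qed

lemma N2_pos: "u \<in> V \<Longrightarrow> N2 u > 0"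
  using N2_gt[of u] by (smt (verit) zero_le_square zero_less_mult_iff exp_gt_zero)

lemma \<kappa>_less: "u \<in> V \<Longrightarrow> \<kappa> u * \<kappa> u < N2 u"
  using N2_gt[of u] mult_pos_pos[OF exp_gt_zero[of "- u $ 1"] exp_gt_zero[of "- u $ 1"]] by linarith

text \<open>The coefficient for which \<open>r f + E2\<close> is orthogonal to \<open>f\<close>,
  since \<open>f \<bullet> E2 = - \<kappa>\<close>.\<close>

definition r where "r u = \<kappa> u / N2 u"

lemma smooth_r [simp]: "smooth_on V r"
  unfolding r_def[abs_def] using N2_pos by (intro smooth_on_divide) force+

lemma d_r:
  assumes u: "u \<in> V"
  shows "d1 r u = 0" "d2 r u = \<kappa> u * r u" "d3 r u = 0"
proof -
  have N: "N2 z \<noteq> 0" if "z \<in> V" for z using N2_pos[OF that] by simp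
  have e: "r z * N2 z = \<kappa> z" if "z \<in> V" for z using N[OF that] by (simp add: r_def)
  have "deriv_along X (\<lambda>z. r z * N2 z) u = deriv_along X \<kappa> u" for X
    by (rule d_cong[OF u e])
  then have "r u * deriv_along X N2 u + deriv_along X r u * N2 u = deriv_along X \<kappa> u" for X
    using u by (simp add: deriv_along_mult[where U = V])
  from this[of "\<lambda>u. axis 1 1"] this[of X2] this[of X3]
  have "d1 r u * N2 u = 0" "d2 r u * N2 u = \<kappa> u * r u * N2 u" "d3 r u * N2 u = 0"
    using e[OF u, symmetric] by (simp_all add: d_N2 d1_\<kappa> d2_\<kappa> d3_f_\<kappa> u algebra_simps)
  then show "d1 r u = 0" "d2 r u = \<kappa> u * r u" "d3 r u = 0" using N[OF u] by simp_all
qed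

text \<open>\<open>\<nu>\<close> is normal to the transformed surface within its three-space.\<close>

definition \<nu> where "\<nu> u = r u *\<^sub>R f u + E2 u"

lemma smooth_\<nu> [simp]: "smooth_on V \<nu>" unfolding \<nu>_def[abs_def] by simp

text \<open>Along \<open>X2\<close> the rates \<open>\<kappa>\<close> of \<open>r\<close> and
  \<open>- \<kappa>\<close> of \<open>f\<close> cancel, and neither depends on \<open>u1\<close>, so
  \<open>\<nu>\<close> inherits these derivatives from \<open>E2\<close>.\<close>

lemma d_\<nu>: "u \<in> V \<Longrightarrow> d1 \<nu> u = exp (u $ 1) *\<^sub>R B u" "u \<in> V \<Longrightarrow> d2 \<nu> u = d2 E2 u"
  unfolding \<nu>_def[abs_def] by (simp_all add: d_rules d_r d1_f d2_f d1_E2)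

lemma d1_bianchi: "u \<in> V \<Longrightarrow> d1 (bianchi x) u = e1 u + x11 u"
  by (rule d_bianchi)

text \<open>The tangent plane of the transformed surface is spanned by \<open>e1 + x11\<close> and
  \<open>B\<close>. In the product of \<open>f\<close> with the first vector the contributions
  \<open>exp (- u1)\<close> and \<open>- exp (- u1)\<close> cancel.\<close>

lemma bianchi_normal:
  assumes u: "u \<in> V"
  shows "\<nu> u \<bullet> d1 (bianchi x) u = 0" "\<nu> u \<bullet> B u = 0" "E3 u \<bullet> d1 (bianchi x) u = 0" "E3 u \<bullet> B u = 0"
    "f u \<bullet> d1 (bianchi x) u = 0" "f u \<bullet> B u = 0" "\<nu> u \<bullet> E3 u = 0" "\<nu> u \<bullet> f u = 0" "E3 u \<bullet> f u = 0"
    "\<nu> u \<bullet> \<nu> u = 1 - \<kappa> u * \<kappa> u / N2 u"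
proof -
  have N: "N2 u \<noteq> 0" using N2_pos[OF u] by simp
  show "\<nu> u \<bullet> d1 (bianchi x) u = 0" "\<nu> u \<bullet> B u = 0" "E3 u \<bullet> d1 (bianchi x) u = 0" "E3 u \<bullet> B u = 0"
    "f u \<bullet> d1 (bianchi x) u = 0" "f u \<bullet> B u = 0" "\<nu> u \<bullet> E3 u = 0" "E3 u \<bullet> f u = 0"
    using u frame'[OF u] B_perp[OF u] x11_perp[OF u] f_frame[OF u] f_perp[OF u]
    by (simp_all add: \<nu>_def d1_bianchi inner_simps inner_commute)
  show "\<nu> u \<bullet> f u = 0" using f_frame[OF u] N by (simp add: \<nu>_def inner_simps r_def inner_commute)
  have "\<nu> u \<bullet> \<nu> u = r u * r u * N2 u - 2 * r u * \<kappa> u + 1"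
    using f_frame[OF u] frame[OF u] by (simp add: \<nu>_def inner_simps inner_commute algebra_simps)
  also have "\<dots> = 1 - \<kappa> u * \<kappa> u / N2 u" using N by (simp add: r_def)
  finally show "\<nu> u \<bullet> \<nu> u = 1 - \<kappa> u * \<kappa> u / N2 u" .
qed

lemma \<nu>_nonzero: "u \<in> V \<Longrightarrow> \<nu> u \<bullet> \<nu> u > 0"
  using \<kappa>_less[of u] N2_pos[of u] bianchi_normal(10)[of u] by (simp add: pos_divide_less_eq)

text \<open>This is the Gauss equation of the submanifold for the plane spanned by \<open>d1\<close>, \<open>d2\<close>, with
  the normal component of \<open>d2 E2\<close> expressed through \<open>B\<close> and \<open>f\<close>.\<close>

lemma normal_determinant:
  assumes u: "u \<in> V"
  defines "X \<equiv> d1 (bianchi x) u"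
  shows "(d1 \<nu> u \<bullet> X) * (d2 \<nu> u \<bullet> B u) - (d1 \<nu> u \<bullet> B u)\<^sup>2 = - ((X \<bullet> X) * (B u \<bullet> B u) - (X \<bullet> B u)\<^sup>2)"
proof -
  define e where "e = exp (u $ 1)"
  define \<epsilon> where "\<epsilon> = exp (- u $ 1)"
  have ee: "e * \<epsilon> = 1" by (simp add: e_def \<epsilon>_def exp_cancel)
  define b where "b = B u \<bullet> B u"
  define p where "p = B u \<bullet> x11 u"
  define q where "q = B u \<bullet> d2 E2 u"
  define l where "l = N2 u - \<kappa> u * \<kappa> u - \<epsilon> * \<epsilon>"
  \<comment> \<open>The normal part of \<open>f\<close>; together with \<open>B\<close> it is an
    orthogonal basis of the normal plane.\<close>
  define m where "m = f u - \<epsilon> *\<^sub>R e1 u + \<kappa> u *\<^sub>R E2 u"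
  have b: "b > 0" using B_nonzero[OF u] by (simp add: b_def)
  have l: "l > 0" using N2_gt[OF u] by (simp add: l_def \<epsilon>_def)
  note F = frame'[OF u] B_perp[OF u] x11_perp[OF u] f_frame[OF u, folded \<epsilon>_def] f_perp[OF u, folded \<epsilon>_def]
  have mm: "m \<bullet> m = l" "m \<bullet> f u = l" "m \<bullet> e1 u = 0" "m \<bullet> E2 u = 0" "m \<bullet> E3 u = 0" "m \<bullet> B u = 0"
    using F by (simp_all add: m_def l_def inner_simps inner_commute algebra_simps)
  have "x11 u - ((p / b) *\<^sub>R B u - (\<epsilon> / l) *\<^sub>R m) = 0"
    using F mm b l
    by (intro frame_test[OF u] disjI2) (simp_all add: inner_simps inner_commute p_def b_def)
  then have x11: "x11 u = (p / b) *\<^sub>R B u - (\<epsilon> / l) *\<^sub>R m" by simp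
  have "d2 (\<lambda>z. f z \<bullet> E2 z) u = d2 (\<lambda>z. - \<kappa> z) u" by (rule d_cong[OF u f_frame(2)])
  then have 1: "f u \<bullet> d2 E2 u = 0"
    using u F by (simp add: d_rules d2_f d2_\<kappa>)
  have 2: "E2 u \<bullet> d2 E2 u = 0"
    using d_zero[OF u frame(4), of "\<lambda>z. z" X2] u by (simp add: d_rules inner_commute)
  have 3: "e1 z \<bullet> d2 E2 z = exp (- z $ 1)" if z: "z \<in> V" for z
    using d_zero[OF z frame(2), of "\<lambda>z. z" X2] z B_perp[OF z] frame[OF z]
    by (simp add: d_rules d2_e1 inner_simps inner_commute)
  have 4: "e1 u \<bullet> d2 B u = - b"
    using d_zero[OF u B_perp(1), of "\<lambda>z. z" X2] u F by (simp add: d_rules d2_e1 inner_simps inner_commute b_def)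
  have 5: "d1 (d2 E2) u = e *\<^sub>R d2 B u"
  proof -
    have "d1 (d2 E2) u = d2 (d1 E2) u" using u by (simp add: d12)
    also have "\<dots> = d2 (\<lambda>z. exp (z $ 1) *\<^sub>R B z) u" by (rule d_cong[OF u d1_E2])
    finally show ?thesis using u by (simp add: d_rules e_def)
  qed
  \<comment> \<open>Here the curvature enters: a relation between first derivatives of the frame is
    differentiated in \<open>u1\<close>, and \<open>d1\<close> has been commuted past
    \<open>d2\<close> in step 5.\<close>
  have "d1 (\<lambda>z. e1 z \<bullet> d2 E2 z) u = d1 (\<lambda>z. exp (- z $ 1)) u" by (rule d_cong[OF u 3])
  then have 6: "x11 u \<bullet> d2 E2 u = e * b - \<epsilon>"
    using u by (simp add: d_rules 5 4 \<epsilon>_def)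
  have "m \<bullet> d2 E2 u = - \<epsilon> * \<epsilon>"
    using 1 2 3[OF u] by (simp add: m_def inner_simps \<epsilon>_def)
  then have 7: "p * q / b + \<epsilon> * \<epsilon> * \<epsilon> / l = e * b - \<epsilon>"
    using 6 unfolding x11 by (simp add: inner_simps q_def)
  have 8: "x11 u \<bullet> x11 u = p * p / b + \<epsilon> * \<epsilon> / l"
    using b l mm unfolding x11 by (simp add: inner_simps inner_commute flip: b_def)
  have X: "X \<bullet> X = 1 + x11 u \<bullet> x11 u" "X \<bullet> B u = p" "B u \<bullet> X = p"
    using F by (simp_all add: X_def d1_bianchi u inner_simps inner_commute p_def)
  have D1: "d1 \<nu> u \<bullet> X = e * p" "d1 \<nu> u \<bullet> B u = e * b" "d2 \<nu> u \<bullet> B u = q"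
    using X by (simp_all add: d_\<nu> u e_def b_def q_def inner_commute)
  have "e * p * q = b * (e * (p * q / b))" using b by simp
  also have "p * q / b = e * b - \<epsilon> - \<epsilon> * \<epsilon> * \<epsilon> / l" using 7 by simp
  also have "b * (e * (e * b - \<epsilon> - \<epsilon> * \<epsilon> * \<epsilon> / l)) = b * (e * e * b - e * \<epsilon> - e * \<epsilon> * (\<epsilon> * \<epsilon> / l))"
    by (simp add: algebra_simps)
  finally have "e * p * q - (e * b)\<^sup>2 = - (b * (1 + \<epsilon> * \<epsilon> / l))"
    unfolding ee by (simp add: power2_eq_square algebra_simps)
  moreover have "(1 + (p * p / b + \<epsilon> * \<epsilon> / l)) * b - p\<^sup>2 = b * (1 + \<epsilon> * \<epsilon> / l)"
    using b by (simp add: power2_eq_square algebra_simps)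
  ultimately show ?thesis
    unfolding D1 X 8 b_def[symmetric] by simp
qed

text \<open>The parametrization \<open>y\<close> is arbitrary, so its metric and second fundamental
  form are recovered from derivatives of \<open>bianchi x\<close> and its normals along
  \<open>d1\<close> and \<open>d2\<close>. Both determinants change by the square of the Jacobian
  \<open>\<Delta>\<close>, which drops out of the quotient; the squared length of
  \<open>\<nu>\<close> remains.\<close>

theorem gauss_curvature_bianchi:
  fixes \<pi> :: "real^3 \<Rightarrow> real^2" and y :: "real^2 \<Rightarrow> real^5"
  assumes "open W" "immersion_on W y" "smooth_on V \<pi>" "\<pi> ` V \<subseteq> W" "\<And>z. z \<in> V \<Longrightarrow> bianchi x z = y (\<pi> z)"
    and u: "u \<in> V"
  shows "gauss_curvature y (\<pi> u) = - 1 / (1 - \<kappa> u * \<kappa> u / N2 u)"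
proof -
  interpret S: immersed_surface W y using assms by unfold_locales
  let ?Y = "\<lambda>k z. pd k y (\<pi> z)" and ?xt = "bianchi x"
  define a where "a k z = d1 \<pi> z $ k" for k z
  define b where "b k z = d2 \<pi> z $ k" for k z
  have \<pi>W: "\<pi> z \<in> W" if "z \<in> V" for z using assms(4) that by auto
  have chain: "deriv_along X (\<lambda>z. F (\<pi> z)) z = deriv_along X \<pi> z $ 1 *\<^sub>R pd 1 F (\<pi> z) + deriv_along X \<pi> z $ 2 *\<^sub>R pd 2 F (\<pi> z)"
    if "smooth_on W F" "z \<in> V" for F :: "real^2 \<Rightarrow> real^5" and X z
    using deriv_along_compose[OF smooth_on_differentiable[OF assms(3) that(2)] smooth_on_differentiable[OF that(1) \<pi>W[OF that(2)]], of "X z"]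
    by (simp add: deriv_along_def frechet_derivative_pd[OF smooth_on_differentiable[OF that(1) \<pi>W[OF that(2)]]] sum_2)
  have sY: "smooth_on V (?Y k)" for k
    by (rule smooth_on_compose[OF open_V assms(1,4,3)]) simp
  have cg: "deriv_along X ?xt z = deriv_along X (\<lambda>z. y (\<pi> z)) z" if "z \<in> V" for X z
    by (rule d_cong[OF that assms(5)])
  have xt1: "d1 ?xt z = a 1 z *\<^sub>R ?Y 1 z + a 2 z *\<^sub>R ?Y 2 z" if "z \<in> V" for z
    unfolding cg[OF that] chain[OF S.smooth_y that] by (simp add: a_def)
  have xt2: "B z = b 1 z *\<^sub>R ?Y 1 z + b 2 z *\<^sub>R ?Y 2 z" if "z \<in> V" for z
    unfolding B_def cg[OF that] chain[OF S.smooth_y that] by (simp add: b_def)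
  \<comment> \<open>Determinant of the differential of \<open>\<pi>\<close> restricted to the first
    coordinate direction and \<open>X2\<close>.\<close>
  define \<Delta> where "\<Delta> z = a 1 z * b 2 z - a 2 z * b 1 z" for z
  have \<Delta>: "\<Delta> z \<noteq> 0" if z: "z \<in> V" for z
  proof
    assume 0: "\<Delta> z = 0"
    have "b 2 z *\<^sub>R d1 ?xt z - a 2 z *\<^sub>R B z = \<Delta> z *\<^sub>R ?Y 1 z" "a 1 z *\<^sub>R B z - b 1 z *\<^sub>R d1 ?xt z = \<Delta> z *\<^sub>R ?Y 2 z"
      unfolding xt1[OF z] xt2[OF z] \<Delta>_def by (simp_all add: algebra_simps)
    then have e: "b 2 z *\<^sub>R d1 ?xt z - a 2 z *\<^sub>R B z = 0" "a 1 z *\<^sub>R B z - b 1 z *\<^sub>R d1 ?xt z = 0" using 0 by simp_all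
    \<comment> \<open>Pairing with \<open>e1\<close> reads off the first coefficient, because
      \<open>B\<close> is orthogonal to \<open>e1\<close> and \<open>e1 + x11\<close> has product 1
      with it.\<close>
    have i: "(\<alpha> *\<^sub>R d1 ?xt z - \<beta> *\<^sub>R B z) \<bullet> e1 z = \<alpha>" for \<alpha> \<beta>
      using frame[OF z] B_perp[OF z] x11_perp[OF z] z by (simp add: d1_bianchi inner_simps)
    have "b 2 z = 0" using e(1) i[of "b 2 z" "a 2 z"] by simp
    moreover have "b 1 z = 0" using e(2) i[of "- b 1 z" "- a 1 z"] by simp
    ultimately show False using xt2[OF z] B_nonzero[OF z] by simp
  qed
  have solve: "p = 0 \<and> q = 0" if "z \<in> V" "a 1 z * p + a 2 z * q = 0" "b 1 z * p + b 2 z * q = 0" for p q z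
  proof -
    have "\<Delta> z * p = 0" "\<Delta> z * q = 0" using that(2,3) unfolding \<Delta>_def by algebra+
    then show ?thesis using \<Delta>[OF that(1)] by simp
  qed
  have normal: "q \<bullet> ?Y k z = 0" if "z \<in> V" "q \<bullet> d1 ?xt z = 0" "q \<bullet> B z = 0" for q z k
    using solve[OF that(1), of "q \<bullet> ?Y 1 z" "q \<bullet> ?Y 2 z"] that exhaust_2[of k]
    by (auto simp: xt1 xt2 inner_simps)
  let ?h = "\<lambda>i k. pd i (pd k y) (\<pi> u)"
  have weingarten: "deriv_along X \<pi> u $ 1 * (Q u \<bullet> ?h 1 k) + deriv_along X \<pi> u $ 2 * (Q u \<bullet> ?h 2 k) = - (deriv_along X Q u \<bullet> ?Y k u)"
    if "smooth_on V Q" "\<And>z. z \<in> V \<Longrightarrow> Q z \<bullet> d1 ?xt z = 0" "\<And>z. z \<in> V \<Longrightarrow> Q z \<bullet> B z = 0" for Q X k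
  proof -
    have "deriv_along X (\<lambda>z. Q z \<bullet> ?Y k z) u = 0"
      by (rule d_zero[OF u]) (rule normal[OF _ that(2,3)])
    then show ?thesis
      using u by (simp add: deriv_along_inner[OF sY u that(1)] chain inner_simps)
  qed
  \<comment> \<open>A normal field whose derivatives along \<open>d1\<close> and \<open>d2\<close>
    are multiples of itself sees no second fundamental form. \<open>E3\<close> and \<open>f\<close>
    are of this kind, so only the direction of \<open>\<nu>\<close> is left.\<close>
  have flat: "Q u \<bullet> ?h i k = 0" if "smooth_on V Q" "\<And>z. z \<in> V \<Longrightarrow> Q z \<bullet> d1 ?xt z = 0" "\<And>z. z \<in> V \<Longrightarrow> Q z \<bullet> B z = 0"
    "d1 Q u = 0" "d2 Q u = t *\<^sub>R Q u" for Q i k t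
    using solve[OF u, of "Q u \<bullet> ?h 1 k" "Q u \<bullet> ?h 2 k"] weingarten[OF that(1-3), of "\<lambda>u. axis 1 1" k]
      weingarten[OF that(1-3), of X2 k] that(4,5) exhaust_2[of i] normal[OF u that(2,3)[OF u], of k]
    by (auto simp: a_def b_def)
  have flat3: "E3 u \<bullet> ?h i k = 0" and flatf: "f u \<bullet> ?h i k = 0" for i k
    by (rule flat[of E3 0]; simp add: bianchi_normal d1_E3 d2_E3 u)
      (rule flat[of f "- \<kappa> u"]; simp add: bianchi_normal d1_f d2_f u)
  have nY: "E3 u \<bullet> ?Y k u = 0" "f u \<bullet> ?Y k u = 0" "\<nu> u \<bullet> ?Y k u = 0" for k
    by (rule normal[OF u]; simp add: bianchi_normal u)+
  have w: "\<pi> u \<in> W" using \<pi>W[OF u] .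
  let ?n = "\<nu> u \<bullet> \<nu> u"
  have II: "S.II i k (\<pi> u) = ((\<nu> u \<bullet> ?h i k) / ?n) *\<^sub>R \<nu> u" for i k
  proof -
    define v where "v = S.II i k (\<pi> u) - ((\<nu> u \<bullet> ?h i k) / ?n) *\<^sub>R \<nu> u"
    \<comment> \<open>Orthogonalised against \<open>B\<close>, so that \<open>X\<close>,
      \<open>B\<close>, \<open>E3\<close>, \<open>f\<close>, \<open>\<nu>\<close> form an orthogonal
      basis of five-space.\<close>
    define X where "X = d1 ?xt u - ((d1 ?xt u \<bullet> B u) / (B u \<bullet> B u)) *\<^sub>R B u"
    have n: "\<nu> u \<bullet> \<nu> u \<noteq> 0" using \<nu>_nonzero[OF u] by simp
    have IIn: "Q \<bullet> S.II i k (\<pi> u) = Q \<bullet> ?h i k" if "\<And>k. Q \<bullet> ?Y k u = 0" for Q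
      using that by (simp add: S.II_def S.T_def inner_simps)
    have vY: "v \<bullet> ?Y k u = 0" for k
      using S.II_inner[OF w] nY by (simp add: v_def inner_simps)
    have vq: "v \<bullet> q = q \<bullet> ?h i k - (\<nu> u \<bullet> ?h i k) / ?n * (q \<bullet> \<nu> u)" if "\<And>k. q \<bullet> ?Y k u = 0" for q
      using IIn[OF that] by (simp add: v_def inner_diff_left inner_diff_right inner_commute[of _ q])
    note N = bianchi_normal[OF u]
    have EN: "E3 u \<bullet> \<nu> u = 0" "f u \<bullet> \<nu> u = 0"
      using N(7,8) by (simp_all add: inner_commute)
    have v: "v \<bullet> E3 u = 0" "v \<bullet> f u = 0" "v \<bullet> \<nu> u = 0" "v \<bullet> B u = 0" "v \<bullet> d1 ?xt u = 0"
      using vq[OF nY(1)] vq[OF nY(2)] vq[OF nY(3)] flat3 flatf EN n vY[of 1] vY[of 2]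
      by (simp_all add: xt1[OF u] xt2[OF u] inner_add_right)
    have "X \<bullet> e1 u = 1"
      using frame[OF u] B_perp[OF u] x11_perp[OF u] u by (simp add: X_def d1_bianchi inner_simps)
    then have X0: "X \<noteq> 0" by auto
    have nz: "B u \<noteq> 0" "E3 u \<noteq> 0" "f u \<noteq> 0" "\<nu> u \<noteq> 0"
      using B_nonzero[OF u] frame[OF u] N2_pos[OF u] n by auto
    have "X \<bullet> B u = 0" using nz by (simp add: X_def inner_diff_left)
    moreover have "X \<bullet> q = 0" if "q \<bullet> d1 ?xt u = 0" "q \<bullet> B u = 0" for q
      using that by (simp add: X_def inner_simps inner_commute[of _ q])
    moreover have "v \<bullet> X = 0" using v by (simp add: X_def inner_diff_right)
    moreover have "B u \<bullet> q = 0" if "q \<bullet> B u = 0" for q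
      using that by (simp add: inner_commute)
    ultimately have "v = 0"
      by (intro orthogonal_five[OF X0 nz, of v]) (simp_all add: v N EN del: inner_commute)
    then show ?thesis by (simp add: v_def)
  qed
  let ?L = "\<lambda>i k. \<nu> u \<bullet> ?h i k"
  have sym: "?L 2 1 = ?L 1 2" using pd_commute[OF assms(1) S.smooth_y w] by simp
  have wn: "deriv_along X \<pi> u $ 1 * ?L 1 k + deriv_along X \<pi> u $ 2 * ?L 2 k = - (deriv_along X \<nu> u \<bullet> ?Y k u)" for X k
    by (rule weingarten) (simp_all add: bianchi_normal)
  have h: "d1 \<nu> u \<bullet> d1 ?xt u = - (a 1 u * (a 1 u * ?L 1 1 + a 2 u * ?L 1 2) + a 2 u * (a 1 u * ?L 1 2 + a 2 u * ?L 2 2))"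
    "d1 \<nu> u \<bullet> B u = - (b 1 u * (a 1 u * ?L 1 1 + a 2 u * ?L 1 2) + b 2 u * (a 1 u * ?L 1 2 + a 2 u * ?L 2 2))"
    "d2 \<nu> u \<bullet> B u = - (b 1 u * (b 1 u * ?L 1 1 + b 2 u * ?L 1 2) + b 2 u * (b 1 u * ?L 1 2 + b 2 u * ?L 2 2))"
    using wn[of "\<lambda>u. axis 1 1" 1] wn[of "\<lambda>u. axis 1 1" 2] wn[of X2 1] wn[of X2 2]
    by (simp_all add: xt1[OF u] xt2[OF u] inner_simps sym a_def b_def)
  have 1: "(d1 \<nu> u \<bullet> d1 ?xt u) * (d2 \<nu> u \<bullet> B u) - (d1 \<nu> u \<bullet> B u)\<^sup>2 = (\<Delta> u)\<^sup>2 * (?L 1 1 * ?L 2 2 - ?L 1 2 * ?L 1 2)"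
    unfolding h \<Delta>_def by algebra
  have gs: "S.g 2 1 (\<pi> u) = S.g 1 2 (\<pi> u)" by (rule inner_commute)
  have 2: "(d1 ?xt u \<bullet> d1 ?xt u) * (B u \<bullet> B u) - (d1 ?xt u \<bullet> B u)\<^sup>2 = (\<Delta> u)\<^sup>2 * S.D (\<pi> u)"
    unfolding xt1[OF u] xt2[OF u] \<Delta>_def inner_simps gs by algebra
  have "(\<Delta> u)\<^sup>2 * (?L 1 1 * ?L 2 2 - ?L 1 2 * ?L 1 2) = (\<Delta> u)\<^sup>2 * - S.D (\<pi> u)"
    using normal_determinant[OF u] unfolding 1 2 mult_minus_right .
  then have "?L 1 1 * ?L 2 2 - ?L 1 2 * ?L 1 2 = - S.D (\<pi> u)"
    using \<Delta>[OF u] by simp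
  moreover have "S.II 1 1 (\<pi> u) \<bullet> S.II 2 2 (\<pi> u) - S.II 1 2 (\<pi> u) \<bullet> S.II 1 2 (\<pi> u) = (?L 1 1 * ?L 2 2 - ?L 1 2 * ?L 1 2) / ?n"
    using \<nu>_nonzero[OF u] unfolding II by (simp add: diff_divide_distrib)
  moreover obtain d where d: "S.D (\<pi> u) = d" by blast
  ultimately have "gauss_curvature y (\<pi> u) = (- d / ?n) / d"
    using S.gauss_equation[OF w] by (simp only:)
  then show ?thesis
    using S.D_pos[OF w] bianchi_normal(10)[OF u] unfolding d by simp
qed

end

section \<open>Splitting off a plane by a rotation\<close>

lemma exhaust_5:
  fixes x :: 5
  shows "x = 1 \<or> x = 2 \<or> x = 3 \<or> x = 4 \<or> x = 5"
proof (induct x)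
  case (of_int z)
  then have "0 \<le> z" and "z < 5" by simp_all
  then have "z = 0 \<or> z = 1 \<or> z = 2 \<or> z = 3 \<or> z = 4" by arith
  then show ?case by auto
qed

lemma forall_5: "(\<forall>i::5. P i) \<longleftrightarrow> P 1 \<and> P 2 \<and> P 3 \<and> P 4 \<and> P 5"
  by (metis exhaust_5)

lemma UNIV_5: "UNIV = {1, 2, 3, 4, 5::5}"
  using exhaust_5 by auto

lemma sum_5: "sum f (UNIV::5 set) = f 1 + f 2 + f 3 + f 4 + f 5"
  unfolding UNIV_5 by (simp add: ac_simps)

lemma vector_5 [simp]:
  "(vector [a,b,c,d,e] :: 'a::zero^5) $ 1 = a" "(vector [a,b,c,d,e] :: 'a::zero^5) $ 2 = b"
  "(vector [a,b,c,d,e] :: 'a::zero^5) $ 3 = c" "(vector [a,b,c,d,e] :: 'a::zero^5) $ 4 = d"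
  "(vector [a,b,c,d,e] :: 'a::zero^5) $ 5 = e"
  unfolding vector_def by simp_all

lemma point5_inner: "point5 v p q \<bullet> point5 w p' q' = v \<bullet> w + p * p' + q * q'"
  by (simp add: point5_def inner_vec_def sum_5 sum_3)

lemma orthogonal_complement_of_pair:
  fixes a b :: "real^5"
  assumes nz: "a \<noteq> 0" "b \<noteq> 0" and ab: "a \<bullet> b = 0"
  shows "subspace {y. a \<bullet> y = 0 \<and> b \<bullet> y = 0}" "dim {y. a \<bullet> y = 0 \<and> b \<bullet> y = 0} = 3"
proof -
  show "subspace {y. a \<bullet> y = 0 \<and> b \<bullet> y = 0}" by (auto simp: subspace_def inner_simps)
  have ne: "a \<noteq> b" using nz ab by auto
  have "independent {a, b}"
    using nz ab ne by (intro pairwise_orthogonal_independent) (auto simp: pairwise_def orthogonal_def inner_commute)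
  then have "dim (span {a, b}) = 2" using ne by (simp add: dim_eq_card_independent)
  then have "dim {y. \<forall>x\<in>span {a, b}. orthogonal x y} = 3"
    using dim_subspace_orthogonal_to_vectors[of "span {a, b}" UNIV] by simp
  moreover have "(\<forall>x\<in>span {a, b}. orthogonal x y) \<longleftrightarrow> a \<bullet> y = 0 \<and> b \<bullet> y = 0" for y
  proof
    assume "\<forall>x\<in>span {a, b}. orthogonal x y"
    then have "orthogonal a y" "orthogonal b y" using span_base[of _ "{a, b}"] by blast+
    then show "a \<bullet> y = 0 \<and> b \<bullet> y = 0" by (simp add: orthogonal_def)
  next
    assume "a \<bullet> y = 0 \<and> b \<bullet> y = 0"
    then have "orthogonal y x" if "x \<in> span {a, b}" for x
      using that by (intro orthogonal_to_span[of x "{a, b}" y]) (auto simp: orthogonal_def inner_commute)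
    then show "\<forall>x\<in>span {a, b}. orthogonal x y" by (simp add: orthogonal_commute)
  qed
  ultimately show "dim {y. a \<bullet> y = 0 \<and> b \<bullet> y = 0} = 3" by simp
qed

lemma orthonormal_basis_of_complement:
  fixes a b :: "real^5"
  assumes ab: "norm a = 1" "norm b = 1" "a \<bullet> b = 0"
  obtains q1 q2 q3 where "norm q1 = 1" "norm q2 = 1" "norm q3 = 1" "q1 \<bullet> q2 = 0" "q1 \<bullet> q3 = 0" "q2 \<bullet> q3 = 0"
    "q1 \<bullet> a = 0" "q1 \<bullet> b = 0" "q2 \<bullet> a = 0" "q2 \<bullet> b = 0" "q3 \<bullet> a = 0" "q3 \<bullet> b = 0"
proof -
  have nz: "a \<noteq> 0" "b \<noteq> 0" using ab by auto
  let ?S = "{y. a \<bullet> y = 0 \<and> b \<bullet> y = 0}"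
  have S: "subspace ?S" and d: "dim ?S = 3"
    using orthogonal_complement_of_pair[OF nz ab(3)] .
  obtain Q where Q: "Q \<subseteq> ?S" "pairwise orthogonal Q" "\<And>x. x \<in> Q \<Longrightarrow> norm x = 1" "card Q = dim ?S"
    by (rule orthonormal_basis_subspace[OF S]) (rule that; assumption)
  then obtain q1 q2 q3 where q: "Q = {q1, q2, q3}" "q1 \<noteq> q2" "q1 \<noteq> q3" "q2 \<noteq> q3"
    unfolding d card_3_iff by blast
  have p: "q \<bullet> a = 0" "q \<bullet> b = 0" if "q \<in> Q" for q
    using subsetD[OF Q(1) that] by (simp_all add: inner_commute)
  show thesis
    using Q(2,3) p q by (intro that[of q1 q2 q3]) (auto simp: pairwise_insert orthogonal_def)
qed

lemma rotation_onto_coordinate_plane: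
  fixes a b :: "real^5"
  assumes ab: "norm a = 1" "norm b = 1" "a \<bullet> b = 0"
  obtains R :: "real^5^5" and L :: "real^5 \<Rightarrow> real^3" where "rotation_matrix R" "bounded_linear L"
    "\<And>v. R *v v = point5 (L v) (a \<bullet> v) (b \<bullet> v)"
    "\<And>v w. L v \<bullet> L w = v \<bullet> w - (a \<bullet> v) * (a \<bullet> w) - (b \<bullet> v) * (b \<bullet> w)"
proof -
  obtain q1 q2 q3 where q: "norm q1 = 1" "norm q2 = 1" "norm q3 = 1" "q1 \<bullet> q2 = 0" "q1 \<bullet> q3 = 0" "q2 \<bullet> q3 = 0"
    "q1 \<bullet> a = 0" "q1 \<bullet> b = 0" "q2 \<bullet> a = 0" "q2 \<bullet> b = 0" "q3 \<bullet> a = 0" "q3 \<bullet> b = 0"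
    using orthonormal_basis_of_complement[OF ab] .
  \<comment> \<open>The sign \<open>t\<close> reverses \<open>q1\<close> if necessary: this changes
    the determinant's sign while the rows \<open>a\<close> and \<open>b\<close> stay in
    place.\<close>
  define M :: "real \<Rightarrow> real^5^5" where "M t = vector [t *\<^sub>R q1, q2, q3, a, b]" for t
  have row: "row i A = A $ i" for i and A :: "real^5^5"
    by (simp add: row_def vec_eq_iff)
  have orth: "orthogonal_matrix (M t)" if "\<bar>t\<bar> = 1" for t
    unfolding orthogonal_matrix_orthonormal_rows forall_5 row
    using q ab that by (simp add: M_def orthogonal_def inner_commute)
  have "det (M (-1)) = - det (M 1)"
  proof -
    have M: "M t = (\<chi> i. if i = 1 then t *\<^sub>R q1 else M 1 $ i)" for t
      unfolding vec_eq_iff[of "M t"] forall_5 by (simp add: M_def)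
    have "det (M (-1)) = -1 * det (\<chi> i. if i = 1 then q1 else M 1 $ i)"
      unfolding M[of "-1"] using det_row_mul[of 1 "-1" "\<lambda>i. q1" "\<lambda>i. M 1 $ i"]
      unfolding scalar_mult_eq_scaleR .
    also have "(\<chi> i. if i = 1 then q1 else M 1 $ i) = M 1"
      using M[of 1] unfolding scaleR_one by (rule sym)
    finally show ?thesis by simp
  qed
  moreover have "det (M 1) = 1 \<or> det (M 1) = -1"
    using det_orthogonal_matrix[OF orth[of 1]] by simp
  ultimately have "det (M 1) = 1 \<or> det (M (-1)) = 1" by auto
  then obtain t where t: "\<bar>t\<bar> = 1" "rotation_matrix (M t)"
  proof
    assume "det (M 1) = 1"
    then show ?thesis using orth[of 1] that[of 1] unfolding rotation_matrix_def by simp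
  next
    assume "det (M (-1)) = 1"
    then show ?thesis using orth[of "-1"] that[of "-1"] unfolding rotation_matrix_def by simp
  qed
  define L :: "real^5 \<Rightarrow> real^3" where "L v = vector [(t *\<^sub>R q1) \<bullet> v, q2 \<bullet> v, q3 \<bullet> v]" for v
  have R: "M t *v v = point5 (L v) (a \<bullet> v) (b \<bullet> v)" for v
    unfolding vec_eq_iff forall_5
    by (simp add: matrix_vector_mult_def M_def point5_def L_def inner_vec_def)
  have "linear L"
    by (rule linearI) (simp_all add: L_def vec_eq_iff forall_3 inner_simps algebra_simps)
  moreover have "L v \<bullet> L w = v \<bullet> w - (a \<bullet> v) * (a \<bullet> w) - (b \<bullet> v) * (b \<bullet> w)" for v w
  proof -
    have "(M t *v v) \<bullet> (M t *v w) = v \<bullet> w"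
      using t(2) orthogonal_transformation_matrix[of "(*v) (M t)"]
      by (simp add: rotation_matrix_def orthogonal_transformation_def)
    then show ?thesis unfolding R point5_inner by simp
  qed
  ultimately show ?thesis
    using that[OF t(2) _ R] linear_conv_bounded_linear by blast
qed

section \<open>The plane swept out by the null directions\<close>

lemma deriv_along_cos:
  fixes w :: "'a::real_normed_vector \<Rightarrow> real"
  assumes "smooth_on U w" "u \<in> U"
  shows "deriv_along X (\<lambda>u. cos (w u)) u = - sin (w u) * deriv_along X w u"
  using deriv_alongI[OF has_derivative_cos[OF smooth_on_has_derivative[OF assms]], of X]
  by (simp add: deriv_along_def)

lemma deriv_along_sin:
  fixes w :: "'a::real_normed_vector \<Rightarrow> real"
  assumes "smooth_on U w" "u \<in> U"
  shows "deriv_along X (\<lambda>u. sin (w u)) u = cos (w u) * deriv_along X w u"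
  using deriv_alongI[OF has_derivative_sin[OF smooth_on_has_derivative[OF assms]], of X]
  by (simp add: deriv_along_def)

lemma cos_sin_squared: "cos t * cos t + sin t * sin t = (1::real)"
  using sin_cos_squared_add2[of t] by (simp add: power2_eq_square)

text \<open>The angle \<open>\<omega>\<close> stays abstract because the two cases supply it
  differently: as a linear function of the horospherical coordinates for parallel null curves, as a
  multiple of the polar angle for circles.\<close>

locale rotating_frame = null_frame V x c s for V x c s +
  fixes N \<omega> :: "real^3 \<Rightarrow> real"
  assumes smooth_N [simp]: "smooth_on V N" and smooth_\<omega> [simp]: "smooth_on V \<omega>"
    and N_pos: "\<And>u. u \<in> V \<Longrightarrow> N u > 0" and N_sq: "\<And>u. u \<in> V \<Longrightarrow> N u * N u = N2 u"
    and d1_\<omega>: "\<And>u. u \<in> V \<Longrightarrow> d1 \<omega> u = 0" and d2_\<omega>: "\<And>u. u \<in> V \<Longrightarrow> d2 \<omega> u = 0" and d3_\<omega>: "\<And>u. u \<in> V \<Longrightarrow> d3 \<omega> u = N u"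
    and convex_V: "convex V" and nonempty_V: "V \<noteq> {}"
begin

lemma d_N:
  assumes u: "u \<in> V"
  shows "d1 N u = 0" "d2 N u = - \<kappa> u * N u" "d3 N u = 0"
proof -
  have "deriv_along X (\<lambda>z. N z * N z) u = deriv_along X N2 u" for X
    by (rule d_cong[OF u N_sq])
  then have *: "2 * N u * deriv_along X N u = deriv_along X N2 u" for X
    using u by (simp add: deriv_along_mult[where U = V] mult.assoc)
  have nz: "2 * N u \<noteq> 0" using N_pos[OF u] by simp
  have "2 * N u * d2 N u = 2 * N u * (- \<kappa> u * N u)"
    unfolding * d_N2(2)[OF u] N_sq[OF u, symmetric] by (simp add: algebra_simps)
  then show "d2 N u = - \<kappa> u * N u" using nz mult_left_cancel by blast
  have "2 * N u * d1 N u = 0" "2 * N u * d3 N u = 0"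
    unfolding * using d_N2[OF u] by blast+
  then show "d1 N u = 0" "d3 N u = 0" using nz mult_eq_0_iff by blast+
qed

definition n where "n u = inverse (N u)"

lemma smooth_n [simp]: "smooth_on V n"
  unfolding n_def[abs_def] using N_pos by (intro smooth_on_inverse) force+

lemma n_N: "u \<in> V \<Longrightarrow> n u * N u = 1" "u \<in> V \<Longrightarrow> n u > 0" "u \<in> V \<Longrightarrow> n u * N2 u = N u"
  using N_pos[of u] N_sq[of u, symmetric] by (simp_all add: n_def)

lemma d_n:
  assumes u: "u \<in> V"
  shows "d1 n u = 0" "d2 n u = \<kappa> u * n u" "d3 n u = 0"
proof -
  have "n u * deriv_along X N u + deriv_along X n u * N u = 0" for X
    using d_zero[OF u n_N(1), of "\<lambda>z. z" X] u by (simp add: deriv_along_mult[where U = V])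
  from this[of "\<lambda>u. axis 1 1"] this[of X2] this[of X3]
  have "d1 n u * N u = 0" "d2 n u * N u = \<kappa> u * n u * N u" "d3 n u * N u = 0"
    using u by (simp_all add: d_N mult.commute)
  then show "d1 n u = 0" "d2 n u = \<kappa> u * n u" "d3 n u = 0"
    using N_pos[OF u] by simp_all
qed

lemmas smooth_cos_\<omega> [simp] = smooth_on_cos[OF open_V smooth_\<omega>] smooth_on_sin[OF open_V smooth_\<omega>]

lemmas d_trig = deriv_along_cos[OF smooth_\<omega>] deriv_along_sin[OF smooth_\<omega>]

text \<open>Along \<open>X3\<close> the orthonormal pair \<open>E3\<close>, \<open>f / N\<close>
  rotates with speed \<open>N\<close>. Turning it back by \<open>\<omega>\<close> gives constant
  vectors; the signs are those for which the position becomes \<open>\<rho> cos \<omega>\<close>,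
  \<open>\<rho> sin \<omega>\<close> up to a translation.\<close>

definition A1 where "A1 u = - (n u * cos (\<omega> u)) *\<^sub>R f u - sin (\<omega> u) *\<^sub>R E3 u"
definition A2 where "A2 u = - (n u * sin (\<omega> u)) *\<^sub>R f u + cos (\<omega> u) *\<^sub>R E3 u"

lemma smooth_A [simp]: "smooth_on V A1" "smooth_on V A2"
  unfolding A1_def[abs_def] A2_def[abs_def] by simp_all

lemma d_A:
  assumes u: "u \<in> V"
  shows "d1 A1 u = 0" "d2 A1 u = 0" "d3 A1 u = 0" "d1 A2 u = 0" "d2 A2 u = 0" "d3 A2 u = 0"
proof -
  have 1: "deriv_along X A1 u = - (n u * cos (\<omega> u)) *\<^sub>R deriv_along X f u
      - (n u * (- sin (\<omega> u) * deriv_along X \<omega> u) + deriv_along X n u * cos (\<omega> u)) *\<^sub>R f u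
      - (sin (\<omega> u) *\<^sub>R deriv_along X E3 u + (cos (\<omega> u) * deriv_along X \<omega> u) *\<^sub>R E3 u)" for X
    unfolding A1_def[abs_def] using u by (simp add: d_rules d_trig)
  have 2: "deriv_along X A2 u = - (n u * sin (\<omega> u)) *\<^sub>R deriv_along X f u
      - (n u * (cos (\<omega> u) * deriv_along X \<omega> u) + deriv_along X n u * sin (\<omega> u)) *\<^sub>R f u
      + (cos (\<omega> u) *\<^sub>R deriv_along X E3 u + (- sin (\<omega> u) * deriv_along X \<omega> u) *\<^sub>R E3 u)" for X
    unfolding A2_def[abs_def] using u by (simp add: d_rules d_trig)
  have nn: "n u * (t * N u) = t" "n u * t * N2 u = t * N u" for t
    using n_N[OF u] by (simp_all add: mult.left_commute)
  show "d1 A1 u = 0" "d2 A1 u = 0" "d1 A2 u = 0" "d2 A2 u = 0"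
    unfolding 1 2 using u by (simp_all add: d_n d1_\<omega> d2_\<omega> d1_f d2_f d1_E3 d2_E3 algebra_simps)
  have d3: "d3 E3 u = f u" by (simp add: f_def)
  show "d3 A1 u = 0" "d3 A2 u = 0"
    unfolding 1 2 using u by (simp_all add: d_n d3_\<omega> d3_f_\<kappa> d3 nn)
qed

definition a where "a = A1 (SOME u. u \<in> V)"
definition b where "b = A2 (SOME u. u \<in> V)"

lemma ab_const: "u \<in> V \<Longrightarrow> A1 u = a" "u \<in> V \<Longrightarrow> A2 u = b"
  unfolding a_def b_def
  using constant_on_convex[OF convex_V smooth_A(1)] constant_on_convex[OF convex_V smooth_A(2)] d_A
    some_in_eq[of V] nonempty_V by blast+

lemma ab_inner:
  assumes u: "u \<in> V"
  shows "a \<bullet> v = - (n u * cos (\<omega> u)) * (f u \<bullet> v) - sin (\<omega> u) * (E3 u \<bullet> v)"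
    "b \<bullet> v = - (n u * sin (\<omega> u)) * (f u \<bullet> v) + cos (\<omega> u) * (E3 u \<bullet> v)"
  unfolding ab_const[OF u, symmetric] A1_def A2_def by (simp_all add: inner_simps)

lemma ab_orthonormal: "norm a = 1" "norm b = 1" "a \<bullet> b = 0"
proof -
  obtain u where u: "u \<in> V" using nonempty_V by blast
  note cc = cos_sin_squared[of "\<omega> u"]
  have fE: "f u \<bullet> E3 u = 0" "E3 u \<bullet> f u = 0" "E3 u \<bullet> E3 u = 1"
    using f_frame(3)[OF u] frame[OF u] by (simp_all add: inner_commute)
  have fa: "f u \<bullet> a = - N u * cos (\<omega> u)" "f u \<bullet> b = - N u * sin (\<omega> u)"
    using n_N[OF u] fE by (simp_all add: ab_const[OF u, symmetric] A1_def A2_def inner_simps mult.left_commute mult.commute)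
  have Ea: "E3 u \<bullet> a = - sin (\<omega> u)" "E3 u \<bullet> b = cos (\<omega> u)"
    using fE by (simp_all add: ab_const[OF u, symmetric] A1_def A2_def inner_simps)
  have "a \<bullet> a = (n u * N u) * (cos (\<omega> u) * cos (\<omega> u)) + sin (\<omega> u) * sin (\<omega> u)"
    "b \<bullet> b = (n u * N u) * (sin (\<omega> u) * sin (\<omega> u)) + cos (\<omega> u) * cos (\<omega> u)"
    "a \<bullet> b = (n u * N u) * (cos (\<omega> u) * sin (\<omega> u)) - cos (\<omega> u) * sin (\<omega> u)"
    unfolding ab_inner[OF u] fa Ea by (simp_all add: algebra_simps)
  then show "norm a = 1" "norm b = 1" "a \<bullet> b = 0"
    using cc n_N[OF u] by (simp_all add: norm_eq_1 add.commute)
qed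

text \<open>Radius of the circular motion in the plane: the length \<open>exp (- u1)\<close> of
  \<open>d3 x\<close> divided by the angular speed \<open>N\<close>.\<close>

definition \<rho> where "\<rho> u = exp (- u $ 1) * n u"

lemma smooth_\<rho> [simp]: "smooth_on V \<rho>" unfolding \<rho>_def[abs_def] by simp

lemma d_\<rho>: "u \<in> V \<Longrightarrow> d1 \<rho> u = - \<rho> u" "u \<in> V \<Longrightarrow> d2 \<rho> u = \<kappa> u * \<rho> u" "u \<in> V \<Longrightarrow> d3 \<rho> u = 0"
  unfolding \<rho>_def[abs_def] by (simp_all add: d_rules d_n)

lemma ab_x:
  assumes u: "u \<in> V"
  shows "a \<bullet> e1 u = - \<rho> u * cos (\<omega> u)" "a \<bullet> d2 x u = \<kappa> u * \<rho> u * cos (\<omega> u)" "a \<bullet> d3 x u = - (exp (- u $ 1) * sin (\<omega> u))"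
    "b \<bullet> e1 u = - \<rho> u * sin (\<omega> u)" "b \<bullet> d2 x u = \<kappa> u * \<rho> u * sin (\<omega> u)" "b \<bullet> d3 x u = exp (- u $ 1) * cos (\<omega> u)"
  using f_frame[OF u] frame'[OF u] unfolding ab_inner[OF u] by (simp_all add: dx \<rho>_def)

lemma ab_B: "u \<in> V \<Longrightarrow> a \<bullet> B u = 0" "u \<in> V \<Longrightarrow> b \<bullet> B u = 0"
  using f_perp[of u] bianchi_normal(4)[of u] ab_inner[of u] by simp_all

definition ga where "ga = (let u = SOME u. u \<in> V in a \<bullet> x u - \<rho> u * cos (\<omega> u))"
definition gb where "gb = (let u = SOME u. u \<in> V in b \<bullet> x u - \<rho> u * sin (\<omega> u))"

lemma n_eps: "u \<in> V \<Longrightarrow> \<rho> u * N u = exp (- u $ 1)"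
  using n_N(1)[of u] by (simp add: \<rho>_def mult.assoc)

text \<open>This integrates \<open>ab_x\<close>: after subtraction of the rotating term all three
  frame derivatives vanish, and \<open>ga\<close>, \<open>gb\<close> are the constants of
  integration.\<close>

lemma ab_position:
  assumes u: "u \<in> V"
  shows "a \<bullet> x u = ga + \<rho> u * cos (\<omega> u)" "b \<bullet> x u = gb + \<rho> u * sin (\<omega> u)"
proof -
  let ?F = "\<lambda>u. a \<bullet> x u - \<rho> u * cos (\<omega> u)" and ?G = "\<lambda>u. b \<bullet> x u - \<rho> u * sin (\<omega> u)"
  have F: "deriv_along X ?F z = a \<bullet> deriv_along X x z - (\<rho> z * (- sin (\<omega> z) * deriv_along X \<omega> z) + deriv_along X \<rho> z * cos (\<omega> z))"
    "deriv_along X ?G z = b \<bullet> deriv_along X x z - (\<rho> z * (cos (\<omega> z) * deriv_along X \<omega> z) + deriv_along X \<rho> z * sin (\<omega> z))"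
    if "z \<in> V" for X z
    using that by (simp_all add: d_rules d_trig)
  have "?F u = ?F v \<and> ?G u = ?G v" if "v \<in> V" for v
    by (intro conjI constant_on_convex[OF convex_V _ _ _ _ u that])
      (simp_all add: F ab_x d_\<rho> d1_\<omega> d2_\<omega> d3_\<omega> n_eps[symmetric])
  then have "?F u = ga" "?G u = gb"
    using some_in_eq[of V] nonempty_V unfolding ga_def gb_def Let_def by blast+
  then show "a \<bullet> x u = ga + \<rho> u * cos (\<omega> u)" "b \<bullet> x u = gb + \<rho> u * sin (\<omega> u)" by simp_all
qed

end

section \<open>Coordinates adapted to the null curves\<close>

lemma pd_linear:
  assumes "bounded_linear L" "smooth_on U F" "u \<in> U"
  shows "pd i (\<lambda>w. L (F w)) u = L (pd i F u)"
  using frechet_derivative_at[OF bounded_linear.has_derivative[OF assms(1) smooth_on_has_derivative[OF assms(2,3)]]]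
  unfolding pd_def by metis

lemma immersion_onI:
  fixes F :: "real^2 \<Rightarrow> real^'m"
  assumes "smooth_on W F"
    and "\<And>w \<alpha> \<beta>. w \<in> W \<Longrightarrow> \<alpha> *\<^sub>R pd 1 F w + \<beta> *\<^sub>R pd 2 F w = 0 \<Longrightarrow> \<alpha> = 0 \<and> \<beta> = 0"
  shows "immersion_on W F"
  unfolding immersion_on_def
proof (intro conjI ballI)
  fix w assume w: "w \<in> W"
  have d: "F differentiable (at w)" using smooth_on_differentiable[OF assms(1) w] .
  show "inj (frechet_derivative F (at w))"
    unfolding linear_injective_0[OF linear_frechet_derivative[OF d]]
  proof (intro allI impI)
    fix v assume "frechet_derivative F (at w) v = 0"
    then have "v $ 1 = 0 \<and> v $ 2 = 0"
      by (intro assms(2)[OF w]) (simp only: frechet_derivative_pd[OF d] sum_2)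
    then show "v = 0" by (simp add: vec_eq_iff forall_2)
  qed
qed (rule assms(1))

lemma first_two_eq: "first_two v = v $ 1 *\<^sub>R axis 1 1 + v $ 2 *\<^sub>R axis 2 1"
  by (simp add: first_two_def vec_eq_iff forall_2 axis_def)

lemma bounded_linear_first_two: "bounded_linear first_two"
  unfolding first_two_eq[abs_def]
  by (intro bounded_linear_add bounded_linear_scaleR_const bounded_linear_vec_nth)

lemma open_product_box:
  assumes "open W" "open J"
  shows "open {v::real^3. first_two v \<in> W \<and> v $ 3 \<in> J}"
proof -
  have "{v::real^3. first_two v \<in> W \<and> v $ 3 \<in> J} = first_two -` W \<inter> (\<lambda>v. v $ 3) -` J" by auto
  moreover have "open (first_two -` W)" "open ((\<lambda>v::real^3. v $ 3) -` J)"
    using assms linear_continuous_on[OF bounded_linear_first_two] linear_continuous_on[OF bounded_linear_vec_nth]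
    by (auto intro: open_vimage)
  ultimately show ?thesis by (simp add: open_Int)
qed

text \<open>\<open>\<psi>\<close> and \<open>\<tau>\<close> identify \<open>V'\<close> with a
  product of \<open>W\<close> and \<open>J\<close> whose third coordinate lines are null curves. The
  product shape makes each of these lines a full interval, so whatever is constant along
  \<open>X3\<close> descends to \<open>W\<close>. The two cases use \<open>l = 1 / k\<close>,
  \<open>\<mu> = 1 / k\<close> and \<open>l = 1\<close>, \<open>\<mu>\<close> the radius.\<close>

locale adapted_chart = rotating_frame V x c s N \<omega> for V x c s N \<omega> +
  fixes V' :: "(real^3) set" and \<psi> \<tau> :: "real^3 \<Rightarrow> real^3" and W :: "(real^2) set" and J :: "real set"
    and j l :: real and \<mu> :: "real^3 \<Rightarrow> real"
  assumes open_V' [simp]: "open V'" and V'_V: "V' \<subseteq> V" and open_W [simp]: "open W"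
    and J: "open J" "convex J" "j \<in> J" and l: "l \<noteq> 0"
    and smooth_\<psi> [simp]: "smooth_on V' \<psi>" and smooth_\<tau>: "smooth_on {v. first_two v \<in> W \<and> v $ 3 \<in> J} \<tau>"
    and \<psi>_in: "\<And>u. u \<in> V' \<Longrightarrow> first_two (\<psi> u) \<in> W" "\<And>u. u \<in> V' \<Longrightarrow> \<psi> u $ 3 \<in> J"
    and \<tau>_\<psi>: "\<And>u. u \<in> V' \<Longrightarrow> \<tau> (\<psi> u) = u"
    and \<tau>_in: "\<And>v. first_two v \<in> W \<Longrightarrow> v $ 3 \<in> J \<Longrightarrow> \<tau> v \<in> V'"
    and \<psi>_\<tau>: "\<And>v. first_two v \<in> W \<Longrightarrow> v $ 3 \<in> J \<Longrightarrow> \<psi> (\<tau> v) = v"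
    and pd_\<tau>: "\<And>v. first_two v \<in> W \<Longrightarrow> v $ 3 \<in> J \<Longrightarrow> pd 1 \<tau> v = axis 1 1"
      "\<And>v. first_two v \<in> W \<Longrightarrow> v $ 3 \<in> J \<Longrightarrow> pd 2 \<tau> v = l *\<^sub>R X2 (\<tau> v)"
      "\<And>v. first_two v \<in> W \<Longrightarrow> v $ 3 \<in> J \<Longrightarrow> pd 3 \<tau> v = \<mu> v *\<^sub>R X3 (\<tau> v)"
begin

definition Box where "Box = {v. first_two v \<in> W \<and> v $ 3 \<in> J}"

lemma Box_iff: "v \<in> Box \<longleftrightarrow> first_two v \<in> W \<and> v $ 3 \<in> J" by (simp add: Box_def)

lemma open_Box: "open Box"
  unfolding Box_def by (rule open_product_box[OF open_W J(1)])

lemma \<tau>_V: "v \<in> Box \<Longrightarrow> \<tau> v \<in> V"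
  using \<tau>_in V'_V by (auto simp: Box_def)

definition \<sigma> :: "real^2 \<Rightarrow> real^3" where
  "\<sigma> w = (w $ 1 *\<^sub>R axis 1 1 + w $ 2 *\<^sub>R axis 2 1) + j *\<^sub>R axis 3 1"

lemma \<sigma>_Box: "w \<in> W \<Longrightarrow> \<sigma> w \<in> Box" "first_two (\<sigma> w) = w"
proof -
  have v2: "vector [w $ 1, w $ 2] = w" for w :: "real^2" by (simp add: vec_eq_iff forall_2)
  show "w \<in> W \<Longrightarrow> \<sigma> w \<in> Box" "first_two (\<sigma> w) = w"
    using J by (simp_all add: Box_def \<sigma>_def first_two_def axis_def v2)
qed

text \<open>Restriction to the cross-section with third coordinate \<open>j\<close>, transversal to
  the null curves.\<close>

definition slice :: "(real^3 \<Rightarrow> 'b) \<Rightarrow> real^2 \<Rightarrow> 'b" where "slice F w = F (\<tau> (\<sigma> w))"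

lemma slice_point: "w \<in> W \<Longrightarrow> \<tau> (\<sigma> w) \<in> V'" "w \<in> W \<Longrightarrow> \<tau> (\<sigma> w) \<in> V" "w \<in> W \<Longrightarrow> first_two (\<psi> (\<tau> (\<sigma> w))) = w"
  using \<tau>_in \<psi>_\<tau> \<sigma>_Box V'_V by (auto simp: Box_iff)

lemma smooth_\<sigma>: "smooth_on W \<sigma>"
  unfolding \<sigma>_def[abs_def] by (intro smooth_intros) simp_all

lemma \<sigma>_deriv: "(\<sigma> has_derivative (\<lambda>v. v $ 1 *\<^sub>R axis 1 1 + v $ 2 *\<^sub>R axis 2 1)) (at w)"
  unfolding \<sigma>_def[abs_def]
  by (auto intro!: derivative_eq_intros bounded_linear.has_derivative[OF bounded_linear_vec_nth])

lemma smooth_slice [simp]: "smooth_on V F \<Longrightarrow> smooth_on W (slice F)"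
  unfolding slice_def[abs_def]
  using smooth_on_compose[OF open_W open_Box _ smooth_\<sigma> smooth_\<tau>[folded Box_def]] \<sigma>_Box slice_point
  by (intro smooth_on_compose[OF open_W open_V, of "\<lambda>w. \<tau> (\<sigma> w)" F]) auto

lemma pd_slice:
  assumes F: "smooth_on V F" and w: "w \<in> W"
  shows "pd 1 (slice F) w = slice (d1 F) w" "pd 2 (slice F) w = l *\<^sub>R slice (d2 F) w"
proof -
  have b: "\<sigma> w \<in> Box" using \<sigma>_Box w by simp
  have F': "(F has_derivative frechet_derivative F (at (\<tau> (\<sigma> w)))) (at (\<tau> (\<sigma> w)))"
    by (rule smooth_on_has_derivative[OF F \<tau>_V[OF b]])
  have \<tau>': "(\<tau> has_derivative frechet_derivative \<tau> (at (\<sigma> w))) (at (\<sigma> w))"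
    by (rule smooth_on_has_derivative[OF smooth_\<tau>[folded Box_def] b])
  have "(slice F has_derivative
      (\<lambda>v. frechet_derivative F (at (\<tau> (\<sigma> w))) (frechet_derivative \<tau> (at (\<sigma> w)) (v $ 1 *\<^sub>R axis 1 1 + v $ 2 *\<^sub>R axis 2 1)))) (at w)"
    unfolding slice_def[abs_def]
    by (rule has_derivative_compose[OF has_derivative_compose[OF \<sigma>_deriv \<tau>'] F'])
  note D = frechet_derivative_at[OF this, symmetric]
  have ax: "axis (1::2) (1::real) $ 1 = 1" "axis (1::2) (1::real) $ 2 = 0" "axis (2::2) (1::real) $ 1 = 0" "axis (2::2) (1::real) $ 2 = 1"
    by (simp_all add: axis_def)
  have "pd 1 (slice F) w = frechet_derivative F (at (\<tau> (\<sigma> w))) (pd 1 \<tau> (\<sigma> w))"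
    "pd 2 (slice F) w = frechet_derivative F (at (\<tau> (\<sigma> w))) (pd 2 \<tau> (\<sigma> w))"
    by (simp_all add: pd_def D ax)
  then show "pd 1 (slice F) w = slice (d1 F) w" "pd 2 (slice F) w = l *\<^sub>R slice (d2 F) w"
    using b pd_\<tau> linear_cmul[OF linear_frechet_derivative[OF smooth_on_differentiable[OF F \<tau>_V[OF b]]]]
    by (simp_all add: Box_iff slice_def deriv_along_def)
qed

text \<open>The third coordinate line through \<open>\<psi> u\<close> remains in the box until it
  meets the cross-section, and its image under \<open>\<tau>\<close> has velocity along
  \<open>X3\<close>, so \<open>F\<close> does not change on it.\<close>

lemma factor_slice:
  assumes F: "smooth_on V F" and d3: "\<And>u. u \<in> V \<Longrightarrow> d3 F u = 0" and u: "u \<in> V'"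
  shows "F u = slice F (first_two (\<psi> u))"
proof -
  define v where "v = \<psi> u"
  define q :: "real \<Rightarrow> real^3" where "q t = (v $ 1 *\<^sub>R axis 1 1 + v $ 2 *\<^sub>R axis 2 1) + t *\<^sub>R axis 3 1" for t
  have q_Box: "q t \<in> Box" if "t \<in> J" for t
  proof -
    have "first_two (q t) = first_two v" "q t $ 3 = t"
      by (simp_all add: q_def first_two_def axis_def)
    then show ?thesis using \<psi>_in[OF u] that by (simp add: Box_iff v_def)
  qed
  have "((\<lambda>t. F (\<tau> (q t))) has_derivative (\<lambda>h. 0)) (at t within J)" if t: "t \<in> J" for t
  proof -
    have b: "q t \<in> Box" by (rule q_Box[OF t])
    have d: "F differentiable (at (\<tau> (q t)))" "\<tau> differentiable (at (q t))"
      using smooth_on_differentiable[OF F \<tau>_V[OF b]] smooth_on_differentiable[OF smooth_\<tau>[folded Box_def] b] by auto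
    have q': "(q has_derivative (\<lambda>h. h *\<^sub>R axis 3 1)) (at t)"
      unfolding q_def[abs_def] by (auto intro!: derivative_eq_intros)
    have "((\<lambda>t. F (\<tau> (q t))) has_derivative
        (\<lambda>h. frechet_derivative F (at (\<tau> (q t))) (frechet_derivative \<tau> (at (q t)) (h *\<^sub>R axis 3 1)))) (at t)"
      using d by (intro has_derivative_compose[OF has_derivative_compose[OF q']]) (simp_all add: frechet_derivative_works[symmetric])
    moreover have "frechet_derivative F (at (\<tau> (q t))) (frechet_derivative \<tau> (at (q t)) (h *\<^sub>R axis 3 1)) = 0" for h
    proof -
      have "frechet_derivative \<tau> (at (q t)) (h *\<^sub>R axis 3 1) = h *\<^sub>R pd 3 \<tau> (q t)"
        using linear_cmul[OF linear_frechet_derivative[OF d(2)]] by (simp add: pd_def)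
      also have "\<dots> = (h * \<mu> (q t)) *\<^sub>R X3 (\<tau> (q t))"
        using b pd_\<tau>(3) by (simp add: Box_iff)
      finally show ?thesis
        using linear_cmul[OF linear_frechet_derivative[OF d(1)]] d3[OF \<tau>_V[OF b]] by (simp add: deriv_along_def)
    qed
    ultimately show ?thesis by (auto intro: has_derivative_at_withinI)
  qed
  from has_derivative_zero_constant[OF J(2) this] obtain k where k: "\<And>t. t \<in> J \<Longrightarrow> F (\<tau> (q t)) = k"
    by blast
  have "q (v $ 3) = v" by (simp add: q_def vec_eq_iff forall_3 axis_def)
  then have "F u = k" using k[of "v $ 3"] \<psi>_in[OF u] \<tau>_\<psi>[OF u] by (simp add: v_def)
  moreover have "q j = \<sigma> (first_two v)" by (simp add: q_def \<sigma>_def first_two_def)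
  ultimately show ?thesis using k[OF J(3)] by (simp add: slice_def v_def)
qed

lemma bianchi_independent:
  assumes u: "u \<in> V" and z: "\<alpha> *\<^sub>R d1 (bianchi x) u + \<beta> *\<^sub>R B u = 0"
  shows "\<alpha> = 0 \<and> \<beta> = 0"
proof -
  have "(\<alpha> *\<^sub>R d1 (bianchi x) u + \<beta> *\<^sub>R B u) \<bullet> e1 u = \<alpha>"
    using frame[OF u] B_perp[OF u] x11_perp[OF u] u by (simp add: d1_bianchi inner_simps)
  then have "\<alpha> = 0" using z by simp
  then show ?thesis using z B_nonzero[OF u] by simp
qed

definition ybar where "ybar = slice (bianchi x)"

lemma ybar_immersion: "immersion_on W ybar"
  unfolding ybar_def
proof (rule immersion_onI)
  fix w \<alpha> \<beta> assume w: "w \<in> W" and z: "\<alpha> *\<^sub>R pd 1 (slice (bianchi x)) w + \<beta> *\<^sub>R pd 2 (slice (bianchi x)) w = 0"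
  then have "\<alpha> *\<^sub>R d1 (bianchi x) (\<tau> (\<sigma> w)) + (\<beta> * l) *\<^sub>R B (\<tau> (\<sigma> w)) = 0"
    by (simp add: pd_slice[OF _ w] slice_def B_def)
  then show "\<alpha> = 0 \<and> \<beta> = 0"
    using bianchi_independent[OF slice_point(2)[OF w]] l by fastforce
qed simp

lemma ybar: "u \<in> V' \<Longrightarrow> bianchi x u = ybar (first_two (\<psi> u))"
  unfolding ybar_def by (rule factor_slice) (simp_all add: d3_bianchi)

lemma image_W: "(\<lambda>u. first_two (\<psi> u)) ` V' = W"
  using \<psi>_in slice_point by (auto simp: image_iff) metis

lemma smooth_\<pi>: "smooth_on V' (\<lambda>u. first_two (\<psi> u))"
  by (rule smooth_on_linear[OF bounded_linear_first_two]) simp_all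

text \<open>\<open>bianchi x\<close> is the immersion \<open>ybar\<close> following the projection
  by the first two coordinates, so the two differentials have the same kernel; on an interval, zero
  velocity of the projected curve means constancy.\<close>

lemma null_curve_iff:
  assumes "regular_curve V' I \<gamma>"
  shows "null_curve (bianchi x) V' I \<gamma> \<longleftrightarrow> (\<lambda>t. first_two (\<psi> (\<gamma> t))) constant_on I"
proof -
  have I: "open I" "convex I" and g: "smooth_on I \<gamma>" "\<And>t. t \<in> I \<Longrightarrow> \<gamma> t \<in> V'"
    using assms by (auto simp: regular_curve_def is_interval_convex)
  let ?\<pi> = "\<lambda>u. first_two (\<psi> u)" and ?\<gamma>' = "\<lambda>t. vector_derivative \<gamma> (at t)"
  have \<gamma>': "(\<gamma> has_derivative (\<lambda>h. h *\<^sub>R ?\<gamma>' t)) (at t)" if "t \<in> I" for t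
    using smooth_on_differentiable[OF g(1) that]
    by (metis has_vector_derivative_def vector_derivative_works)
  have \<pi>': "((\<lambda>t. ?\<pi> (\<gamma> t)) has_derivative (\<lambda>h. h *\<^sub>R frechet_derivative ?\<pi> (at (\<gamma> t)) (?\<gamma>' t))) (at t)" if t: "t \<in> I" for t
  proof -
    have d: "?\<pi> differentiable (at (\<gamma> t))" by (rule smooth_on_differentiable[OF smooth_\<pi> g(2)[OF t]])
    from has_derivative_compose[OF \<gamma>'[OF t] d[unfolded frechet_derivative_works]] show ?thesis
      using linear_cmul[OF linear_frechet_derivative[OF d]] by simp
  qed
  have F: "frechet_derivative (bianchi x) (at (\<gamma> t)) (?\<gamma>' t) = 0 \<longleftrightarrow> frechet_derivative ?\<pi> (at (\<gamma> t)) (?\<gamma>' t) = 0"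
    if t: "t \<in> I" for t
  proof -
    have w: "?\<pi> (\<gamma> t) \<in> W" using \<psi>_in g(2)[OF t] by auto
    have sy: "smooth_on W ybar" using ybar_immersion by (simp add: immersion_on_def)
    have dy: "ybar differentiable (at (?\<pi> (\<gamma> t)))" by (rule smooth_on_differentiable[OF sy w])
    have "frechet_derivative (bianchi x) (at (\<gamma> t)) = frechet_derivative (\<lambda>u. ybar (?\<pi> u)) (at (\<gamma> t))"
      by (rule frechet_derivative_cong[OF open_V' g(2)[OF t]]) (rule ybar)
    then have "frechet_derivative (bianchi x) (at (\<gamma> t)) (?\<gamma>' t)
        = frechet_derivative ybar (at (?\<pi> (\<gamma> t))) (frechet_derivative ?\<pi> (at (\<gamma> t)) (?\<gamma>' t))"
      using deriv_along_compose[OF smooth_on_differentiable[OF smooth_\<pi> g(2)[OF t]] dy] by simp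
    moreover have "inj (frechet_derivative ybar (at (?\<pi> (\<gamma> t))))"
      using ybar_immersion w by (simp add: immersion_on_def)
    ultimately show ?thesis
      using linear_injective_0[OF linear_frechet_derivative[OF dy]] linear_0[OF linear_frechet_derivative[OF dy]] by auto
  qed
  show ?thesis
  proof
    assume "null_curve (bianchi x) V' I \<gamma>"
    then have "((\<lambda>t. ?\<pi> (\<gamma> t)) has_derivative (\<lambda>h. 0)) (at t within I)" if "t \<in> I" for t
      using \<pi>'[OF that] F[OF that] that by (auto simp: null_curve_def intro: has_derivative_at_withinI)
    from has_derivative_zero_constant[OF I(2) this] show "(\<lambda>t. ?\<pi> (\<gamma> t)) constant_on I"
      by (auto simp: constant_on_def)
  next
    assume "(\<lambda>t. ?\<pi> (\<gamma> t)) constant_on I"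
    then obtain k where k: "\<And>t. t \<in> I \<Longrightarrow> ?\<pi> (\<gamma> t) = k" by (auto simp: constant_on_def)
    have "frechet_derivative ?\<pi> (at (\<gamma> t)) (?\<gamma>' t) = 0" if t: "t \<in> I" for t
    proof -
      have "((\<lambda>t. ?\<pi> (\<gamma> t)) has_derivative (\<lambda>h. 0)) (at t)"
        by (rule has_derivative_transform_within_open[OF has_derivative_const I(1) t]) (simp add: k)
      from has_derivative_unique[OF this \<pi>'[OF t]] show ?thesis
        by (metis scaleR_one)
    qed
    then show "null_curve (bianchi x) V' I \<gamma>"
      using F assms by (simp add: null_curve_def)
  qed
qed

end

text \<open>The double cross product formula makes \<open>n\<close> parallel to
  \<open>cross3 v w\<close>. Two parallel vectors with zero inner product cannot both be
  nonzero.\<close>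

lemma cross3_independent:
  fixes v w n :: "real^3"
  assumes ind: "\<And>\<alpha> \<beta>. \<alpha> *\<^sub>R v + \<beta> *\<^sub>R w = 0 \<Longrightarrow> \<alpha> = 0 \<and> \<beta> = 0"
    and n: "n \<noteq> 0" "n \<bullet> v = 0" "n \<bullet> w = 0"
  shows "n \<bullet> cross3 v w \<noteq> 0"
proof
  assume 0: "n \<bullet> cross3 v w = 0"
  have "cross3 v w \<noteq> 0"
  proof
    assume "cross3 v w = 0"
    then have "v = 0 \<or> w = 0 \<or> (\<exists>k. w = k *\<^sub>R v)"
      unfolding cross_eq_0 collinear_lemma .
    then show False
    proof (elim disjE exE)
      assume "v = 0"
      then show ?thesis using ind[of 1 0] by simp
    next
      assume "w = 0"
      then show ?thesis using ind[of 0 1] by simp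
    next
      fix k assume "w = k *\<^sub>R v"
      then show ?thesis using ind[of "- k" 1] by simp
    qed
  qed
  moreover have "cross3 (cross3 v w) n = (v \<bullet> n) *\<^sub>R w - (w \<bullet> n) *\<^sub>R v"
    unfolding vec_eq_iff forall_3 by (simp add: cross3_simps)
  then have "cross3 (cross3 v w) n = 0" using n by (simp add: inner_commute)
  then have "cross3 v w = 0 \<or> n = 0"
    using norm_cross_dot[of "cross3 v w" n] 0 by (simp add: inner_commute)
  ultimately show False using n(1) by simp
qed

context adapted_chart
begin

text \<open>Once \<open>a\<close> and \<open>b\<close> are rotated onto the last two axes,
  \<open>ab_position\<close> supplies these coordinates up to a translation. The other three,
  \<open>L (x u)\<close>, are constant along null curves because \<open>d3 x\<close> lies in the
  plane of \<open>a\<close> and \<open>b\<close>, so they descend to \<open>xbar\<close> on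
  \<open>W\<close>.\<close>

theorem normal_form:
  obtains g xbar where "rigid_motion g" "immersion_on W xbar"
    "\<And>u. u \<in> V' \<Longrightarrow> g (x u) = point5 (xbar (first_two (\<psi> u))) (\<rho> u * cos (\<omega> u)) (\<rho> u * sin (\<omega> u))"
    "\<And>w. w \<in> W \<Longrightarrow> b12 xbar w \<noteq> 0"
    "\<And>u. u \<in> V' \<Longrightarrow> metric xbar (first_two (\<psi> u)) $ 1 $ 1 = 1 - \<rho> u * \<rho> u"
    "\<And>u. u \<in> V' \<Longrightarrow> metric xbar (first_two (\<psi> u)) $ 1 $ 2 = l * \<kappa> u * \<rho> u * \<rho> u"
    "\<And>u. u \<in> V' \<Longrightarrow> metric xbar (first_two (\<psi> u)) $ 2 $ 2 = l * l * (exp (- u $ 1) * exp (- u $ 1) - \<kappa> u * \<kappa> u * (\<rho> u * \<rho> u))"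
proof -
  obtain R :: "real^5^5" and L :: "real^5 \<Rightarrow> real^3" where R: "rotation_matrix R" and L: "bounded_linear L"
    and RL: "\<And>v. R *v v = point5 (L v) (a \<bullet> v) (b \<bullet> v)"
    and LL: "\<And>v w. L v \<bullet> L w = v \<bullet> w - (a \<bullet> v) * (a \<bullet> w) - (b \<bullet> v) * (b \<bullet> w)"
    by (rule rotation_onto_coordinate_plane[OF ab_orthonormal]) (rule that; assumption)
  have lin: "linear L" using L bounded_linear.linear by blast
  note L_simps = linear_add[OF lin] linear_diff[OF lin] linear_cmul[OF lin]
  define g where "g v = R *v v + point5 0 (- ga) (- gb)" for v
  define xbar where "xbar w = L (slice x w)" for w
  let ?u = "\<lambda>w. \<tau> (\<sigma> w)"
  have smx: "smooth_on W xbar"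
    unfolding xbar_def[abs_def] by (rule smooth_on_linear[OF L open_W]) simp
  have pd1: "pd 1 xbar w = L (e1 (?u w))" and pd2: "pd 2 xbar w = l *\<^sub>R L (d2 x (?u w))" if w: "w \<in> W" for w
    unfolding xbar_def[abs_def]
    using w by (simp_all add: pd_linear[OF L smooth_slice[OF smooth_x]] pd_slice L_simps) (simp_all add: slice_def)
  have gram: "L (e1 u) \<bullet> L (e1 u) = 1 - \<rho> u * \<rho> u" "L (e1 u) \<bullet> L (d2 x u) = \<kappa> u * \<rho> u * \<rho> u"
    "L (d2 x u) \<bullet> L (d2 x u) = exp (- u $ 1) * exp (- u $ 1) - \<kappa> u * \<kappa> u * (\<rho> u * \<rho> u)" if u: "u \<in> V" for u
  proof -
    have cs1: "(cos (\<omega> u))\<^sup>2 = 1 - (sin (\<omega> u))\<^sup>2" by (simp add: cos_squared_eq)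
    have F: "e1 u \<bullet> e1 u = 1" "e1 u \<bullet> d2 x u = 0" "d2 x u \<bullet> d2 x u = exp (- u $ 1) * exp (- u $ 1)"
      using frame[OF u] by (simp_all add: dx)
    show "L (e1 u) \<bullet> L (e1 u) = 1 - \<rho> u * \<rho> u" "L (e1 u) \<bullet> L (d2 x u) = \<kappa> u * \<rho> u * \<rho> u"
      "L (d2 x u) \<bullet> L (d2 x u) = exp (- u $ 1) * exp (- u $ 1) - \<kappa> u * \<kappa> u * (\<rho> u * \<rho> u)"
      unfolding LL F ab_x[OF u] using cs1 by algebra+
  qed
  \<comment> \<open>A vector killed by \<open>L\<close> lies in the plane of \<open>a\<close> and
    \<open>b\<close>, here as \<open>\<gamma> * \<rho> u\<close> times a unit vector of that plane.
    The normal vector \<open>x11\<close> has product \<open>\<rho> u\<close> with this unit vector,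
    while a tangent vector is orthogonal to \<open>x11\<close>; hence
    \<open>\<gamma> = 0\<close>.\<close>
  have L0: "\<alpha> = 0 \<and> \<beta> = 0" if u: "u \<in> V" and z: "\<alpha> *\<^sub>R L (e1 u) + \<beta> *\<^sub>R L (d2 x u) = 0" for u \<alpha> \<beta>
  proof -
    define v where "v = \<alpha> *\<^sub>R e1 u + \<beta> *\<^sub>R d2 x u"
    define \<gamma> where "\<gamma> = - \<alpha> + \<beta> * \<kappa> u"
    have Lv: "L v = 0" using z by (simp add: v_def L_simps)
    have av: "a \<bullet> v = \<gamma> * \<rho> u * cos (\<omega> u)" "b \<bullet> v = \<gamma> * \<rho> u * sin (\<omega> u)"
      by (simp_all add: v_def inner_simps ab_x[OF u] \<gamma>_def algebra_simps)
    have ax: "a \<bullet> x11 u = \<rho> u * cos (\<omega> u)" "b \<bullet> x11 u = \<rho> u * sin (\<omega> u)"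
      unfolding ab_inner[OF u] using f_perp[OF u] x11_perp[OF u] by (simp_all add: \<rho>_def inner_commute)
    have "v \<bullet> x11 u = 0"
      using x11_perp[OF u] by (simp add: v_def inner_simps dx inner_commute)
    moreover have "L v \<bullet> L (x11 u) = 0" using Lv by simp
    ultimately have "\<gamma> * (\<rho> u * \<rho> u) * (cos (\<omega> u) * cos (\<omega> u) + sin (\<omega> u) * sin (\<omega> u)) = 0"
      unfolding LL av ax by algebra
    moreover have "\<rho> u > 0" using n_N[OF u] by (simp add: \<rho>_def)
    ultimately have "\<gamma> = 0" by (simp only: cos_sin_squared mult_eq_0_iff) simp
    moreover have "L v \<bullet> L v = 0" using Lv by simp
    ultimately have "v \<bullet> v = 0" unfolding LL av by simp
    then have v: "v = 0" by simp
    have "v \<bullet> e1 u = \<alpha>" "v \<bullet> E2 u = \<beta> * exp (- u $ 1)"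
      using frame'[OF u] by (simp_all add: v_def inner_simps dx)
    then show ?thesis using v by simp
  qed
  have ind: "\<alpha> = 0 \<and> \<beta> = 0" if w: "w \<in> W" and "\<alpha> *\<^sub>R pd 1 xbar w + \<beta> *\<^sub>R pd 2 xbar w = 0" for w \<alpha> \<beta>
    using L0[OF slice_point(2)[OF w], of \<alpha> "\<beta> * l"] that(2) l by (simp add: pd1[OF w] pd2[OF w])
  have imm: "immersion_on W xbar"
    by (rule immersion_onI[OF smx ind])
  have pos: "g (x u) = point5 (xbar (first_two (\<psi> u))) (\<rho> u * cos (\<omega> u)) (\<rho> u * sin (\<omega> u))" if u: "u \<in> V'" for u
  proof -
    have uV: "u \<in> V" using u V'_V by blast
    have "L (d3 x z) = 0" if z: "z \<in> V" for z
    proof -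
      have F: "d3 x z \<bullet> d3 x z = exp (- z $ 1) * exp (- z $ 1)" using frame[OF z] by (simp add: dx)
      have "L (d3 x z) \<bullet> L (d3 x z) = 0"
        unfolding LL F ab_x[OF z] using cos_squared_eq[of "\<omega> z"] by algebra
      then show ?thesis by simp
    qed
    moreover have "d3 (\<lambda>z. L (x z)) z = L (d3 x z)" if "z \<in> V" for z
      using deriv_alongI[OF bounded_linear.has_derivative[OF L smooth_on_has_derivative[OF smooth_x that]]]
      by (simp add: deriv_along_def)
    ultimately have "L (x u) = slice (\<lambda>z. L (x z)) (first_two (\<psi> u))"
      by (intro factor_slice[OF _ _ u] smooth_on_linear[OF L]) simp_all
    then have "L (x u) = xbar (first_two (\<psi> u))" by (simp add: slice_def xbar_def)
    then show ?thesis
      unfolding g_def RL ab_position[OF uV]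
      by (simp add: vec_eq_iff forall_5 point5_def)
  qed
  \<comment> \<open>\<open>L B\<close> is normal to \<open>xbar\<close>, since \<open>B\<close> is
    normal to the submanifold and orthogonal to \<open>a\<close> and \<open>b\<close>. The mixed
    derivative of \<open>xbar\<close> is \<open>l\<close> times \<open>L B\<close> minus the tangent
    vector \<open>pd 2 xbar\<close>.\<close>
  have b: "b12 xbar w \<noteq> 0" if w: "w \<in> W" for w
  proof -
    let ?n = "L (B (?u w))" and ?c = "cross3 (pd 1 xbar w) (pd 2 xbar w)"
    have uV: "?u w \<in> V" by (rule slice_point(2)[OF w])
    have LB: "?n \<bullet> L v = B (?u w) \<bullet> v" for v
      by (simp add: LL ab_B[OF uV])
    have "?n \<bullet> ?n \<noteq> 0" using LB[of "B (?u w)"] B_nonzero[OF uV] by simp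
    then have n0: "?n \<noteq> 0" by auto
    have nc: "?n \<bullet> ?c \<noteq> 0"
      by (rule cross3_independent[OF ind[OF w] n0]) (simp_all add: pd1[OF w] pd2[OF w] LB B_perp[OF uV] dx)
    have "pd 1 (pd 2 xbar) w = pd 1 (\<lambda>w. (l *\<^sub>R L (slice (d2 x) w))) w"
      by (rule pd_cong[OF open_W w]) (simp add: pd2 slice_def)
    also have "\<dots> = l *\<^sub>R L (slice (d1 (d2 x)) w)"
      using pd_linear[OF bounded_linear_compose[OF bounded_linear_scaleR_right[of l] L] smooth_slice w, of "d2 x" 1]
        pd_slice(1)[OF _ w, of "d2 x"] by simp
    also have "\<dots> = l *\<^sub>R ?n - exp (?u w $ 1) *\<^sub>R (exp (- ?u w $ 1) *\<^sub>R pd 2 xbar w)"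
      using uV by (simp add: slice_def d12 d2_e1 L_simps pd2[OF w] dx scaleR_diff_right exp_cancel)
    finally have p: "pd 1 (pd 2 xbar) w = l *\<^sub>R ?n - pd 2 xbar w" by (simp add: exp_cancel)
    have "pd 1 (pd 2 xbar) w \<bullet> ?c = l * (?n \<bullet> ?c)"
      unfolding p by (simp add: inner_diff_left dot_cross_self)
    then have pc: "pd 1 (pd 2 xbar) w \<bullet> ?c \<noteq> 0" using l nc by simp
    then have "?c \<noteq> 0" by auto
    then show ?thesis using pc by (simp add: b12_def unit_normal_def sgn_div_norm)
  qed
  have m: "metric xbar (first_two (\<psi> u)) $ i $ k = pd i xbar (first_two (\<psi> u)) \<bullet> pd k xbar (first_two (\<psi> u))" for u i k
    by (simp add: metric_def)
  \<comment> \<open>The metric was computed at the point of the cross-section on the same null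
    curve; \<open>u1\<close>, \<open>\<rho>\<close> and \<open>\<kappa>\<close> have the same values
    there.\<close>
  have "?u (first_two (\<psi> u)) $ 1 = u $ 1 \<and> \<rho> (?u (first_two (\<psi> u))) = \<rho> u \<and> \<kappa> (?u (first_two (\<psi> u))) = \<kappa> u" if u: "u \<in> V'" for u
  proof -
    have "exp (- u $ 1) = exp (- ?u (first_two (\<psi> u)) $ 1)"
      using factor_slice[of "\<lambda>z. exp (- z $ 1)", OF _ _ u] by (simp add: slice_def)
    moreover have "\<rho> u = \<rho> (?u (first_two (\<psi> u)))" "\<kappa> u = \<kappa> (?u (first_two (\<psi> u)))"
      using factor_slice[of \<rho>, OF _ _ u] factor_slice[of \<kappa>, OF _ _ u] d_\<rho> d3_f_\<kappa> by (simp_all add: slice_def)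
    ultimately show ?thesis by simp
  qed
  then have mm: "metric xbar (first_two (\<psi> u)) $ 1 $ 1 = 1 - \<rho> u * \<rho> u"
    "metric xbar (first_two (\<psi> u)) $ 1 $ 2 = l * \<kappa> u * \<rho> u * \<rho> u"
    "metric xbar (first_two (\<psi> u)) $ 2 $ 2 = l * l * (exp (- u $ 1) * exp (- u $ 1) - \<kappa> u * \<kappa> u * (\<rho> u * \<rho> u))" if u: "u \<in> V'" for u
    using u gram[OF slice_point(2)[OF \<psi>_in(1)[OF u]]] unfolding m
    by (simp_all add: pd1[OF \<psi>_in(1)[OF u]] pd2[OF \<psi>_in(1)[OF u]])
  have "rigid_motion g"
    unfolding rigid_motion_def g_def[abs_def] using R by blast
  then show thesis
    by (rule that[OF _ imm pos b mm])
qed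

end

section \<open>Coordinate maps into three-space, subframes and existence of charts\<close>

lemma vector3_eq: "(vector [p, q, r] :: real^3) = p *\<^sub>R axis 1 1 + q *\<^sub>R axis 2 1 + r *\<^sub>R axis 3 1"
  by (simp add: vec_eq_iff forall_3 axis_def)

lemma has_derivative_vector3:
  assumes "(p has_derivative p') (at u)" "(q has_derivative q') (at u)" "(r has_derivative r') (at u)"
  shows "((\<lambda>u. vector [p u, q u, r u] :: real^3) has_derivative (\<lambda>h. vector [p' h, q' h, r' h])) (at u)"
  unfolding vector3_eq using assms by (intro has_derivative_add has_derivative_scaleR_left)

lemma smooth_on_vector3:
  assumes "open U" "smooth_on U p" "smooth_on U q" "smooth_on U r"
  shows "smooth_on U (\<lambda>u. vector [p u, q u, r u] :: real^3)"
  unfolding vector3_eq using assms by (intro smooth_intros)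

lemma has_derivative_nth: "((\<lambda>u::real^'n. u $ i) has_derivative (\<lambda>h. h $ i)) (at u)"
  using bounded_linear.has_derivative[OF bounded_linear_vec_nth has_derivative_ident] .

lemma norm_split_first_two: "norm (v :: real^3) \<le> norm (first_two v) + \<bar>v $ 3\<bar>"
proof (rule power2_le_imp_le)
  have "(norm v)\<^sup>2 = (norm (first_two v))\<^sup>2 + (v $ 3)\<^sup>2"
    unfolding power2_norm_eq_inner by (simp add: inner_vec_def sum_3 sum_2 first_two_def power2_eq_square)
  also have "\<dots> \<le> (norm (first_two v) + \<bar>v $ 3\<bar>)\<^sup>2"
    by (simp add: power2_sum)
  finally show "(norm v)\<^sup>2 \<le> (norm (first_two v) + \<bar>v $ 3\<bar>)\<^sup>2" .
qed simp

lemma open_contains_product_box: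
  assumes "open S" "q \<in> S"
  obtains W J where "open W" "open J" "convex J" "first_two q \<in> W" "q $ 3 \<in> J"
    "\<And>v. first_two v \<in> W \<Longrightarrow> v $ 3 \<in> J \<Longrightarrow> v \<in> S"
proof -
  obtain e where e: "e > 0" "ball q e \<subseteq> S" using assms open_contains_ball by blast
  have "v \<in> S" if "first_two v \<in> ball (first_two q) (e/2)" "v $ 3 \<in> ball (q $ 3) (e/2)" for v
  proof -
    have "first_two (v - q) = first_two v - first_two q"
      using linear_diff[OF bounded_linear.linear[OF bounded_linear_first_two]] .
    moreover have "norm (first_two v - first_two q) < e / 2" "\<bar>v $ 3 - q $ 3\<bar> < e / 2"
      using that by (simp_all add: dist_norm norm_minus_commute abs_minus_commute)
    ultimately have "norm (v - q) < e"
      using norm_split_first_two[of "v - q"] by simp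
    then show ?thesis using e(2) by (auto simp: dist_norm norm_minus_commute)
  qed
  then show thesis using e(1) by (intro that[of "ball (first_two q) (e/2)" "ball (q $ 3) (e/2)"]) auto
qed

lemma null_frame_subset:
  assumes "null_frame V x c s" "open V1" "V1 \<subseteq> V"
  shows "null_frame V1 x c s"
proof -
  interpret null_frame V x c s by fact
  show ?thesis
    using assms(2,3) smooth_on_subset[OF smooth_x assms(3)] smooth_on_subset[OF smooth_c assms(3)]
      smooth_on_subset[OF smooth_s assms(3)] horospherical cs pd1_c pd1_s kernel cokernel
    by unfold_locales (auto simp: horospherical_on_def)
qed

text \<open>Reversing the frame changes the sign of \<open>\<kappa>\<close>, which allows a nonzero
  \<open>\<kappa>\<close> to be taken positive.\<close>

lemma null_frame_minus:
  assumes "null_frame V x c s"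
  shows "null_frame V x (\<lambda>u. - c u) (\<lambda>u. - s u)"
proof -
  interpret null_frame V x c s by fact
  have "pd 1 (\<lambda>u. - c u) u = 0" "pd 1 (\<lambda>u. - s u) u = 0" if "u \<in> V" for u
    using that deriv_along_minus[OF smooth_c that, of "\<lambda>u. axis 1 1"] deriv_along_minus[OF smooth_s that, of "\<lambda>u. axis 1 1"]
      pd1_c pd1_s by (simp_all add: deriv_along_axis)
  moreover have "- c u *\<^sub>R pd 2 (bianchi x) u + - s u *\<^sub>R pd 3 (bianchi x) u \<noteq> 0" if "u \<in> V" for u
  proof -
    have "- c u *\<^sub>R pd 2 (bianchi x) u + - s u *\<^sub>R pd 3 (bianchi x) u =
        - (c u *\<^sub>R pd 2 (bianchi x) u + s u *\<^sub>R pd 3 (bianchi x) u)" by simp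
    then show ?thesis using cokernel[OF that] by (simp only: neg_equal_0_iff_equal not_False_eq_True)
  qed
  ultimately show ?thesis
    using horospherical cs kernel by unfold_locales auto
qed

context rotating_frame
begin

text \<open>\<open>\<tau>\<close> is required to be inverted by \<open>\<psi>\<close> only on
  \<open>S\<close>. Cutting down to a product box inside \<open>S\<close> around
  \<open>\<psi> p\<close> provides the shape that an adapted chart needs.\<close>

lemma adapted_chart_exists:
  assumes V0: "open V0" "V0 \<subseteq> V" "p \<in> V0" and \<psi>: "smooth_on V0 \<psi>" and \<tau>: "smooth_on UNIV \<tau>"
    and inv: "\<And>u. u \<in> V0 \<Longrightarrow> \<tau> (\<psi> u) = u"
    and S: "open S" "\<psi> p \<in> S" "\<And>v. v \<in> S \<Longrightarrow> \<tau> v \<in> V0" "\<And>v. v \<in> S \<Longrightarrow> \<psi> (\<tau> v) = v"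
    and pd: "\<And>v. v \<in> S \<Longrightarrow> pd 1 \<tau> v = axis 1 1" "\<And>v. v \<in> S \<Longrightarrow> pd 2 \<tau> v = l *\<^sub>R X2 (\<tau> v)"
      "\<And>v. v \<in> S \<Longrightarrow> pd 3 \<tau> v = \<mu> v *\<^sub>R X3 (\<tau> v)"
    and l: "l \<noteq> 0"
  obtains V' W J j where "p \<in> V'" "V' \<subseteq> V0" "adapted_chart V x c s N \<omega> V' \<psi> \<tau> W J j l \<mu>"
proof -
  obtain W J where WJ: "open W" "open J" "convex J" "first_two (\<psi> p) \<in> W" "\<psi> p $ 3 \<in> J"
    and sub: "\<And>v. first_two v \<in> W \<Longrightarrow> v $ 3 \<in> J \<Longrightarrow> v \<in> S"
    by (rule open_contains_product_box[OF S(1,2)]) (rule that; assumption)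
  let ?O = "{v. first_two v \<in> W \<and> v $ 3 \<in> J}"
  have O: "open ?O" by (rule open_product_box[OF WJ(1,2)])
  define V' where "V' = V0 \<inter> \<psi> -` ?O"
  have "open V'"
    unfolding V'_def by (rule continuous_open_preimage[OF smooth_on_continuous[OF \<psi>] V0(1) O])
  moreover have "p \<in> V'" "V' \<subseteq> V0" using V0 WJ by (auto simp: V'_def)
  moreover have "adapted_chart V x c s N \<omega> V' \<psi> \<tau> W J (\<psi> p $ 3) l \<mu>"
  proof
    show "open V'" by fact
    show "V' \<subseteq> V" "smooth_on V' \<psi>" using V0 \<psi> by (auto simp: V'_def intro: smooth_on_subset)
    show "smooth_on ?O \<tau>" using \<tau> by (rule smooth_on_subset) simp
    show "\<tau> v \<in> V'" "\<psi> (\<tau> v) = v" "pd 1 \<tau> v = axis 1 1" "pd 2 \<tau> v = l *\<^sub>R X2 (\<tau> v)" "pd 3 \<tau> v = \<mu> v *\<^sub>R X3 (\<tau> v)"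
      if "first_two v \<in> W" "v $ 3 \<in> J" for v
      using S(3,4)[OF sub[OF that]] pd[OF sub[OF that]] that by (auto simp: V'_def)
    show "first_two (\<psi> u) \<in> W" "\<psi> u $ 3 \<in> J" "\<tau> (\<psi> u) = u" if "u \<in> V'" for u
      using that inv by (auto simp: V'_def)
  qed (use WJ l in auto)
  ultimately show thesis using that by blast
qed

end

lemma (in adapted_chart) local_surface_chart:
  "V' \<subseteq> U \<Longrightarrow> local_surface U (bianchi x) V' (\<lambda>u. first_two (\<psi> u)) W ybar"
  unfolding local_surface_def using smooth_\<pi> image_W ybar_immersion ybar by simp

section \<open>The case of straight null curves\<close>

context null_frame
begin

lemma d_nth:
  fixes X :: "real^3 \<Rightarrow> real^3"
  shows "deriv_along X (\<lambda>u. u $ i) u = X u $ i"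
  using deriv_alongI[OF has_derivative_nth, of X i u] by simp

lemma X_nth [simp]: "X2 u $ 1 = 0" "X2 u $ 2 = c u" "X2 u $ 3 = s u" "X3 u $ 1 = 0" "X3 u $ 2 = - s u" "X3 u $ 3 = c u"
  by (simp_all add: X2_def X3_def axis_def)

text \<open>For \<open>\<kappa> = 0\<close> the direction \<open>(c, s)\<close> and the length
  \<open>k\<close> of \<open>f\<close> are constant. The admissible change shifts \<open>u1\<close>
  by \<open>ln k\<close> and scales the horosphere by \<open>k\<close>: this absorbs the factor
  \<open>1 / k\<close> in \<open>\<rho>\<close> and turns the angle \<open>\<omega>\<close> into the
  third coordinate.\<close>

theorem line_form:
  assumes V: "convex V" "p \<in> V" and \<kappa>0: "\<And>u. u \<in> V \<Longrightarrow> \<kappa> u = 0"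
  obtains V' \<pi> W y where "open V'" "p \<in> V'" "V' \<subseteq> V" "line_form_on V' x" "local_surface V (bianchi x) V' \<pi> W y"
proof -
  define c0 where "c0 = c p"
  define s0 where "s0 = s p"
  define k where "k = sqrt (N2 p)"
  have const: "F u = F p" if "smooth_on V F" "\<And>u. u \<in> V \<Longrightarrow> d1 F u = 0" "\<And>u. u \<in> V \<Longrightarrow> d2 F u = 0" "\<And>u. u \<in> V \<Longrightarrow> d3 F u = 0" "u \<in> V"
    for F :: "real^3 \<Rightarrow> real" and u
    using constant_on_convex[OF V(1) that(1-4) that(5) V(2)] .
  have c: "c u = c0" and s: "s u = s0" if "u \<in> V" for u
    unfolding c0_def s0_def using that \<kappa>0 by (intro const; simp add: d2_cs d_cs3)+
  have k: "k > 0" "k * k = N2 u" if "u \<in> V" for u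
    using const[of N2, OF _ _ _ _ that] N2_pos[OF V(2)] \<kappa>0 by (simp_all add: k_def d_N2)
  have cs0: "c0 * c0 + s0 * s0 = 1" using cs[OF V(2)] by (simp add: c0_def s0_def)
  have k0: "k > 0" by (rule k(1)[OF V(2)])
  define \<omega> :: "real^3 \<Rightarrow> real" where "\<omega> u = k * (c0 * u $ 3 - s0 * u $ 2)" for u
  have smn: "smooth_on V (\<lambda>u. u $ i)" for i by simp
  have d\<omega>: "deriv_along X \<omega> u = k * (c0 * X u $ 3 - s0 * X u $ 2)" for X u
    unfolding \<omega>_def[abs_def]
    by (rule deriv_alongI) (auto intro!: derivative_eq_intros has_derivative_nth)
  interpret R: rotating_frame V x c s "\<lambda>u. k" \<omega>
  proof
    show "smooth_on V \<omega>" unfolding \<omega>_def[abs_def] by simp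
    show "d1 \<omega> u = 0" "d2 \<omega> u = 0" "d3 \<omega> u = k" if "u \<in> V" for u
      using cs0 by (simp_all add: d\<omega> c[OF that] s[OF that] axis_def)
  qed (use k V in auto)
  define \<psi> :: "real^3 \<Rightarrow> real^3" where "\<psi> u = vector [u $ 1 + ln k, k * (c0 * u $ 2 + s0 * u $ 3), \<omega> u]" for u
  define \<tau> :: "real^3 \<Rightarrow> real^3" where "\<tau> v = vector [v $ 1 - ln k, (c0 * v $ 2 - s0 * v $ 3) / k, (s0 * v $ 2 + c0 * v $ 3) / k]" for v
  have \<tau>': "(\<tau> has_derivative (\<lambda>h. vector [h $ 1, (c0 * h $ 2 - s0 * h $ 3) / k, (s0 * h $ 2 + c0 * h $ 3) / k])) (at v)" for v
    unfolding \<tau>_def[abs_def]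
    by (rule has_derivative_vector3) (use k0 in \<open>auto intro!: derivative_eq_intros has_derivative_nth simp: diff_divide_distrib add_divide_distrib\<close>)
  have pd\<tau>: "pd i \<tau> v = vector [axis i 1 $ 1, (c0 * axis i 1 $ 2 - s0 * axis i 1 $ 3) / k, (s0 * axis i 1 $ 2 + c0 * axis i 1 $ 3) / k]" for i v
    unfolding pd_def frechet_derivative_at[OF \<tau>', symmetric] ..
  have cs1: "c0 * (c0 * t) + s0 * (s0 * t) = t" for t
  proof -
    have "c0 * (c0 * t) + s0 * (s0 * t) = (c0 * c0 + s0 * s0) * t" by (simp add: algebra_simps)
    then show ?thesis unfolding cs0 by simp
  qed
  have \<tau>\<psi>: "\<tau> (\<psi> u) = u" and \<psi>\<tau>: "\<psi> (\<tau> u) = u" for u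
    using k0 cs1[of "u $ 2"] cs1[of "u $ 3"] cs1[of "k * u $ 2"] cs1[of "k * u $ 3"]
      cs1[of "k * (k * u $ 2)"] cs1[of "k * (k * u $ 3)"] unfolding \<psi>_def \<tau>_def \<omega>_def vec_eq_iff forall_3
    by (simp_all add: field_simps)
  have sm\<psi>: "smooth_on V \<psi>" unfolding \<psi>_def[abs_def] by (intro smooth_on_vector3) simp_all
  have sm\<tau>: "smooth_on UNIV \<tau>" unfolding \<tau>_def[abs_def] divide_inverse
    by (intro smooth_on_vector3 smooth_intros) simp_all
  have S: "open (\<tau> -` V)"
    by (rule open_vimage[OF open_V smooth_on_continuous[OF sm\<tau>]])
  obtain V' W J j where p: "p \<in> V'" "V' \<subseteq> V" and AC: "adapted_chart V x c s (\<lambda>u. k) \<omega> V' \<psi> \<tau> W J j (1 / k) (\<lambda>v. 1 / k)"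
  proof (rule R.adapted_chart_exists[where S = "\<tau> -` V", OF open_V subset_refl V(2) sm\<psi> sm\<tau> \<tau>\<psi> S])
    show "pd 1 \<tau> v = axis 1 1" "pd 2 \<tau> v = (1 / k) *\<^sub>R X2 (\<tau> v)" "pd 3 \<tau> v = (1 / k) *\<^sub>R X3 (\<tau> v)" if "v \<in> \<tau> -` V" for v
      using that unfolding pd\<tau> vec_eq_iff forall_3 by (simp_all add: axis_def c s)
  qed (use V \<tau>\<psi> \<psi>\<tau> k0 in auto)
  interpret AC: adapted_chart V x c s "\<lambda>u. k" \<omega> V' \<psi> \<tau> W J j "1 / k" "\<lambda>v. 1 / k" by (rule AC)
  obtain g xbar where g: "rigid_motion g" "immersion_on W xbar"
    "\<And>u. u \<in> V' \<Longrightarrow> g (x u) = point5 (xbar (first_two (\<psi> u))) (R.\<rho> u * cos (\<omega> u)) (R.\<rho> u * sin (\<omega> u))"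
    "\<And>w. w \<in> W \<Longrightarrow> b12 xbar w \<noteq> 0"
    "\<And>u. u \<in> V' \<Longrightarrow> metric xbar (first_two (\<psi> u)) $ 1 $ 1 = 1 - R.\<rho> u * R.\<rho> u"
    "\<And>u. u \<in> V' \<Longrightarrow> metric xbar (first_two (\<psi> u)) $ 1 $ 2 = 1 / k * \<kappa> u * R.\<rho> u * R.\<rho> u"
    "\<And>u. u \<in> V' \<Longrightarrow> metric xbar (first_two (\<psi> u)) $ 2 $ 2 = 1 / k * (1 / k) * (exp (- u $ 1) * exp (- u $ 1) - \<kappa> u * \<kappa> u * (R.\<rho> u * R.\<rho> u))"
    by (rule AC.normal_form) (rule that; assumption)
  have \<rho>: "R.\<rho> u = exp (- \<psi> u $ 1)" for u
    using k0 by (simp add: R.\<rho>_def R.n_def \<psi>_def exp_diff exp_minus field_simps)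
  have e2: "exp (- 2 * t) = exp (- t) * exp (- t)" for t :: real by (simp add: mult_exp_exp)
  have adm: "admissible_change \<psi>"
    unfolding admissible_change_def
  proof (intro exI conjI allI)
    let ?T = "\<lambda>q::real^2. vector [c0 * q $ 1 + s0 * q $ 2, c0 * q $ 2 - s0 * q $ 1] :: real^2"
    show "dist (?T q) (?T r) = dist q r" for q r
    proof -
      have "(?T q - ?T r) \<bullet> (?T q - ?T r) = (c0 * c0 + s0 * s0) * ((q - r) \<bullet> (q - r))"
        by (simp add: inner_vec_def sum_2 algebra_simps)
      then show ?thesis by (simp add: cs0 dist_norm norm_eq_sqrt_inner)
    qed
    show "\<psi> u = vector [u $ 1 + ln k, exp (ln k) * ?T (vector [u $ 2, u $ 3]) $ 1, exp (ln k) * ?T (vector [u $ 2, u $ 3]) $ 2]" for u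
      using k0 by (simp add: \<psi>_def \<omega>_def)
  qed
  have "line_form_on V' x"
    unfolding line_form_on_def Let_def
  proof (intro exI conjI ballI)
    show "rigid_motion g" "admissible_change \<psi>" by fact+
    show "W = (\<lambda>u. first_two (\<psi> u)) ` V'" by (rule AC.image_W[symmetric])
    show "immersion_on W xbar" by fact
    show "g (x u) = point5 (xbar (first_two (\<psi> u))) (exp (- \<psi> u $ 1) * cos (\<psi> u $ 3)) (exp (- \<psi> u $ 1) * sin (\<psi> u $ 3))"
      if "u \<in> V'" for u
      using g(3)[OF that] by (simp add: \<rho>) (simp add: \<psi>_def)
    show "b12 xbar w \<noteq> 0" if "w \<in> W" for w using g(4)[OF that] .
    show "metric xbar w $ 1 $ 1 = 1 - exp (- 2 * w $ 1)" "metric xbar w $ 1 $ 2 = 0" "metric xbar w $ 2 $ 2 = exp (- 2 * w $ 1)"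
      if w: "w \<in> W" for w
    proof -
      obtain u where u: "u \<in> V'" "w = first_two (\<psi> u)"
        using w unfolding AC.image_W[symmetric] by blast
      have w1: "w $ 1 = \<psi> u $ 1" unfolding u(2) by (simp add: first_two_def)
      have \<kappa>u: "\<kappa> u = 0" using \<kappa>0 u p by blast
      have "exp (- u $ 1) / k = exp (- w $ 1)"
        unfolding w1 using \<rho>[of u] k0 by (simp add: R.\<rho>_def R.n_def divide_inverse)
      moreover have "1 / k * (1 / k) * (exp (- u $ 1) * exp (- u $ 1)) = exp (- u $ 1) / k * (exp (- u $ 1) / k)"
        by simp
      ultimately have "1 / k * (1 / k) * (exp (- u $ 1) * exp (- u $ 1)) = exp (- w $ 1) * exp (- w $ 1)"
        by (simp only:)
      then show "metric xbar w $ 1 $ 1 = 1 - exp (- 2 * w $ 1)" "metric xbar w $ 1 $ 2 = 0" "metric xbar w $ 2 $ 2 = exp (- 2 * w $ 1)"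
        using g(5-7)[OF u(1)] \<rho>[of u] unfolding u(2)[symmetric] w1[symmetric] e2 \<kappa>u by simp_all
    qed
    show "\<forall>I \<gamma>. regular_curve V' I \<gamma> \<longrightarrow> null_curve (bianchi x) V' I \<gamma> \<longleftrightarrow> (\<lambda>t. first_two (\<psi> (\<gamma> t))) constant_on I"
      using AC.null_curve_iff by blast
  qed
  then show thesis
    using that[OF AC.open_V' p _ AC.local_surface_chart[OF p(2)]] by blast
qed

end

section \<open>The case of circular null curves\<close>

context null_frame
begin

text \<open>\<open>1 / \<kappa>\<close> grows with unit speed along \<open>X2\<close> and is the
  distance from a common centre, with \<open>(c, s)\<close> the radial direction. Since
  \<open>|f| = \<alpha> \<kappa>\<close> for \<open>\<alpha> = 1 / sqrt m\<close>, the rotation in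
  the plane of \<open>a\<close>, \<open>b\<close> proceeds \<open>\<alpha>\<close> times as fast as
  the polar angle.\<close>

theorem circle_form:
  assumes V: "convex V" "p \<in> V" and \<kappa>_pos: "\<And>u. u \<in> V \<Longrightarrow> \<kappa> u > 0"
    and m: "\<And>u. u \<in> V \<Longrightarrow> \<kappa> u * \<kappa> u = m * N2 u" "m > 0"
    and near: "\<And>u. u \<in> V \<Longrightarrow> c p * c u + s p * s u > 0"
  obtains V' \<pi> W y where "open V'" "p \<in> V'" "V' \<subseteq> V" "circle_form_on (1 / sqrt m) V' x" "local_surface V (bianchi x) V' \<pi> W y"
proof -
  define \<alpha> where "\<alpha> = 1 / sqrt m"
  have \<alpha>: "\<alpha> > 0" "\<alpha> * \<alpha> * m = 1" using m(2) by (simp_all add: \<alpha>_def)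
  define h where "h u = inverse (\<kappa> u)" for u
  have h: "h u > 0" "h u * \<kappa> u = 1" if "u \<in> V" for u using \<kappa>_pos[OF that] by (simp_all add: h_def)
  have smh [simp]: "smooth_on V h"
    unfolding h_def[abs_def] using \<kappa>_pos by (intro smooth_on_inverse) force+
  have dh: "d1 h u = 0" "d2 h u = 1" "d3 h u = 0" if u: "u \<in> V" for u
  proof -
    have "h u * deriv_along X \<kappa> u + deriv_along X h u * \<kappa> u = 0" for X
      using d_zero[OF u h(2), of "\<lambda>z. z" X] u by (simp add: deriv_along_mult[where U = V])
    from this[of "\<lambda>u. axis 1 1"] this[of X2] this[of X3]
    have "d1 h u * \<kappa> u = 0" "d2 h u * \<kappa> u = (h u * \<kappa> u) * \<kappa> u" "d3 h u * \<kappa> u = 0"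
      using u by (simp_all add: d1_\<kappa> d2_\<kappa> d3_f_\<kappa>)
    then show "d1 h u = 0" "d2 h u = 1" "d3 h u = 0"
      using \<kappa>_pos[OF u] unfolding h(2)[OF u] by simp_all
  qed
  \<comment> \<open>\<open>(z2, z3)\<close> is the centre of curvature of the null curve through
    \<open>p\<close>; the next step shows that it is the centre for all of \<open>V\<close>.\<close>
  define z2 where "z2 = p $ 2 - c p * h p"
  define z3 where "z3 = p $ 3 - s p * h p"
  have z: "u $ 2 = z2 + c u * h u" "u $ 3 = z3 + s u * h u" if u: "u \<in> V" for u
  proof -
    have "deriv_along X (\<lambda>u. u $ 2 - c u * h u) z = X z $ 2 - (c z * deriv_along X h z + deriv_along X c z * h z)"
      "deriv_along X (\<lambda>u. u $ 3 - s u * h u) z = X z $ 3 - (s z * deriv_along X h z + deriv_along X s z * h z)"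
      if "z \<in> V" for X z using that by (simp_all add: d_rules d_nth)
    moreover have "axis 1 (1::real) $ (2::3) = 0" "axis 1 (1::real) $ (3::3) = 0" by (simp_all add: axis_def)
    ultimately have "u $ 2 - c u * h u = p $ 2 - c p * h p \<and> u $ 3 - s u * h u = p $ 3 - s p * h p"
      using h(2)
      by (intro conjI constant_on_convex[OF V(1) _ _ _ _ u V(2)])
        (simp_all add: dh d2_cs d_cs3 mult.assoc mult.left_commute mult.commute)
    then show "u $ 2 = z2 + c u * h u" "u $ 3 = z3 + s u * h u" by (simp_all add: z2_def z3_def)
  qed
  obtain t0 where t0: "c p = cos t0" "s p = sin t0"
    using sincos_total_2pi[of "c p" "s p"] cs[OF V(2)] by (metis power2_eq_square)
  \<comment> \<open>\<open>(C, S)\<close> is \<open>(c, s)\<close> turned back by the angle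
    \<open>t0\<close> of \<open>(c p, s p)\<close>. The hypothesis \<open>near\<close> keeps it in
    the right half-plane, where \<open>arctan\<close> is a smooth branch of the angle.\<close>
  define C where "C u = c p * c u + s p * s u" for u
  define S where "S u = c p * s u - s p * c u" for u
  have C: "C u > 0" if "u \<in> V" for u using near[OF that] by (simp add: C_def)
  have CS: "C u * C u + S u * S u = 1" if u: "u \<in> V" for u
    using cs[OF u] cs[OF V(2)] unfolding C_def S_def by algebra
  define \<theta> where "\<theta> u = t0 + arctan (S u / C u)" for u
  have smCS [simp]: "smooth_on V C" "smooth_on V S" unfolding C_def[abs_def] S_def[abs_def] by simp_all
  have "smooth_on V (\<lambda>u. S u / C u)" using C by (intro smooth_on_divide) force+
  then have sm\<theta> [simp]: "smooth_on V \<theta>"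
    unfolding \<theta>_def[abs_def] by (intro smooth_on_add smooth_on_arctan smooth_on_const open_V)
  have cs\<theta>: "cos (\<theta> u) = c u" "sin (\<theta> u) = s u" if u: "u \<in> V" for u
  proof -
    have "1 + (S u / C u)\<^sup>2 = (1 / C u)\<^sup>2"
      using C[OF u] CS[OF u] by (simp add: power2_eq_square field_simps)
    then have q: "sqrt (1 + (S u / C u)\<^sup>2) = 1 / C u"
      using C[OF u] by simp
    have "cos (arctan (S u / C u)) = C u" "sin (arctan (S u / C u)) = S u"
      using C[OF u] by (simp_all add: cos_arctan sin_arctan q)
    then have "cos (\<theta> u) = c p * C u - s p * S u" "sin (\<theta> u) = s p * C u + c p * S u"
      by (simp_all add: \<theta>_def cos_add sin_add t0)
    moreover have "c p * C u - s p * S u = c u" "s p * C u + c p * S u = s u"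
      using cs[OF V(2)] unfolding C_def S_def by algebra+
    ultimately show "cos (\<theta> u) = c u" "sin (\<theta> u) = s u" by simp_all
  qed
  have d\<theta>: "deriv_along X \<theta> u = c u * deriv_along X s u - s u * deriv_along X c u" if u: "u \<in> V" for X u
  proof -
    have "deriv_along X (\<lambda>u. cos (\<theta> u)) u = deriv_along X c u"
      by (rule d_cong[OF u]) (rule cs\<theta>(1))
    moreover have "deriv_along X (\<lambda>u. sin (\<theta> u)) u = deriv_along X s u"
      by (rule d_cong[OF u]) (rule cs\<theta>(2))
    ultimately have "deriv_along X c u = - s u * deriv_along X \<theta> u" "deriv_along X s u = c u * deriv_along X \<theta> u"
      by (simp_all add: deriv_along_cos[OF sm\<theta> u] deriv_along_sin[OF sm\<theta> u] cs\<theta>[OF u])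
    then show ?thesis using cs[OF u] by algebra
  qed
  define \<omega> where "\<omega> u = \<alpha> * \<theta> u" for u
  have d\<omega>: "deriv_along X \<omega> u = \<alpha> * deriv_along X \<theta> u" if "u \<in> V" for X u
    unfolding \<omega>_def[abs_def] using that by (simp add: deriv_along_mult[where U = V])
  interpret R: rotating_frame V x c s "\<lambda>u. \<alpha> * \<kappa> u" \<omega>
  proof
    show "smooth_on V \<omega>" unfolding \<omega>_def[abs_def] by simp
    show "d1 \<omega> u = 0" "d2 \<omega> u = 0" "d3 \<omega> u = \<alpha> * \<kappa> u" if "u \<in> V" for u
      using that by (simp_all add: d\<omega> d\<theta> d2_cs \<kappa>_def)
    show "\<alpha> * \<kappa> u * (\<alpha> * \<kappa> u) = N2 u" if "u \<in> V" for u
    proof -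
      have "\<alpha> * \<kappa> u * (\<alpha> * \<kappa> u) = \<alpha> * \<alpha> * (\<kappa> u * \<kappa> u)" by simp
      also have "\<dots> = (\<alpha> * \<alpha> * m) * N2 u" unfolding m(1)[OF that] by simp
      finally show ?thesis unfolding \<alpha>(2) by simp
    qed
  qed (use V \<kappa>_pos \<alpha> in auto)
  define \<psi> :: "real^3 \<Rightarrow> real^3" where "\<psi> u = vector [u $ 1, h u, \<theta> u]" for u
  define \<tau> :: "real^3 \<Rightarrow> real^3" where "\<tau> v = vector [v $ 1, z2 + v $ 2 * cos (v $ 3), z3 + v $ 2 * sin (v $ 3)]" for v
  have \<tau>': "(\<tau> has_derivative (\<lambda>d. vector [d $ 1, d $ 2 * cos (v $ 3) - v $ 2 * sin (v $ 3) * d $ 3,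
      d $ 2 * sin (v $ 3) + v $ 2 * cos (v $ 3) * d $ 3])) (at v)" for v
    unfolding \<tau>_def[abs_def]
    by (rule has_derivative_vector3) (auto intro!: derivative_eq_intros has_derivative_nth simp: algebra_simps)
  have pd\<tau>: "pd i \<tau> v = vector [axis i 1 $ 1, axis i 1 $ 2 * cos (v $ 3) - v $ 2 * sin (v $ 3) * axis i 1 $ 3,
      axis i 1 $ 2 * sin (v $ 3) + v $ 2 * cos (v $ 3) * axis i 1 $ 3]" for i v
    unfolding pd_def frechet_derivative_at[OF \<tau>', symmetric] ..
  have \<tau>\<psi>: "\<tau> (\<psi> u) = u" if "u \<in> V" for u
    unfolding \<tau>_def \<psi>_def vec_eq_iff forall_3 using z[OF that] cs\<theta>[OF that] by (simp add: mult.commute)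
  have sm\<psi>: "smooth_on V \<psi>" unfolding \<psi>_def[abs_def] by (intro smooth_on_vector3) simp_all
  have sm\<tau>: "smooth_on UNIV \<tau>" unfolding \<tau>_def[abs_def]
    by (intro smooth_on_vector3 smooth_intros) simp_all
  have \<theta>t: "\<bar>\<theta> u - t0\<bar> < pi / 2" for u
    using arctan_bounded[of "S u / C u"] by (simp add: \<theta>_def abs_if)
  \<comment> \<open>Positive radius and an angle within \<open>pi / 2\<close> of \<open>t0\<close>
    make polar coordinates injective: two such angles differ by less than \<open>pi\<close>, which
    excludes a nonzero multiple of \<open>2 * pi\<close>.\<close>
  define Q where "Q = \<tau> -` V \<inter> {v. v $ 2 > 0 \<and> \<bar>v $ 3 - t0\<bar> < pi / 2}"
  have "open {v::real^3. v $ 2 > 0 \<and> \<bar>v $ 3 - t0\<bar> < pi / 2}"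
    by (intro open_Collect_conj open_Collect_less continuous_intros)
  then have Q: "open Q"
    unfolding Q_def using open_vimage[OF open_V smooth_on_continuous[OF sm\<tau>]] by (rule open_Int[rotated])
  have \<psi>\<tau>: "\<psi> (\<tau> v) = v" if v: "v \<in> Q" for v
  proof -
    let ?u = "\<tau> v"
    have u: "?u \<in> V" and v2: "v $ 2 > 0" and v3: "\<bar>v $ 3 - t0\<bar> < pi / 2" using v by (auto simp: Q_def)
    have e: "v $ 2 * cos (v $ 3) = h ?u * cos (\<theta> ?u)" "v $ 2 * sin (v $ 3) = h ?u * sin (\<theta> ?u)"
      using z[OF u] cs\<theta>[OF u] by (simp_all add: \<tau>_def mult.commute)
    note cc = cos_sin_squared
    have "v $ 2 * v $ 2 = h ?u * h ?u"
      using e cc[of "v $ 3"] cc[of "\<theta> ?u"] by algebra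
    then have h2: "v $ 2 = h ?u"
      using v2 h(1)[OF u] power2_eq_imp_eq[of "v $ 2" "h ?u"] by (simp add: power2_eq_square)
    then have "cos (v $ 3) = cos (\<theta> ?u)" "sin (v $ 3) = sin (\<theta> ?u)" using e v2 by simp_all
    then have "cos (v $ 3 - \<theta> ?u) = 1" using cc[of "\<theta> ?u"] by (simp add: cos_diff)
    then obtain n :: int where n: "v $ 3 - \<theta> ?u = of_int n * 2 * pi"
      using cos_one_2pi_int[of "v $ 3 - \<theta> ?u"] by blast
    have "\<bar>v $ 3 - \<theta> ?u\<bar> < pi" using v3 \<theta>t[of ?u] by linarith
    then have "(2 * \<bar>real_of_int n\<bar>) * pi < 1 * pi" unfolding n by (simp add: abs_mult)
    then have "2 * \<bar>real_of_int n\<bar> < 1" using pi_gt_zero mult_less_cancel_right_pos by blast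
    then have "n = 0" by linarith
    then have h3: "v $ 3 = \<theta> ?u" using n by simp
    have "\<psi> ?u $ 1 = v $ 1" by (simp add: \<psi>_def \<tau>_def)
    moreover have "\<psi> ?u $ 2 = h ?u" "\<psi> ?u $ 3 = \<theta> ?u" by (simp_all add: \<psi>_def)
    ultimately show ?thesis unfolding vec_eq_iff forall_3 using h2 h3 by (simp only: simp_thms)
  qed
  have pQ: "\<psi> p \<in> Q"
    using V(2) \<tau>\<psi>[OF V(2)] h(1)[OF V(2)] \<theta>t[of p] by (simp add: Q_def) (simp add: \<psi>_def)
  obtain V' W J j where p: "p \<in> V'" "V' \<subseteq> V"
    and AC: "adapted_chart V x c s (\<lambda>u. \<alpha> * \<kappa> u) \<omega> V' \<psi> \<tau> W J j 1 (\<lambda>v. v $ 2)"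
  proof (rule R.adapted_chart_exists[where S = Q, OF open_V subset_refl V(2) sm\<psi> sm\<tau> \<tau>\<psi> Q pQ])
    show "pd 1 \<tau> v = axis 1 1" "pd 2 \<tau> v = 1 *\<^sub>R X2 (\<tau> v)" "pd 3 \<tau> v = v $ 2 *\<^sub>R X3 (\<tau> v)" if v: "v \<in> Q" for v
    proof -
      have u: "\<tau> v \<in> V" using v by (simp add: Q_def)
      have "\<theta> (\<tau> v) = v $ 3" using \<psi>\<tau>[OF v] by (metis \<psi>_def vector_3(3))
      then have "c (\<tau> v) = cos (v $ 3)" "s (\<tau> v) = sin (v $ 3)" using cs\<theta>[OF u] by simp_all
      then show "pd 1 \<tau> v = axis 1 1" "pd 2 \<tau> v = 1 *\<^sub>R X2 (\<tau> v)" "pd 3 \<tau> v = v $ 2 *\<^sub>R X3 (\<tau> v)"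
        unfolding pd\<tau> vec_eq_iff forall_3 by (simp_all add: axis_def)
    qed
    show "\<tau> v \<in> V" if "v \<in> Q" for v using that by (simp add: Q_def)
  qed (use \<psi>\<tau> in auto)
  interpret AC: adapted_chart V x c s "\<lambda>u. \<alpha> * \<kappa> u" \<omega> V' \<psi> \<tau> W J j 1 "\<lambda>v. v $ 2" by (rule AC)
  obtain g xbar where g: "rigid_motion g" "immersion_on W xbar"
    "\<And>u. u \<in> V' \<Longrightarrow> g (x u) = point5 (xbar (first_two (\<psi> u))) (R.\<rho> u * cos (\<omega> u)) (R.\<rho> u * sin (\<omega> u))"
    "\<And>w. w \<in> W \<Longrightarrow> b12 xbar w \<noteq> 0"
    "\<And>u. u \<in> V' \<Longrightarrow> metric xbar (first_two (\<psi> u)) $ 1 $ 1 = 1 - R.\<rho> u * R.\<rho> u"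
    "\<And>u. u \<in> V' \<Longrightarrow> metric xbar (first_two (\<psi> u)) $ 1 $ 2 = 1 * \<kappa> u * R.\<rho> u * R.\<rho> u"
    "\<And>u. u \<in> V' \<Longrightarrow> metric xbar (first_two (\<psi> u)) $ 2 $ 2 = 1 * 1 * (exp (- u $ 1) * exp (- u $ 1) - \<kappa> u * \<kappa> u * (R.\<rho> u * R.\<rho> u))"
    by (rule AC.normal_form) (rule that; assumption)
  have \<rho>: "R.\<rho> u = 1 / \<alpha> * exp (- u $ 1) * h u" for u
    by (simp add: R.\<rho>_def R.n_def h_def divide_inverse)
  have \<psi>_nth: "\<psi> u $ 1 = u $ 1" "\<psi> u $ 2 = h u" "\<psi> u $ 3 = \<theta> u" for u by (simp_all add: \<psi>_def)
  have e2: "exp (- 2 * t) = exp (- t) * exp (- t)" for t :: real by (simp add: mult_exp_exp)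
  define \<phi> :: "real^3 \<Rightarrow> real^3" where "\<phi> u = vector [u $ 1, u $ 2 - z2, u $ 3 - z3]" for u
  have adm: "admissible_change \<phi>"
    unfolding admissible_change_def
  proof (intro exI conjI allI)
    let ?T = "\<lambda>q::real^2. vector [q $ 1 - z2, q $ 2 - z3] :: real^2"
    show "dist (?T q) (?T r) = dist q r" for q r
    proof -
      have "?T q - ?T r = q - r" by (simp add: vec_eq_iff forall_2)
      then show ?thesis by (simp add: dist_norm)
    qed
    show "\<phi> u = vector [u $ 1 + 0, exp 0 * ?T (vector [u $ 2, u $ 3]) $ 1, exp 0 * ?T (vector [u $ 2, u $ 3]) $ 2]" for u
      by (simp add: \<phi>_def)
  qed
  have "circle_form_on \<alpha> V' x"
    unfolding circle_form_on_def Let_def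
  proof (intro exI conjI ballI)
    show "rigid_motion g" "admissible_change \<phi>" by fact+
    show "smooth_on V' \<psi>" by simp
    show "\<psi> u $ 2 > 0" if "u \<in> V'" for u using h(1)[of u] that p(2) by (auto simp: \<psi>_nth)
    show "\<phi> u = polar_coords (\<psi> u)" if "u \<in> V'" for u
    proof -
      have u: "u \<in> V" using that p(2) by blast
      show ?thesis
        using z[OF u] cs\<theta>[OF u] by (simp add: \<phi>_def polar_coords_def \<psi>_nth mult.commute)
    qed
    show "W = (\<lambda>u. first_two (\<psi> u)) ` V'" by (rule AC.image_W[symmetric])
    show "immersion_on W xbar" by fact
    show "g (x u) = point5 (xbar (first_two (\<psi> u))) (1 / \<alpha> * exp (- \<psi> u $ 1) * \<psi> u $ 2 * cos (\<alpha> * \<psi> u $ 3))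
        (1 / \<alpha> * exp (- \<psi> u $ 1) * \<psi> u $ 2 * sin (\<alpha> * \<psi> u $ 3))"
      if "u \<in> V'" for u
      using g(3)[OF that] by (simp add: \<rho> \<psi>_nth \<omega>_def)
    show "b12 xbar w \<noteq> 0" if "w \<in> W" for w using g(4)[OF that] .
    show "metric xbar w $ 1 $ 1 = 1 - exp (- 2 * w $ 1) * ((w $ 2)\<^sup>2 / \<alpha>\<^sup>2)"
      "metric xbar w $ 1 $ 2 = exp (- 2 * w $ 1) * (w $ 2 / \<alpha>\<^sup>2)"
      "metric xbar w $ 2 $ 2 = exp (- 2 * w $ 1) * (1 - 1 / \<alpha>\<^sup>2)"
      if w: "w \<in> W" for w
    proof -
      obtain u where u: "u \<in> V'" "w = first_two (\<psi> u)"
        using w unfolding AC.image_W[symmetric] by blast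
      have uV: "u \<in> V" using u(1) p(2) by blast
      have w12: "w $ 1 = u $ 1" "w $ 2 = h u" unfolding u(2) by (simp_all add: first_two_def \<psi>_nth)
      have "\<kappa> u * R.\<rho> u = (h u * \<kappa> u) * (1 / \<alpha> * exp (- u $ 1))" by (simp add: \<rho>)
      then have kr: "\<kappa> u * R.\<rho> u = 1 / \<alpha> * exp (- u $ 1)" unfolding h(2)[OF uV] by simp
      have "metric xbar w $ 1 $ 1 = 1 - R.\<rho> u * R.\<rho> u" "metric xbar w $ 1 $ 2 = (\<kappa> u * R.\<rho> u) * R.\<rho> u"
        "metric xbar w $ 2 $ 2 = exp (- u $ 1) * exp (- u $ 1) - (\<kappa> u * R.\<rho> u) * (\<kappa> u * R.\<rho> u)"
        using g(5-7)[OF u(1)] unfolding u(2)[symmetric] by (simp_all add: ac_simps)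
      then show "metric xbar w $ 1 $ 1 = 1 - exp (- 2 * w $ 1) * ((w $ 2)\<^sup>2 / \<alpha>\<^sup>2)"
        "metric xbar w $ 1 $ 2 = exp (- 2 * w $ 1) * (w $ 2 / \<alpha>\<^sup>2)"
        "metric xbar w $ 2 $ 2 = exp (- 2 * w $ 1) * (1 - 1 / \<alpha>\<^sup>2)"
        using \<alpha>(1) unfolding kr unfolding w12 e2 \<rho>
        by (simp_all add: power2_eq_square field_simps)
    qed
    show "\<forall>I \<gamma>. regular_curve V' I \<gamma> \<longrightarrow> null_curve (bianchi x) V' I \<gamma> \<longleftrightarrow> (\<lambda>t. first_two (\<psi> (\<gamma> t))) constant_on I"
      using AC.null_curve_iff by blast
  qed
  then show thesis
    using that[OF AC.open_V' p _ AC.local_surface_chart[OF p(2)]] unfolding \<alpha>_def by blast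
qed

end

section \<open>From local frames to the global statement\<close>

text \<open>The frame is the kernel field normalised in the coordinates \<open>(u2, u3)\<close> and
  turned by a right angle.\<close>

lemma exists_null_frame:
  fixes U :: "(real^3) set" and x :: "real^3 \<Rightarrow> real^5"
  assumes U: "open U" and sx: "smooth_on U x" and horo: "horospherical_on U x"
    and hol: "holonomically_degenerate_on U x" and p: "p \<in> U"
  obtains V c s where "p \<in> V" "V \<subseteq> U" "null_frame V x c s"
proof -
  from bspec[OF hol[unfolded holonomically_degenerate_on_def] p]
  obtain V Y1 Y2 Y3 where Y: "open V \<and> p \<in> V \<and> V \<subseteq> U \<and> smooth_on V Y1 \<and> smooth_on V Y2 \<and> smooth_on V Y3 \<and>
    (\<forall>u\<in>V. Y1 u = axis 1 1 \<and>
       Y3 u \<noteq> 0 \<and> span {Y3 u} = {v. frechet_derivative (bianchi x) (at u) v = 0} \<and>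
       Y2 u \<noteq> 0 \<and> metric_inner x u (Y1 u) (Y2 u) = 0 \<and> metric_inner x u (Y1 u) (Y3 u) = 0 \<and>
       metric_inner x u (Y2 u) (Y3 u) = 0 \<and> lie_bracket Y1 Y2 u \<in> span {Y1 u, Y2 u} \<and>
       lie_bracket Y1 Y3 u \<in> span {Y1 u, Y3 u} \<and> lie_bracket Y2 Y3 u \<in> span {Y2 u, Y3 u})"
    by (elim exE) (rule that)
  then have V: "open V" "p \<in> V" "V \<subseteq> U" and sY: "smooth_on V Y3" by simp_all
  have H: "Y1 u = axis 1 1" "Y3 u \<noteq> 0" "span {Y3 u} = {v. frechet_derivative (bianchi x) (at u) v = 0}"
      "lie_bracket Y1 Y3 u \<in> span {Y1 u, Y3 u}" if "u \<in> V" for u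
    using Y that by blast+
  have sV: "smooth_on V x" by (rule smooth_on_subset[OF sx V(3)])
  have b: "bianchi x = (\<lambda>u. x u + pd 1 x u)" by (simp add: fun_eq_iff bianchi_def)
  have s1: "smooth_on V (pd 1 x)" by (rule smooth_on_pd[OF V(1) sV])
  have sb: "smooth_on V (bianchi x)" unfolding b by (rule smooth_on_add[OF V(1) sV s1])
  have ker: "frechet_derivative (bianchi x) (at u) v = v $ 1 *\<^sub>R pd 1 (bianchi x) u + v $ 2 *\<^sub>R pd 2 (bianchi x) u + v $ 3 *\<^sub>R pd 3 (bianchi x) u"
    if "u \<in> V" for u v
    by (simp add: frechet_derivative_pd[OF smooth_on_differentiable[OF sb that]] sum_3)
  have g: "pd i x u \<bullet> pd j x u = (if i \<noteq> j then 0 else if i = 1 then 1 else exp (- 2 * u $ 1))" if "u \<in> V" for i j u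
  proof -
    have "metric x u $ i $ j = (if i \<noteq> j then 0 else if i = 1 then 1 else exp (- 2 * u $ 1))"
      using horo that V(3) by (auto simp: horospherical_on_def)
    then show ?thesis by (simp add: metric_def)
  qed
  \<comment> \<open>Because \<open>e1\<close> has constant length, pairing the differential of
    \<open>bianchi x\<close> with \<open>e1\<close> returns the first coordinate of the argument, so
    kernel vectors are tangent to the horospheres.\<close>
  have b1: "pd k (bianchi x) u \<bullet> pd 1 x u = (if k = 1 then 1 else 0)" if u: "u \<in> V" for k u
  proof -
    have "pd k (\<lambda>u. pd 1 x u \<bullet> pd 1 x u) u = pd k (\<lambda>u. 1) u"
      by (rule pd_cong[OF V(1) u]) (simp add: g)
    then have "pd k (pd 1 x) u \<bullet> pd 1 x u = 0"
      by (simp add: pd_inner[OF s1 u s1] inner_commute) (simp add: pd_def)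
    moreover have "pd k (bianchi x) u = pd k x u + pd k (pd 1 x) u"
      unfolding b by (rule pd_add[OF s1 u sV])
    ultimately show ?thesis by (simp add: inner_add_left g[OF u])
  qed
  have kerY: "frechet_derivative (bianchi x) (at u) (Y3 u) = 0" if "u \<in> V" for u
    using H(3)[OF that] span_base[of "Y3 u" "{Y3 u}"] by blast
  have Y31: "Y3 u $ 1 = 0" if u: "u \<in> V" for u
  proof -
    have "frechet_derivative (bianchi x) (at u) (Y3 u) \<bullet> pd 1 x u = Y3 u $ 1"
      unfolding ker[OF u] by (simp add: inner_add_left b1[OF u])
    then show ?thesis unfolding kerY[OF u] by simp
  qed
  define q2 where "q2 u = Y3 u $ 2" for u
  define q3 where "q3 u = Y3 u $ 3" for u
  define r where "r u = sqrt (q2 u * q2 u + q3 u * q3 u)" for u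
  define c where "c u = q3 u / r u" for u
  define s where "s u = - q2 u / r u" for u
  have sq: "smooth_on V q2" "smooth_on V q3"
    unfolding q2_def[abs_def] q3_def[abs_def] by (rule smooth_on_nth[OF V(1) sY])+
  have q_nz: "q2 u \<noteq> 0 \<or> q3 u \<noteq> 0" if "u \<in> V" for u
    using H(2)[OF that] Y31[OF that] by (auto simp: q2_def q3_def vec_eq_iff forall_3)
  have q_pos: "q2 u * q2 u + q3 u * q3 u > 0" if "u \<in> V" for u
    using q_nz[OF that] by (auto simp: sum_squares_gt_zero_iff)
  have r: "r u > 0" "r u * r u = q2 u * q2 u + q3 u * q3 u" if "u \<in> V" for u
    using q_pos[OF that] by (simp_all add: r_def)
  have sr: "smooth_on V r"
    unfolding r_def[abs_def] using q_pos V(1) sq by (intro smooth_on_sqrt smooth_on_add smooth_on_mult)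
  have r0: "r u \<noteq> 0" if "u \<in> V" for u using r(1)[OF that] by simp
  have sc: "smooth_on V c" unfolding c_def[abs_def] by (rule smooth_on_divide[OF V(1) sq(2) sr r0])
  have ss: "smooth_on V s" unfolding s_def[abs_def]
    by (rule smooth_on_divide[OF V(1) smooth_on_minus[OF V(1) sq(1)] sr r0])
  have q: "q3 u = r u * c u" "q2 u = - (r u * s u)" if "u \<in> V" for u
    using r0[OF that] by (simp_all add: c_def s_def)
  have cs: "c u * c u + s u * s u = 1" if u: "u \<in> V" for u
  proof -
    have "(r u * r u) * (c u * c u + s u * s u) = r u * r u * 1"
      using r(2)[OF u] unfolding q[OF u] by algebra
    then show ?thesis using r0[OF u] by simp
  qed
  have kr: "c u *\<^sub>R pd 3 (bianchi x) u = s u *\<^sub>R pd 2 (bianchi x) u" if u: "u \<in> V" for u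
  proof -
    have "q2 u *\<^sub>R pd 2 (bianchi x) u + q3 u *\<^sub>R pd 3 (bianchi x) u = 0"
      using kerY[OF u] unfolding ker[OF u] by (simp add: Y31[OF u] q2_def q3_def)
    then have "r u *\<^sub>R (c u *\<^sub>R pd 3 (bianchi x) u - s u *\<^sub>R pd 2 (bianchi x) u) = 0"
      unfolding q[OF u] by (simp add: scaleR_diff_right)
    then show ?thesis using r0[OF u] by simp
  qed
  \<comment> \<open>Otherwise both directions of the horosphere would lie in the kernel, which is
    spanned by the single vector \<open>Y3 u\<close>.\<close>
  have ck: "c u *\<^sub>R pd 2 (bianchi x) u + s u *\<^sub>R pd 3 (bianchi x) u \<noteq> 0" if u: "u \<in> V" for u
  proof
    assume 0: "c u *\<^sub>R pd 2 (bianchi x) u + s u *\<^sub>R pd 3 (bianchi x) u = 0"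
    have "pd 2 (bianchi x) u = (c u * c u + s u * s u) *\<^sub>R pd 2 (bianchi x) u" by (simp add: cs[OF u])
    also have "\<dots> = c u *\<^sub>R (c u *\<^sub>R pd 2 (bianchi x) u + s u *\<^sub>R pd 3 (bianchi x) u)
        - s u *\<^sub>R (c u *\<^sub>R pd 3 (bianchi x) u - s u *\<^sub>R pd 2 (bianchi x) u)"
      by (simp add: algebra_simps)
    finally have 2: "pd 2 (bianchi x) u = 0" unfolding 0 kr[OF u] by simp
    have "pd 3 (bianchi x) u = (c u * c u + s u * s u) *\<^sub>R pd 3 (bianchi x) u" by (simp add: cs[OF u])
    also have "\<dots> = s u *\<^sub>R (c u *\<^sub>R pd 2 (bianchi x) u + s u *\<^sub>R pd 3 (bianchi x) u)
        + c u *\<^sub>R (c u *\<^sub>R pd 3 (bianchi x) u - s u *\<^sub>R pd 2 (bianchi x) u)"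
      by (simp add: algebra_simps)
    finally have 3: "pd 3 (bianchi x) u = 0" unfolding 0 kr[OF u] by simp
    have "axis 2 1 \<in> span {Y3 u}" "axis 3 1 \<in> span {Y3 u}"
      unfolding H(3)[OF u] by (simp_all add: ker[OF u] 2 3 axis_def)
    then obtain k k' where k: "axis 2 1 = k *\<^sub>R Y3 u" "axis 3 1 = k' *\<^sub>R Y3 u"
      unfolding span_singleton by blast
    have "k * q2 u = 1" "k * q3 u = 0" "k' * q3 u = 1"
      using arg_cong[OF k(1), of "\<lambda>v. v $ 2"] arg_cong[OF k(1), of "\<lambda>v. v $ 3"] arg_cong[OF k(2), of "\<lambda>v. v $ 3"]
      by (simp_all add: q2_def q3_def axis_def)
    then show False by auto
  qed
  let ?d = "deriv_along (\<lambda>u::real^3. axis 1 1)"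
  \<comment> \<open>By the bracket condition the \<open>u1\<close>-derivative of \<open>Y3\<close>
    lies in the span of the first axis and \<open>Y3\<close>, so its part in \<open>(u2, u3)\<close>
    is only rescaled and the normalised direction is constant.\<close>
  have d1: "?d c u = 0 \<and> ?d s u = 0" if u: "u \<in> V" for u
  proof -
    have "frechet_derivative Y1 (at u) = frechet_derivative (\<lambda>u. axis 1 1) (at u)"
      by (rule frechet_derivative_cong[OF V(1) u H(1)])
    then have "lie_bracket Y1 Y3 u = pd 1 Y3 u"
      by (simp add: lie_bracket_def H(1)[OF u] pd_def)
    then obtain \<alpha> \<beta> where "pd 1 Y3 u - \<alpha> *\<^sub>R axis 1 1 = \<beta> *\<^sub>R Y3 u"
      using H(4)[OF u] unfolding H(1)[OF u] span_breakdown_eq span_singleton by auto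
    then have Y': "pd 1 Y3 u = \<alpha> *\<^sub>R axis 1 1 + \<beta> *\<^sub>R Y3 u" by (simp add: algebra_simps)
    have dq: "?d q2 u = \<beta> * q2 u" "?d q3 u = \<beta> * q3 u"
      unfolding q2_def[abs_def] q3_def[abs_def] deriv_along_axis pd_linear[OF bounded_linear_vec_nth sY u] Y'
      by (simp_all add: axis_def)
    have "?d (\<lambda>u. q2 u * c u + q3 u * s u) u = (q2 u * ?d c u + ?d q2 u * c u) + (q3 u * ?d s u + ?d q3 u * s u)"
      by (simp only: deriv_along_add[OF smooth_on_mult[OF V(1) sq(2) ss] u smooth_on_mult[OF V(1) sq(1) sc]]
          deriv_along_mult[OF sc u sq(1)] deriv_along_mult[OF ss u sq(2)])
    moreover have "?d (\<lambda>u. q2 u * c u + q3 u * s u) u = 0"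
      by (rule deriv_along_zero[OF V(1) u]) (simp add: q)
    ultimately have "q2 u * ?d c u + q3 u * ?d s u + \<beta> * (q2 u * c u + q3 u * s u) = 0"
      unfolding dq by algebra
    then have "r u * (c u * ?d s u - s u * ?d c u) = 0"
      unfolding q[OF u] by (simp add: algebra_simps)
    then have 1: "c u * ?d s u = s u * ?d c u" using r0[OF u] by simp
    have "?d (\<lambda>u. c u * c u + s u * s u) u = 0"
      by (rule deriv_along_zero[OF V(1) u]) (rule cs)
    then have 2: "c u * ?d c u + s u * ?d s u = 0"
      by (simp add: deriv_along_add[OF smooth_on_mult[OF V(1) ss ss] u smooth_on_mult[OF V(1) sc sc]]
          deriv_along_mult[OF sc u sc] deriv_along_mult[OF ss u ss])
    show ?thesis using 1 2 cs[OF u] by algebra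
  qed
  have "null_frame V x c s"
  proof
    show "horospherical_on V x" using horo V(3) by (auto simp: horospherical_on_def)
    show "pd 1 c u = 0" "pd 1 s u = 0" if "u \<in> V" for u
      using d1[OF that] by (simp_all add: deriv_along_axis)
  qed (use V sV sc ss cs kr ck in auto)
  then show thesis using that V by blast
qed

section \<open>Data independent of the choice of frame\<close>

context null_frame
begin

lemma \<kappa>_r_constant:
  assumes "convex V" "p \<in> V" "q \<in> V"
  shows "\<kappa> p * r p = \<kappa> q * r q"
  by (rule constant_on_convex[OF assms(1) _ _ _ _ assms(2,3)])
    (simp_all add: d_rules d_r d1_\<kappa> d2_\<kappa> d3_f_\<kappa>)

text \<open>Orthogonal projection of \<open>v\<close> onto the plane of \<open>E3\<close> and
  \<open>f\<close>; the two vectors are orthogonal and each occurs twice, so signs drop out.\<close>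

definition proj where "proj v u = (E3 u \<bullet> v) *\<^sub>R E3 u + (inverse (N2 u) * (f u \<bullet> v)) *\<^sub>R f u"

text \<open>Along \<open>X3\<close> the vectors \<open>E3\<close> and \<open>f\<close> turn into
  multiples of each other, and in the other directions they are at most rescaled, so their plane
  does not move.\<close>

lemma proj_constant:
  assumes "convex V" "p \<in> V" "q \<in> V"
  shows "proj v p = proj v q"
proof -
  define i where "i u = inverse (N2 u)" for u
  have si [simp]: "smooth_on V i"
    unfolding i_def[abs_def] using N2_pos by (intro smooth_on_inverse) force+
  have iN: "i u * N2 u = 1" if "u \<in> V" for u using N2_pos[OF that] by (simp add: i_def)
  have di: "d1 i u = 0" "d2 i u = 2 * \<kappa> u * i u" "d3 i u = 0" if u: "u \<in> V" for u
  proof -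
    have N: "N2 u \<noteq> 0" using N2_pos[OF u] by simp
    have e: "i u * deriv_along X N2 u + deriv_along X i u * N2 u = 0" for X
      using d_zero[OF u iN, of "\<lambda>z. z" X] u by (simp add: deriv_along_mult[where U = V])
    have "d1 i u * N2 u = 0" "d3 i u * N2 u = 0"
      using e[of "\<lambda>u. axis 1 1"] e[of X3] by (simp_all only: d_N2[OF u] mult_zero_right add_0_left)
    moreover have "d2 i u * N2 u = (2 * \<kappa> u * i u) * N2 u"
      using e[of X2] unfolding d_N2[OF u] by (simp add: ac_simps)
    ultimately show "d1 i u = 0" "d2 i u = 2 * \<kappa> u * i u" "d3 i u = 0"
      using N mult_right_cancel[of "N2 u"] mult_eq_0_iff[of _ "N2 u"] by blast+
  qed
  let ?P = "\<lambda>u. (E3 u \<bullet> v) *\<^sub>R E3 u + (i u * (f u \<bullet> v)) *\<^sub>R f u"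
  have dP: "deriv_along X ?P u = (E3 u \<bullet> v) *\<^sub>R deriv_along X E3 u + (deriv_along X E3 u \<bullet> v) *\<^sub>R E3 u
      + ((i u * (f u \<bullet> v)) *\<^sub>R deriv_along X f u + (i u * (deriv_along X f u \<bullet> v) + deriv_along X i u * (f u \<bullet> v)) *\<^sub>R f u)"
    if "u \<in> V" for X u
    using that by (simp add: d_rules)
  have dE: "d3 E3 u = f u" for u by (simp add: f_def)
  have "?P p = ?P q"
  proof (rule constant_on_convex[OF assms(1) _ _ _ _ assms(2,3)])
    show "smooth_on V ?P" by simp
    show "d1 ?P u = 0" "d2 ?P u = 0" if u: "u \<in> V" for u
      unfolding dP[OF u] using u by (simp_all add: di d1_E3 d2_E3 d1_f d2_f algebra_simps)
    show "d3 ?P u = 0" if u: "u \<in> V" for u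
    proof -
      have "d3 ?P u = (f u \<bullet> v) *\<^sub>R E3 u - ((i u * N2 u) * (f u \<bullet> v)) *\<^sub>R E3 u
          + ((E3 u \<bullet> v) *\<^sub>R f u - ((i u * N2 u) * (E3 u \<bullet> v)) *\<^sub>R f u)"
        unfolding dP[OF u] di(3)[OF u] dE d3_f_\<kappa>(2)[OF u] by (simp add: algebra_simps)
      then show ?thesis unfolding iN[OF u] by simp
    qed
  qed
  then show ?thesis by (simp add: proj_def i_def)
qed

definition invariant where "invariant u = (\<kappa> u * r u, \<lambda>v. proj v u)"

end

text \<open>The kernel determines \<open>(c, s)\<close> up to a sign, which is locally constant and drops out of \<open>f\<close>.\<close>

lemma null_frame_unique:
  assumes "null_frame V x c s" "null_frame V' x c' s'" and u: "u \<in> V" "u \<in> V'"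
  shows "null_frame.\<kappa> c' s' u = (c u * c' u + s u * s' u) * null_frame.\<kappa> c s u"
    and "(c u * c' u + s u * s' u) * (c u * c' u + s u * s' u) = 1"
    and "null_frame.E3 x c' s' u = (c u * c' u + s u * s' u) *\<^sub>R null_frame.E3 x c s u"
    and "null_frame.f x c' s' u = null_frame.f x c s u"
proof -
  define Z where "Z = V \<inter> V'"
  have "open V" "open V'" using assms null_frame.open_V by blast+
  then have Z: "open Z" "Z \<subseteq> V" "Z \<subseteq> V'" "u \<in> Z" using u by (auto simp: Z_def)
  interpret A: null_frame Z x c s by (rule null_frame_subset[OF assms(1) Z(1,2)])
  interpret B: null_frame Z x c' s' by (rule null_frame_subset[OF assms(2) Z(1,3)])
  \<comment> \<open>The sign relating the two frames: both are unit normals to the same line, so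
    \<open>t\<close> is 1 or -1, and smoothness with \<open>t * t = 1\<close> makes its derivatives
    vanish.\<close>
  define t where "t z = c z * c' z + s z * s' z" for z
  have st [simp]: "smooth_on Z t" unfolding t_def[abs_def] by simp
  have ct: "c' z = t z * c z" "s' z = t z * s z" if z: "z \<in> Z" for z
  proof -
    let ?b2 = "pd 2 (bianchi x) z" and ?b3 = "pd 3 (bianchi x) z"
    have "?b2 = c z *\<^sub>R A.B z - s z *\<^sub>R A.d3 (bianchi x) z" "?b3 = s z *\<^sub>R A.B z + c z *\<^sub>R A.d3 (bianchi x) z"
      unfolding A.B_def using A.pd_frame[OF A.smooth_fields(3) z] by simp_all
    then have "?b2 = c z *\<^sub>R A.B z" "?b3 = s z *\<^sub>R A.B z"
      by (simp_all add: A.d3_bianchi[OF z])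
    then have "(c' z * s z - s' z * c z) *\<^sub>R A.B z = 0"
      using B.kernel[OF z] by (simp add: scaleR_diff_left)
    then have e: "c' z * s z = s' z * c z" using A.B_nonzero[OF z] by simp
    show "c' z = t z * c z" "s' z = t z * s z"
      using e A.cs[OF z] unfolding t_def by algebra+
  qed
  have tt: "t z * t z = 1" if z: "z \<in> Z" for z
    using A.cs[OF z] B.cs[OF z] unfolding ct[OF z] by algebra
  have dt: "deriv_along X t u = 0" for X
  proof -
    have "deriv_along X (\<lambda>z. t z * t z) u = 0" by (rule deriv_along_zero[OF Z(1,4) tt])
    then have "t u * deriv_along X t u = 0" by (simp add: deriv_along_mult[OF st Z(4) st])
    moreover have "t u \<noteq> 0" using tt[OF Z(4)] by auto
    ultimately show ?thesis by simp
  qed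
  have d3: "B.d3 F z = t z *\<^sub>R A.d3 F z" if "smooth_on Z F" "z \<in> Z" for F :: "real^3 \<Rightarrow> 'e::real_normed_vector" and z
    unfolding A.d3_eq[OF that] B.d3_eq[OF that] ct[OF that(2)] by (simp add: scaleR_diff_right)
  have E3: "B.E3 z = t z *\<^sub>R A.E3 z" if "z \<in> Z" for z
    unfolding A.E3_def B.E3_def d3[OF A.smooth_x that] by simp
  show "null_frame.E3 x c' s' u = (c u * c' u + s u * s' u) *\<^sub>R null_frame.E3 x c s u"
    using E3[OF Z(4)] by (simp add: t_def)
  have "B.f u = t u *\<^sub>R A.d3 (\<lambda>z. t z *\<^sub>R A.E3 z) u"
    unfolding B.f_def d3[OF B.smooth_fields(2) Z(4)] using A.d_cong[OF Z(4) E3] by simp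
  also have "\<dots> = (t u * t u) *\<^sub>R A.f u"
    by (simp add: deriv_along_scaleR[OF A.smooth_fields(2) Z(4) st] dt A.f_def)
  finally show f: "null_frame.f x c' s' u = null_frame.f x c s u" by (simp add: tt[OF Z(4)])
  show "(c u * c' u + s u * s' u) * (c u * c' u + s u * s' u) = 1"
    using tt[OF Z(4)] by (simp add: t_def)
  have "B.\<kappa> u = t u * t u * B.\<kappa> u" by (simp add: tt[OF Z(4)])
  have E2: "B.E2 u = t u *\<^sub>R A.E2 u"
    unfolding A.E2_def B.E2_def A.d2_eq[OF A.smooth_x Z(4)] B.d2_eq[OF A.smooth_x Z(4)] ct[OF Z(4)]
    by (simp add: scaleR_add_right ac_simps)
  have "B.\<kappa> u = t u * A.\<kappa> u"
    using A.f_frame(2)[OF Z(4)] B.f_frame(2)[OF Z(4)] unfolding f E2 by simp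
  then show "null_frame.\<kappa> c' s' u = (c u * c' u + s u * s' u) * null_frame.\<kappa> c s u" by (simp add: t_def)
qed

lemma affine_orthogonal_to_pair:
  fixes a b y0 :: "real^5"
  assumes nz: "a \<noteq> 0" "b \<noteq> 0" and ab: "a \<bullet> b = 0"
  shows "affine {y. a \<bullet> y = a \<bullet> y0 \<and> b \<bullet> y = b \<bullet> y0}" "aff_dim {y. a \<bullet> y = a \<bullet> y0 \<and> b \<bullet> y = b \<bullet> y0} = 3"
proof -
  let ?S = "{y. a \<bullet> y = 0 \<and> b \<bullet> y = 0}" and ?A = "{y. a \<bullet> y = a \<bullet> y0 \<and> b \<bullet> y = b \<bullet> y0}"
  note S = orthogonal_complement_of_pair[OF nz ab]
  have "y \<in> (+) y0 ` ?S" if "y \<in> ?A" for y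
  proof (rule image_eqI)
    show "y = y0 + (y - y0)" by simp
    show "y - y0 \<in> ?S" using that by (simp add: inner_diff_right)
  qed
  then have A: "?A = (+) y0 ` ?S" by (auto simp: inner_add_right)
  show "affine ?A" unfolding A affine_translation[symmetric] by (rule subspace_imp_affine[OF S(1)])
  show "aff_dim ?A = 3" unfolding A aff_dim_translation_eq aff_dim_subspace[OF S(1)] S(2) by simp
qed

text \<open>The description is nonempty at points covered by a frame; as it does not depend on the frame,
  the choice is locally constant even though frames only exist locally.\<close>

definition frame_invariant :: "(real^3 \<Rightarrow> real^5) \<Rightarrow> real^3 \<Rightarrow> real \<times> (real^5 \<Rightarrow> real^5)" where
  "frame_invariant x u = (SOME d. \<exists>V c s. null_frame V x c s \<and> u \<in> V \<and>
     d = null_frame.invariant x c s u)"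

lemma frame_invariant_eq:
  assumes "null_frame V x c s" "u \<in> V"
  shows "frame_invariant x u = null_frame.invariant x c s u"
  unfolding frame_invariant_def
proof (rule some_equality)
  show "\<exists>V c' s'. null_frame V x c' s' \<and> u \<in> V \<and>
     null_frame.invariant x c s u
     = null_frame.invariant x c' s' u"
    using assms by blast
next
  fix d
  assume "\<exists>V c s. null_frame V x c s \<and> u \<in> V \<and>
     d = null_frame.invariant x c s u"
  then obtain V' c' s' where F: "null_frame V' x c' s'" "u \<in> V'"
    and d: "d = null_frame.invariant x c' s' u" by blast
  interpret A: null_frame V x c s by fact
  interpret B: null_frame V' x c' s' by fact
  define t where "t = c u * c' u + s u * s' u"
  note T = null_frame_unique[OF assms(1) F(1) assms(2) F(2), folded t_def]
  have "B.\<kappa> u * B.r u = (t * t) * (A.\<kappa> u * A.r u)"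
    unfolding A.r_def B.r_def T(1) T(4) by (simp add: ac_simps)
  moreover have "B.proj v u = ((t * t) * (A.E3 u \<bullet> v)) *\<^sub>R A.E3 u + (inverse (A.N2 u) * (A.f u \<bullet> v)) *\<^sub>R A.f u" for v
    unfolding B.proj_def T(3) T(4) by (simp add: ac_simps)
  ultimately show "d = A.invariant u"
    unfolding d T(2) B.invariant_def A.invariant_def by (simp add: A.proj_def)
qed

lemma null_frame_ball:
  assumes "null_frame V x c s" "p \<in> V"
  obtains e where "e > 0" "ball p e \<subseteq> V" "null_frame (ball p e) x c s"
proof -
  have "open V" using assms(1) null_frame.open_V by blast
  then obtain e where "e > 0" "ball p e \<subseteq> V" using assms(2) open_contains_ball by blast
  then show thesis using that null_frame_subset[OF assms(1) open_ball] by blast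
qed

text \<open>On a ball inside one frame domain both components are constant by convexity;
  connectedness of \<open>U\<close> passes from local to global constancy.\<close>

lemma frame_invariant_constant:
  assumes "connected U" "open U" and fr: "\<And>p. p \<in> U \<Longrightarrow> \<exists>V c s. p \<in> V \<and> V \<subseteq> U \<and> null_frame V x c s"
    and "p \<in> U" "q \<in> U"
  shows "frame_invariant x p = frame_invariant x q"
proof -
  have "frame_invariant x constant_on U"
  proof (rule locally_constant_imp_constant[OF assms(1)])
    fix a assume a: "a \<in> U"
    then obtain V c s where V: "a \<in> V" "V \<subseteq> U" "null_frame V x c s" using fr by blast
    then obtain e where e: "e > 0" "ball a e \<subseteq> V" "null_frame (ball a e) x c s"
      using null_frame_ball by blast
    interpret F: null_frame "ball a e" x c s by fact
    have ab: "a \<in> ball a e" using e(1) by simp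
    have "frame_invariant x z = frame_invariant x a" if z: "z \<in> ball a e" for z
      unfolding frame_invariant_eq[OF e(3) z] frame_invariant_eq[OF e(3) ab]
      using F.\<kappa>_r_constant[OF convex_ball z ab] F.proj_constant[OF convex_ball z ab] by (simp add: F.invariant_def)
    moreover have "openin (top_of_set U) (ball a e)"
      using e(2) V(2) by (intro open_subset) auto
    ultimately show "\<exists>T. openin (top_of_set U) T \<and> a \<in> T \<and> (\<forall>z\<in>T. frame_invariant x z = frame_invariant x a)"
      using ab by blast
  qed
  then show ?thesis using assms(4,5) by (auto simp: constant_on_def)
qed

theorem mainTheorem1:
  fixes U :: "(real^3) set" and x :: "real^3 \<Rightarrow> real^5"
  assumes "open U" and "connected U"
    and "pseudospherical_on U x"
    and "horospherical_on U x"
    and "degenerate_rank2_on U (bianchi x)"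
    and "holonomically_degenerate_on U x"
  shows "(\<exists>A. affine A \<and> aff_dim A = 3 \<and> bianchi x ` U \<subseteq> A) \<and>
    (\<exists>K\<le>-1. represents_surface_of_curvature U (bianchi x) K \<and>
       (K = -1 \<longrightarrow> (\<forall>p\<in>U. \<exists>V. open V \<and> p \<in> V \<and> V \<subseteq> U \<and> line_form_on V x)) \<and>
       (K < -1 \<longrightarrow> (\<exists>a>1. K = - (a\<^sup>2 / (a\<^sup>2 - 1)) \<and>
          (\<forall>p\<in>U. \<exists>V. open V \<and> p \<in> V \<and> V \<subseteq> U \<and> circle_form_on a V x))))"
proof (cases "U = {}")
  case True
  \<comment> \<open>For empty \<open>U\<close> every three-dimensional affine subspace and
    \<open>K = -1\<close> will do.\<close>
  have "(axis 1 1 :: real^5) \<noteq> 0" "(axis 2 1 :: real^5) \<noteq> 0" "(axis 1 1 :: real^5) \<bullet> axis 2 1 = 0"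
    by (simp_all add: axis_eq_0_iff inner_axis_axis)
  from affine_orthogonal_to_pair[OF this, of 0]
  have "\<exists>A. affine A \<and> aff_dim A = 3 \<and> bianchi x ` U \<subseteq> (A :: (real^5) set)"
    unfolding True by blast
  moreover have "represents_surface_of_curvature U (bianchi x) (-1)"
    unfolding represents_surface_of_curvature_def local_surface_def True by auto
  ultimately show ?thesis
    by (intro conjI, blast, intro exI[of _ "-1"]) (simp add: True)
next
  case False
  have sx: "smooth_on U x"
    using assms(3) by (simp add: pseudospherical_on_def immersion_on_def)
  have fr: "\<exists>V c s. p \<in> V \<and> V \<subseteq> U \<and> null_frame V x c s" if "p \<in> U" for p
    using exists_null_frame[OF assms(1) sx assms(4,6) that] by metis
  obtain p0 where p0: "p0 \<in> U" using False by blast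
  \<comment> \<open>The common value of \<open>\<kappa>^2 / |f|^2\<close> on \<open>U\<close>;
    \<open>P\<close> below is the projection onto the common plane.\<close>
  define m where "m = fst (frame_invariant x p0)"
  define P where "P = snd (frame_invariant x p0)"
  have inv: "null_frame.\<kappa> c s u * null_frame.r x c s u = m" "(\<lambda>v. null_frame.proj x c s v u) = P"
    if "null_frame V x c s" "u \<in> V" "u \<in> U" for V c s u
    using frame_invariant_eq[OF that(1,2)] frame_invariant_constant[OF assms(2,1) fr p0 that(3)]
    by (simp_all add: m_def P_def null_frame.invariant_def[OF that(1)])
  have ratio: "null_frame.\<kappa> c s u * null_frame.\<kappa> c s u = m * (null_frame.f x c s u \<bullet> null_frame.f x c s u)"
    if F: "null_frame V x c s" and u: "u \<in> V" "u \<in> U" for V c s u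
  proof -
    interpret A: null_frame V x c s by (rule F)
    show ?thesis using inv(1)[OF F u] A.N2_pos[OF u(1)] by (auto simp: A.r_def field_simps)
  qed
  have m: "0 \<le> m" "m < 1"
  proof -
    obtain V c s where V: "p0 \<in> V" "null_frame V x c s" using fr[OF p0] by blast
    interpret A: null_frame V x c s by (rule V(2))
    have e: "A.\<kappa> p0 * A.\<kappa> p0 = m * A.N2 p0" by (rule ratio[OF V(2,1) p0])
    have N: "A.N2 p0 > 0" "A.\<kappa> p0 * A.\<kappa> p0 < A.N2 p0"
      using A.N2_pos[OF V(1)] A.\<kappa>_less[OF V(1)] .
    show "0 \<le> m" using e N(1) by (metis zero_le_square zero_le_mult_iff less_le_not_le)
    have "m * A.N2 p0 < 1 * A.N2 p0" using e N(2) by simp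
    then show "m < 1" using mult_less_cancel_right_pos[OF N(1)] by blast
  qed
  have smb: "smooth_on U (bianchi x)"
    using sx assms(1) by (simp add: bianchi_def[abs_def] smooth_on_add smooth_on_pd)
  \<comment> \<open>The plane of \<open>E3\<close> and \<open>f\<close> is orthogonal to the
    transformed surface, so \<open>P\<close> annihilates its tangent vectors. Hence \<open>P\<close>
    is constant on the surface, which confines it to a translate of the three-dimensional
    complement.\<close>
  have Pd: "P (frechet_derivative (bianchi x) (at u) h) = 0" if u: "u \<in> U" for u h
  proof -
    obtain V c s where V: "u \<in> V" "null_frame V x c s" using fr[OF u] by blast
    interpret A: null_frame V x c s by (rule V(2))
    have bd: "bianchi x differentiable (at u)" by (rule smooth_on_differentiable[OF smb u])
    have "E \<bullet> frechet_derivative (bianchi x) (at u) h = 0"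
      if "E \<bullet> A.d1 (bianchi x) u = 0" "E \<bullet> A.B u = 0" for E
      unfolding frechet_derivative_pd[OF bd] sum_3 A.pd_frame[OF A.smooth_fields(3) V(1)] A.d3_bianchi[OF V(1)]
      using that by (simp add: inner_simps A.B_def deriv_along_axis)
    then show ?thesis
      using A.bianchi_normal[OF V(1)] unfolding inv(2)[OF V(2,1) u, symmetric] by (simp add: A.proj_def)
  qed
  obtain V0 c0 s0 where V0: "p0 \<in> V0" "null_frame V0 x c0 s0" using fr[OF p0] by blast
  interpret A0: null_frame V0 x c0 s0 by (rule V0(2))
  have P: "P v = A0.proj v p0" for v using fun_cong[OF inv(2)[OF V0(2,1) p0], of v] by simp
  have linP: "bounded_linear P"
    unfolding P[abs_def] A0.proj_def
    by (intro bounded_linear_add bounded_linear_scaleR_const bounded_linear_const_mult bounded_linear_inner_right)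
  have Pb: "P (bianchi x u) = P (bianchi x p0)" if u: "u \<in> U" for u
  proof (rule has_derivative_zero_unique_connected[OF assms(1,2) _ u p0])
    fix z assume z: "z \<in> U"
    show "((\<lambda>u. P (bianchi x u)) has_derivative (\<lambda>h. 0)) (at z)"
      using bounded_linear.has_derivative[OF linP smooth_on_has_derivative[OF smb z]] by (simp add: Pd[OF z])
  qed
  have EP: "A0.E3 p0 \<bullet> P v = A0.E3 p0 \<bullet> v" "A0.f p0 \<bullet> P v = A0.f p0 \<bullet> v" for v
    using A0.frame(6)[OF V0(1)] A0.f_frame(3)[OF V0(1)] A0.N2_pos[OF V0(1)]
    by (simp_all add: P A0.proj_def inner_simps inner_commute)
  define A where "A = {y. A0.E3 p0 \<bullet> y = A0.E3 p0 \<bullet> bianchi x p0 \<and> A0.f p0 \<bullet> y = A0.f p0 \<bullet> bianchi x p0}"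
  have nz: "A0.E3 p0 \<noteq> 0" "A0.f p0 \<noteq> 0" "A0.E3 p0 \<bullet> A0.f p0 = 0"
    using A0.frame(6)[OF V0(1)] A0.f_frame(3)[OF V0(1)] A0.N2_pos[OF V0(1)] by (auto simp: inner_commute)
  have "bianchi x u \<in> A" if "u \<in> U" for u
    unfolding A_def mem_Collect_eq using EP[of "bianchi x u"] EP[of "bianchi x p0"] Pb[OF that] by simp
  then have "bianchi x ` U \<subseteq> A" by blast
  then have affine_part: "\<exists>A. affine A \<and> aff_dim A = 3 \<and> bianchi x ` U \<subseteq> A"
    using affine_orthogonal_to_pair[OF nz, of "bianchi x p0", folded A_def] by (intro exI[of _ A] conjI)
  \<comment> \<open>\<open>1 - m\<close> is the squared length of \<open>\<nu>\<close>.\<close>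
  define K where "K = - 1 / (1 - m)"
  have local_form: "\<exists>V' \<pi> W y. open V' \<and> p \<in> V' \<and> V' \<subseteq> U \<and> (m = 0 \<longrightarrow> line_form_on V' x) \<and>
      (m > 0 \<longrightarrow> circle_form_on (1 / sqrt m) V' x) \<and> local_surface U (bianchi x) V' \<pi> W y" if p: "p \<in> U" for p
  proof -
    have mono: "local_surface U F V' \<pi> W y" if "local_surface V F V' \<pi> W y" "V \<subseteq> U" for V F V' \<pi> W y
      using that order_trans[of V' V U] by (simp add: local_surface_def)
    obtain V c s where V: "p \<in> V" "V \<subseteq> U" "null_frame V x c s" using fr[OF p] by blast
    show ?thesis
    proof (cases "m = 0")
      case True
      obtain e where e: "e > 0" "ball p e \<subseteq> V" "null_frame (ball p e) x c s"
        using null_frame_ball[OF V(3,1)] by blast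
      interpret F: null_frame "ball p e" x c s by (rule e(3))
      have pb: "p \<in> ball p e" using e(1) by simp
      have k0: "F.\<kappa> u = 0" if u: "u \<in> ball p e" for u
      proof -
        have "u \<in> U" using u e(2) V(2) by blast
        then show ?thesis using ratio[OF e(3) u] True by simp
      qed
      obtain V' \<pi> W y where "open V'" "p \<in> V'" "V' \<subseteq> ball p e" "line_form_on V' x"
        "local_surface (ball p e) (bianchi x) V' \<pi> W y"
        by (rule F.line_form[OF convex_ball pb]) (rule k0, assumption, (rule that; assumption))
      moreover have "ball p e \<subseteq> U" using e(2) V(2) by blast
      ultimately show ?thesis
        using True mono by (intro exI[of _ V'] exI[of _ \<pi>] exI[of _ W] exI[of _ y]) auto
    next
      case False
      then have m0: "m > 0" using m by simp
      \<comment> \<open>\<open>\<kappa>\<close> cannot vanish as \<open>m > 0\<close>; if it is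
        negative at \<open>p\<close>, the reversed frame is taken.\<close>
      have "\<exists>c s. null_frame V x c s \<and> null_frame.\<kappa> c s p > 0"
      proof -
        interpret F: null_frame V x c s by (rule V(3))
        have ne: "F.\<kappa> p \<noteq> 0" using ratio[OF V(3,1) p] m0 F.N2_pos[OF V(1)] by auto
        have "null_frame.\<kappa> (\<lambda>u. - c u) (\<lambda>u. - s u) p = (c p * - c p + s p * - s p) * F.\<kappa> p"
          by (rule null_frame_unique(1)[OF V(3) null_frame_minus[OF V(3)] V(1,1)])
        also have "c p * - c p + s p * - s p = - 1" using F.cs[OF V(1)] by simp
        finally have "null_frame.\<kappa> (\<lambda>u. - c u) (\<lambda>u. - s u) p = - F.\<kappa> p" by simp
        then show ?thesis
          using ne V(3) null_frame_minus[OF V(3)] by (cases "F.\<kappa> p > 0") (blast, smt (verit))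
      qed
      then obtain c s where G: "null_frame V x c s" "null_frame.\<kappa> c s p > 0" by blast
      interpret G: null_frame V x c s by (rule G(1))
      let ?near = "\<lambda>u. c p * c u + s p * s u"
      have "open (V \<inter> G.\<kappa> -` {0<..})" "open (V \<inter> ?near -` {0<..})"
        by (intro continuous_open_preimage smooth_on_continuous G.open_V open_greaterThan; simp)+
      then have "open (V \<inter> G.\<kappa> -` {0<..} \<inter> (V \<inter> ?near -` {0<..}))" by (rule open_Int)
      moreover have "p \<in> V \<inter> G.\<kappa> -` {0<..} \<inter> (V \<inter> ?near -` {0<..})"
        using V(1) G(2) G.cs[OF V(1)] by simp
      ultimately obtain e where e: "e > 0" "ball p e \<subseteq> V \<inter> G.\<kappa> -` {0<..} \<inter> (V \<inter> ?near -` {0<..})"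
        unfolding open_contains_ball by blast
      have bV: "ball p e \<subseteq> V" using e(2) by blast
      interpret F: null_frame "ball p e" x c s by (rule null_frame_subset[OF G(1) open_ball bV])
      have pb: "p \<in> ball p e" using e(1) by simp
      have k: "F.\<kappa> u > 0" "F.\<kappa> u * F.\<kappa> u = m * F.N2 u" "?near u > 0" if u: "u \<in> ball p e" for u
      proof -
        have "u \<in> V" "u \<in> U" using u bV V(2) by blast+
        then show "F.\<kappa> u * F.\<kappa> u = m * F.N2 u" by (rule ratio[OF G(1)])
        show "F.\<kappa> u > 0" "?near u > 0" using subsetD[OF e(2) u] by simp_all
      qed
      obtain V' \<pi> W y where "open V'" "p \<in> V'" "V' \<subseteq> ball p e" "circle_form_on (1 / sqrt m) V' x"
        "local_surface (ball p e) (bianchi x) V' \<pi> W y"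
        by (rule F.circle_form[OF convex_ball pb, where m = m])
          (rule k(1), assumption, rule k(2), assumption, rule m0, rule k(3), assumption, (rule that; assumption))
      moreover have "ball p e \<subseteq> U" using bV V(2) by blast
      ultimately show ?thesis using False mono by (intro exI[of _ V'] exI[of _ \<pi>] exI[of _ W] exI[of _ y]) auto
    qed
  qed
  have curvature: "gauss_curvature y w = K" if ls: "local_surface U (bianchi x) V1 \<pi> W y" and w: "w \<in> W" for V1 \<pi> W y w
  proof -
    have L: "open V1" "V1 \<subseteq> U" "open W" "smooth_on V1 \<pi>" "\<pi> ` V1 = W" "immersion_on W y" "\<And>u. u \<in> V1 \<Longrightarrow> bianchi x u = y (\<pi> u)"
      using ls unfolding local_surface_def by auto
    obtain u where u: "u \<in> V1" "w = \<pi> u" using w L(5) by blast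
    have uU: "u \<in> U" using u L by blast
    obtain V c s where V: "u \<in> V" "null_frame V x c s" using fr[OF uU] by blast
    have oV: "open V" by (rule null_frame.open_V[OF V(2)])
    interpret F: null_frame "V \<inter> V1" x c s
      by (rule null_frame_subset[OF V(2) open_Int[OF oV L(1)] Int_lower1])
    have uF: "u \<in> V \<inter> V1" using u V by blast
    have "gauss_curvature y (\<pi> u) = - 1 / (1 - F.\<kappa> u * F.\<kappa> u / F.N2 u)"
      using L by (intro F.gauss_curvature_bianchi[OF L(3,6) smooth_on_subset[OF L(4)] _ _ uF]) auto
    moreover have "F.\<kappa> u * F.\<kappa> u / F.N2 u = m"
      using ratio[OF V(2,1) uU] F.N2_pos[OF uF] by simp
    ultimately show ?thesis by (simp add: u(2) K_def)
  qed
  have "represents_surface_of_curvature U (bianchi x) K"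
    unfolding represents_surface_of_curvature_def
  proof (intro conjI ballI allI impI)
    show "\<exists>V \<pi> W y. p \<in> V \<and> local_surface U (bianchi x) V \<pi> W y" if "p \<in> U" for p
      using local_form[OF that] by blast
    show "gauss_curvature y w = K" if "local_surface U (bianchi x) V \<pi> W y" "w \<in> W" for V \<pi> W y w
      by (rule curvature[OF that])
  qed
  moreover have "K \<le> - 1" using m by (simp add: K_def field_simps)
  moreover have "\<exists>V. open V \<and> p \<in> V \<and> V \<subseteq> U \<and> line_form_on V x" if "K = -1" "p \<in> U" for p
  proof -
    have "m = 0" using that(1) m by (simp add: K_def field_simps)
    then show ?thesis using local_form[OF that(2)] by blast
  qed
  moreover have "\<exists>a>1. K = - (a\<^sup>2 / (a\<^sup>2 - 1)) \<and>
      (\<forall>p\<in>U. \<exists>V. open V \<and> p \<in> V \<and> V \<subseteq> U \<and> circle_form_on a V x)" if "K < -1"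
  proof -
    have m0: "m > 0" using that m by (cases "m = 0") (simp_all add: K_def)
    have "sqrt m < 1" using m by simp
    then have "1 / sqrt m > 1" using m0 by simp
    \<comment> \<open>Solving \<open>1 / (1 - m) = a^2 / (a^2 - 1)\<close> for \<open>a > 1\<close>
      gives \<open>a = 1 / sqrt m\<close>.\<close>
    moreover have "K = - ((1 / sqrt m)\<^sup>2 / ((1 / sqrt m)\<^sup>2 - 1))"
      using m m0 by (simp add: K_def power_divide field_simps)
    moreover have "\<forall>p\<in>U. \<exists>V. open V \<and> p \<in> V \<and> V \<subseteq> U \<and> circle_form_on (1 / sqrt m) V x"
    proof
      fix p assume "p \<in> U"
      from local_form[OF this] m0 show "\<exists>V. open V \<and> p \<in> V \<and> V \<subseteq> U \<and> circle_form_on (1 / sqrt m) V x"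
        by (elim exE conjE) blast
    qed
    ultimately show ?thesis by (intro exI[of _ "1 / sqrt m"] conjI)
  qed
  ultimately show ?thesis using affine_part by blast
qed

end
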